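(* There exist a family $\mathcal{W}$ of graphons, finite graphs $H_1,\ldots,H_\ell$ and reals $d_1,\ldots,d_\ell$ such that: (i) a graphon $W$ is weakly isomorphic to a graphon contained in $\mathcal{W}$ if and only if $d(H_i,W)=d_i$ for every $i\in[\ell]$; and (ii) no graphon in $\mathcal{W}$ is finitely forcible; that is, for all finite graphs $H'_1,\ldots,H'_r$ and all reals $d'_1,\ldots,d'_r$, the family $\mathcal{W}$ contains either zero or infinitely many graphons $W$ with $d(H'_i,W)=d'_i$ for all $i\in[r]$.
   Context: A graphon is a symmetric measurable function $W:[0,1)^2\to[0,1]$. For a finite graph $H$, a $W$-random graph of order $|H|$ is obtained by sampling $|H|$ points of $[0,1)$ independently and uniformly, one per vertex, and joining two vertices with probability $W(x,y)$ where $x,y$ are their points; $d(H,W)$ is the probability that this random graph is isomorphic to $H$. Two graphons $W_1,W_2$ are weakly isomorphic if $d(H,W_1)=d(H,W_2)$ for every finite graph $H$. A graphon $W$ is finitely forcible if there exist finite graphs $F_1,\ldots,F_m$ such that every graphon $W'$ with $d(F_i,W')=d(F_i,W)$ for all $i\in[m]$ is weakly isomorphic to $W$. *)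

theory Defs
  imports "HOL-Probability.Probability"
begin

type_synonym graph = "nat set \<times> nat set set"

text \<open>Simple graphs; restricting vertices to natural numbers loses nothing up to isomorphism.\<close>

definition finite_graph :: "graph \<Rightarrow> bool" where
  "finite_graph G \<longleftrightarrow> finite (fst G) \<and> snd G \<subseteq> {e. e \<subseteq> fst G \<and> card e = 2}"

definition graph_isomorphic :: "graph \<Rightarrow> graph \<Rightarrow> bool" where
  "graph_isomorphic G H \<longleftrightarrow>
    (\<exists>f. bij_betw f (fst G) (fst H) \<and>
         (\<forall>u\<in>fst G. \<forall>v\<in>fst G. {u, v} \<in> snd G \<longleftrightarrow> {f u, f v} \<in> snd H))"

definition unif01 :: "real measure" where
  "unif01 = restrict_space lborel {0..<1}"

text \<open>The extensional function space makes a graphon a function with domain exactly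
  $[0,1)^2$: values outside carry no information.  Measurability is Borel measurability.\<close>

definition graphon :: "(real \<times> real \<Rightarrow> real) \<Rightarrow> bool" where
  "graphon W \<longleftrightarrow>
     W \<in> ({0..<1} \<times> {0..<1}) \<rightarrow>\<^sub>E {0..1} \<and>
     (\<forall>x\<in>{0..<1}. \<forall>y\<in>{0..<1}. W (x, y) = W (y, x)) \<and>
     W \<in> borel_measurable (unif01 \<Otimes>\<^sub>M unif01)"

definition vertex_pairs :: "nat \<Rightarrow> (nat \<times> nat) set" where
  "vertex_pairs n = {(i, j). i < j \<and> j < n}"

text \<open>The random graph on the vertices $0,\dots,n-1$ conditioned on the points \<open>x\<close>: the
  pairs are joined independently.\<close>

definition sampled_graph_pmf :: "(real \<times> real \<Rightarrow> real) \<Rightarrow> nat \<Rightarrow> (nat \<Rightarrow> real) \<Rightarrow> graph pmf" where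
  "sampled_graph_pmf W n x =
     map_pmf (\<lambda>b. ({..<n}, {{i, j} | i j. (i, j) \<in> vertex_pairs n \<and> b (i, j)}))
       (Pi_pmf (vertex_pairs n) False (\<lambda>(i, j). bernoulli_pmf (W (x i, x j))))"

definition random_graph :: "(real \<times> real \<Rightarrow> real) \<Rightarrow> nat \<Rightarrow> graph measure" where
  "random_graph W n =
     (\<Pi>\<^sub>M i\<in>{..<n}. unif01) \<bind> (\<lambda>x. measure_pmf (sampled_graph_pmf W n x))"

definition graph_density :: "graph \<Rightarrow> (real \<times> real \<Rightarrow> real) \<Rightarrow> real" where
  "graph_density H W = measure (random_graph W (card (fst H))) {G. graph_isomorphic G H}"

definition weakly_isomorphic :: "(real \<times> real \<Rightarrow> real) \<Rightarrow> (real \<times> real \<Rightarrow> real) \<Rightarrow> bool" where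
  "weakly_isomorphic W1 W2 \<longleftrightarrow>
     (\<forall>H. finite_graph H \<longrightarrow> graph_density H W1 = graph_density H W2)"

definition weak_isomorphism_class :: "(real \<times> real \<Rightarrow> real) \<Rightarrow> (real \<times> real \<Rightarrow> real) set" where
  "weak_isomorphism_class W = {W'. graphon W' \<and> weakly_isomorphic W' W}"

definition finitely_forcible :: "(real \<times> real \<Rightarrow> real) \<Rightarrow> bool" where
  "finitely_forcible W \<longleftrightarrow>
     (\<exists>(m::nat) F. (\<forall>i\<in>{1..m}. finite_graph (F i)) \<and>
       (\<forall>W'. graphon W' \<and> (\<forall>i\<in>{1..m}. graph_density (F i) W' = graph_density (F i) W)
          \<longrightarrow> weakly_isomorphic W' W))"

lemma prob_space_unif01: "prob_space unif01"
  by (rule prob_spaceI) (simp add: unif01_def space_restrict_space emeasure_restrict_space)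

lemma space_unif01 [simp]: "space unif01 = {0..<1}"
  by (simp add: unif01_def space_restrict_space)

lemma finite_vertex_pairs [simp]: "finite (vertex_pairs n)"
  by (rule finite_subset[of _ "{..<n} \<times> {..<n}"]) (auto simp: vertex_pairs_def)

text \<open>\<open>bind\<close> yields a meaningful measure only for a measurable kernel, so
  measurability is recorded here.\<close>

lemma measurable_sampled_graph_pmf:
  assumes "graphon W"
  shows "(\<lambda>x. measure_pmf (sampled_graph_pmf W n x))
    \<in> measurable (\<Pi>\<^sub>M i\<in>{..<n}. unif01) (subprob_algebra (count_space UNIV))"
proof (rule measurable_subprob_algebra)
  fix A :: "graph set"
  let ?M = "\<Pi>\<^sub>M i\<in>{..<n}. unif01"
  let ?g = "\<lambda>b. ({..<n}, {{i, j} | i j. (i, j) \<in> vertex_pairs n \<and> b (i, j)})"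
  let ?P = "\<lambda>x. Pi_pmf (vertex_pairs n) False (\<lambda>(i, j). bernoulli_pmf (W (x i, x j)))"
  define S where "S = PiE_dflt (vertex_pairs n) False (\<lambda>_. UNIV :: bool set)"
  have fin: "finite S"
    unfolding S_def by (rule finite_PiE_dflt) auto
  have Wm: "W \<in> borel_measurable (unif01 \<Otimes>\<^sub>M unif01)"
    using assms by (simp add: graphon_def)
  have sub: "set_pmf (?P x) \<subseteq> S" for x
    using set_Pi_pmf_subset[OF finite_vertex_pairs, of n False]
    by (fastforce simp: S_def PiE_dflt_def)
  have eq: "emeasure (measure_pmf (sampled_graph_pmf W n x)) A
      = ennreal (\<Sum>b\<in>S \<inter> ?g -` A. pmf (?P x) b)" for x
  proof -
    have "measure (measure_pmf (?P x)) (?g -` A) = measure (measure_pmf (?P x)) (S \<inter> ?g -` A)"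
      by (rule measure_prob_cong_0) (use sub[of x] in \<open>auto simp: set_pmf_eq\<close>)
    then show ?thesis
      using fin by (simp add: sampled_graph_pmf_def measure_pmf.emeasure_eq_measure
          measure_measure_pmf_finite)
  qed
  have m: "(\<lambda>x. pmf (?P x) b) \<in> borel_measurable ?M" if "b \<in> S" for b
  proof -
    have "pmf (?P x) b = (\<Prod>e\<in>vertex_pairs n.
        if b e then W (x (fst e), x (snd e)) else 1 - W (x (fst e), x (snd e)))"
      if x: "x \<in> space ?M" for x
    proof -
      have "pmf (?P x) b = (\<Prod>e\<in>vertex_pairs n.
          pmf ((\<lambda>(i, j). bernoulli_pmf (W (x i, x j))) e) (b e))"
        using \<open>b \<in> S\<close> by (intro pmf_Pi') (auto simp: S_def PiE_dflt_def)
      also have "\<dots> = (\<Prod>e\<in>vertex_pairs n.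
        if b e then W (x (fst e), x (snd e)) else 1 - W (x (fst e), x (snd e)))"
      proof (rule prod.cong)
        fix e assume "e \<in> vertex_pairs n"
        then obtain i j where e: "e = (i, j)" "i < n" "j < n"
          by (auto simp: vertex_pairs_def)
        then have "x i \<in> {0..<1}" "x j \<in> {0..<1}"
          using x by (auto simp: space_PiM PiE_iff)
        then have "W (x i, x j) \<in> {0..1}"
          using assms unfolding graphon_def by blast
        then show "pmf ((\<lambda>(i, j). bernoulli_pmf (W (x i, x j))) e) (b e) =
          (if b e then W (x (fst e), x (snd e)) else 1 - W (x (fst e), x (snd e)))"
          by (simp add: e)
      qed simp
      finally show ?thesis .
    qed
    moreover have "(\<lambda>x. \<Prod>e\<in>vertex_pairs n.
        if b e then W (x (fst e), x (snd e)) else 1 - W (x (fst e), x (snd e)))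
        \<in> borel_measurable ?M"
    proof (rule borel_measurable_prod)
      fix e assume e: "e \<in> vertex_pairs n"
      then have "(\<lambda>x. (x (fst e), x (snd e))) \<in> measurable ?M (unif01 \<Otimes>\<^sub>M unif01)"
        by (intro measurable_Pair measurable_component_singleton)
           (auto simp: vertex_pairs_def)
      from measurable_compose[OF this Wm]
      have "(\<lambda>x. W (x (fst e), x (snd e))) \<in> borel_measurable ?M" .
      then show "(\<lambda>x. if b e then W (x (fst e), x (snd e)) else 1 - W (x (fst e), x (snd e)))
        \<in> borel_measurable ?M"
        by (cases "b e") auto
    qed
    ultimately show ?thesis
      by (subst measurable_cong) assumption+
  qed
  show "(\<lambda>x. emeasure (measure_pmf (sampled_graph_pmf W n x)) A) \<in> borel_measurable ?M"
    unfolding eq by (intro measurable_compose[OF _ measurable_ennreal] borel_measurable_sum m) auto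
qed (auto simp: measure_pmf.subprob_space_axioms)

lemma prob_space_random_graph:
  assumes "graphon W"
  shows "prob_space (random_graph W n)"
proof -
  interpret prob_space "\<Pi>\<^sub>M i\<in>{..<n}. unif01"
    by (rule prob_space_PiM) (rule prob_space_unif01)
  show ?thesis
    unfolding random_graph_def
    by (rule prob_space_bind[OF _ measurable_sampled_graph_pmf[OF assms]])
       (auto simp: measure_pmf.prob_space_axioms)
qed

end

theory Submission
  imports Defs
begin

text \<open>The family consists of all graphons that agree with one explicit graphon \<open>V\<close> on the densities
  of all graphs with at most \<open>N\<close> vertices.  Integrals of polynomials in the values of a graphon are
  determined by finitely many densities as long as no value is squared before one of its arguments is
  integrated out.  So, for large \<open>N\<close>, all members of the family satisfy a finite list of polynomial
  identities that hold for \<open>V\<close>.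

  The identities force a part of the graphon to consist of paths of atoms, called strands, whose length
  is \<open>1 / k\<close> at level \<open>k\<close>.  Each end of a strand carries a mark 0 or 1, and it sees strands of level
  \<open>k / 2\<close> starting with either mark and ending with either mark.  Hence there are two strands of the same,
  arbitrarily large length \<open>K\<close> whose marks differ at both ends.  Crossing these two strands
  between the positions 0 and 1 preserves all densities of graphs with fewer than \<open>K - 1\<close> vertices: a
  sample of that size misses an interior position, and exchanging the strands before that position undoes
  the crossing.  But the pairs of marks joined by the strands change, and another density detects this.
  So no finite set of densities determines a member of the family.\<close>

text \<open>Two obstacles shape the proof. A density sees only unlabelled samples, so level,
  position and mark of a point cannot be attached to it directly. They are read off as its adjacency
  to marker classes, and these are recognised by their degrees, through polynomials that are 0 or 1
  at the five prescribed degrees. Moreover, no value of \<open>W\<close> may be squared, so that a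
  vertex sees a marker class uniformly is enforced by a four-cycle integral and not by a variance.
  Masses do much of the work. All atoms of a level have the same prescribed mass, so an inclusion
  between two of them is an equality up to a null set, and exchanging two atoms of one position
  preserves the law of a sample. The identities are local: they fix how an atom is joined to the
  next one, but not which start is joined to which end of a long strand. This is the freedom used.
  As each level forces the next one, no bound on the size of the graphs exceeds all strand lengths.
  The identities also have to be consistent, so an explicit graphon is needed; its degrees are
  balanced by the fourth label and by the densities between markers.\<close>

interpretation unif01: prob_space unif01 by (rule prob_space_unif01)

lemma prob_unif01 [simp]: "measure unif01 {0..<1} = 1"
  using unif01.prob_space by simp

abbreviation cube :: "nat set \<Rightarrow> (nat \<Rightarrow> real) measure" where
  "cube S \<equiv> PiM S (\<lambda>_. unif01)"

interpretation cube: prob_space "cube S" for S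
  by (rule prob_space_PiM) (rule prob_space_unif01)

interpretation cubes: product_sigma_finite "\<lambda>_ :: nat. unif01"
  by unfold_locales

lemma graphon_bounds:
  assumes "graphon W" "s \<in> {0..<1}" "t \<in> {0..<1}"
  shows "0 \<le> W (s, t)" "W (s, t) \<le> 1"
proof -
  have "W (s, t) \<in> {0..1}"
    using assms unfolding graphon_def by blast
  then show "0 \<le> W (s, t)" "W (s, t) \<le> 1" by auto
qed

lemma graphon_sym:
  assumes "graphon W" "s \<in> {0..<1}" "t \<in> {0..<1}"
  shows "W (s, t) = W (t, s)"
  using assms unfolding graphon_def by blast

lemma graphon_measurable:
  "graphon W \<Longrightarrow> W \<in> borel_measurable (unif01 \<Otimes>\<^sub>M unif01)"
  by (simp add: graphon_def)

subsection \<open>Induced densities\<close>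

definition edges :: "nat \<Rightarrow> nat set set" where
  "edges n = {e. e \<subseteq> {..<n} \<and> card e = 2}"

text \<open>\<open>Min\<close> and \<open>Max\<close> pick an orientation, so that the factor of an
  edge is a function of a two-element set; for a graphon the choice is immaterial by
  symmetry.\<close>

definition edge_val :: "(real \<times> real \<Rightarrow> real) \<Rightarrow> (nat \<Rightarrow> real) \<Rightarrow> nat set \<Rightarrow> real" where
  "edge_val W x e = W (x (Min e), x (Max e))"

text \<open>The labelled counterpart of \<open>graph_density\<close>: the probability that the
  sampled graph has edge set exactly \<open>E\<close>. Being the integral of a polynomial in the
  edge values, it is what all later computations use.\<close>

definition ind_density :: "(real \<times> real \<Rightarrow> real) \<Rightarrow> nat \<Rightarrow> nat set set \<Rightarrow> real" where
  "ind_density W n E =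
    (\<integral>x. (\<Prod>e\<in>edges n. if e \<in> E then edge_val W x e else 1 - edge_val W x e) \<partial>cube {..<n})"

definition hom_density :: "(real \<times> real \<Rightarrow> real) \<Rightarrow> nat \<Rightarrow> nat set set \<Rightarrow> real" where
  "hom_density W n F = (\<integral>x. (\<Prod>e\<in>F. edge_val W x e) \<partial>cube {..<n})"

definition density_equiv :: "nat \<Rightarrow> (real \<times> real \<Rightarrow> real) \<Rightarrow> (real \<times> real \<Rightarrow> real) \<Rightarrow> bool" where
  "density_equiv N W W' \<longleftrightarrow>
    (\<forall>H. finite_graph H \<and> card (fst H) \<le> N \<longrightarrow> graph_density H W = graph_density H W')"

lemma finite_edges [simp]: "finite (edges n)"
  by (rule finite_subset[of _ "Pow {..<n}"]) (auto simp: edges_def)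

lemma edgesE:
  assumes "e \<in> edges n"
  obtains i j where "e = {i, j}" "i < j" "j < n"
proof -
  from assms obtain i j where "e = {i, j}" "i \<noteq> j" "i < n" "j < n"
    by (auto simp: edges_def card_2_iff)
  then show thesis
    using that[of i j] that[of j i] by (cases "i < j") (auto simp: insert_commute)
qed

lemma doubleton_edges [simp]: "{i, j} \<in> edges n \<longleftrightarrow> i \<noteq> j \<and> i < n \<and> j < n"
  by (auto simp: edges_def card_2_iff doubleton_eq_iff)

lemma edge_val_doubleton:
  assumes "graphon W" "x i \<in> {0..<1}" "x j \<in> {0..<1}"
  shows "edge_val W x {i, j} = W (x i, x j)"
  using graphon_sym[OF assms] by (cases "i \<le> j") (auto simp: edge_val_def max_def min_def)

lemma cube_coord: "x \<in> space (cube S) \<Longrightarrow> i \<in> S \<Longrightarrow> x i \<in> {0..<1}"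
  by (auto simp: space_PiM PiE_iff)

lemma edge_val_bounds:
  assumes "graphon W" "e \<in> edges n" "x \<in> space (cube {..<n})"
  shows "0 \<le> edge_val W x e" "edge_val W x e \<le> 1"
proof -
  from assms(2) obtain i j where e: "e = {i, j}" "i < j" "j < n" by (rule edgesE)
  then have "x i \<in> {0..<1}" "x j \<in> {0..<1}"
    using cube_coord[OF assms(3)] by auto
  with e show "0 \<le> edge_val W x e" "edge_val W x e \<le> 1"
    using graphon_bounds[OF assms(1)] edge_val_doubleton[OF assms(1)] by metis+
qed

lemma edge_val_measurable:
  assumes "graphon W" "e \<in> edges n"
  shows "(\<lambda>x. edge_val W x e) \<in> borel_measurable (cube {..<n})"
proof -
  from assms(2) obtain i j where e: "e = {i, j}" "i < j" "j < n" by (rule edgesE)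
  have "(\<lambda>x. (x i, x j)) \<in> measurable (cube {..<n}) (unif01 \<Otimes>\<^sub>M unif01)"
    using e by (intro measurable_Pair measurable_component_singleton) auto
  from measurable_compose[OF this graphon_measurable[OF assms(1)]] show ?thesis
    using e by (simp add: edge_val_def max_def min_def)
qed

lemma prod_abs_le_one:
  fixes f :: "'a \<Rightarrow> real"
  assumes "\<And>e. e \<in> A \<Longrightarrow> 0 \<le> f e \<and> f e \<le> 1"
  shows "\<bar>\<Prod>e\<in>A. f e\<bar> \<le> 1"
proof -
  have "0 \<le> (\<Prod>e\<in>A. f e)" "(\<Prod>e\<in>A. f e) \<le> 1"
    using assms by (auto intro!: prod_nonneg prod_le_1)
  then show ?thesis by simp
qed

lemma ind_integrable:
  assumes "graphon W"
  shows "integrable (cube {..<n})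
    (\<lambda>x. \<Prod>e\<in>edges n. if e \<in> E then edge_val W x e else 1 - edge_val W x e)"
proof (rule cube.integrable_const_bound[of _ 1])
  show "AE x in cube {..<n}.
      norm (\<Prod>e\<in>edges n. if e \<in> E then edge_val W x e else 1 - edge_val W x e) \<le> 1"
  proof (rule AE_I2)
    fix x assume "x \<in> space (cube {..<n})"
    then show "norm (\<Prod>e\<in>edges n. if e \<in> E then edge_val W x e else 1 - edge_val W x e) \<le> 1"
      using edge_val_bounds[OF assms] unfolding real_norm_def
      by (intro prod_abs_le_one) auto
  qed
  show "(\<lambda>x. \<Prod>e\<in>edges n. if e \<in> E then edge_val W x e else 1 - edge_val W x e)
      \<in> borel_measurable (cube {..<n})"
  proof (rule borel_measurable_prod)
    fix e assume "e \<in> edges n"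
    then show "(\<lambda>x. if e \<in> E then edge_val W x e else 1 - edge_val W x e)
        \<in> borel_measurable (cube {..<n})"
      using edge_val_measurable[OF assms] by (cases "e \<in> E") auto
  qed
qed

lemma bij_betw_vertex_pairs: "bij_betw (\<lambda>(i, j). {i, j}) (vertex_pairs n) (edges n)"
proof (rule bij_betwI')
  fix p q assume "p \<in> vertex_pairs n" "q \<in> vertex_pairs n"
  then show "((case p of (i, j) \<Rightarrow> {i, j}) = (case q of (i, j) \<Rightarrow> {i, j})) = (p = q)"
    by (auto simp: vertex_pairs_def doubleton_eq_iff)
next
  fix p assume "p \<in> vertex_pairs n"
  then show "(case p of (i, j) \<Rightarrow> {i, j}) \<in> edges n"
    by (auto simp: vertex_pairs_def)
next
  fix e assume "e \<in> edges n"
  then obtain i j where "e = {i, j}" "i < j" "j < n" by (rule edgesE)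
  then show "\<exists>p\<in>vertex_pairs n. e = (case p of (i, j) \<Rightarrow> {i, j})"
    by (intro bexI[of _ "(i, j)"]) (auto simp: vertex_pairs_def)
qed

text \<open>Edge sets and coin flips that are \<open>False\<close> outside
  \<open>vertex_pairs n\<close> determine each other, which turns the product distribution of the
  flips into a polynomial in the edge values.\<close>

lemma sampled_graph_prob:
  assumes W: "graphon W" and x: "x \<in> space (cube {..<n})"
  shows "measure (measure_pmf (sampled_graph_pmf W n x)) A =
    (\<Sum>E | E \<subseteq> edges n \<and> ({..<n}, E) \<in> A.
      \<Prod>e\<in>edges n. if e \<in> E then edge_val W x e else 1 - edge_val W x e)"
proof -
  let ?g = "\<lambda>b. ({..<n}, {{i, j} | i j. (i, j) \<in> vertex_pairs n \<and> b (i, j)})"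
  let ?P = "Pi_pmf (vertex_pairs n) False (\<lambda>(i, j). bernoulli_pmf (W (x i, x j)))"
  define S where "S = PiE_dflt (vertex_pairs n) False (\<lambda>_. UNIV :: bool set)"
  have fin: "finite S"
    unfolding S_def by (rule finite_PiE_dflt) auto
  have sub: "set_pmf ?P \<subseteq> S"
    using set_Pi_pmf_subset[OF finite_vertex_pairs, of n False]
    by (fastforce simp: S_def PiE_dflt_def)
  have "measure (measure_pmf ?P) (?g -` A) = measure (measure_pmf ?P) (S \<inter> ?g -` A)"
    by (rule measure_prob_cong_0) (use sub in \<open>auto simp: set_pmf_eq\<close>)
  then have 1: "measure (measure_pmf (sampled_graph_pmf W n x)) A = (\<Sum>b\<in>S \<inter> ?g -` A. pmf ?P b)"
    using fin by (simp add: sampled_graph_pmf_def measure_measure_pmf_finite)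
  define h where "h E = (\<lambda>(i, j). (i, j) \<in> vertex_pairs n \<and> {i, j} \<in> E)" for E :: "nat set set"
  have snd_g: "snd (?g b) \<subseteq> edges n" for b
    by (auto simp: vertex_pairs_def)
  have gh: "snd (?g (h E)) = E" if "E \<subseteq> edges n" for E
  proof
    show "snd (?g (h E)) \<subseteq> E" by (auto simp: h_def)
    show "E \<subseteq> snd (?g (h E))"
    proof
      fix e assume e: "e \<in> E"
      with that obtain i j where "e = {i, j}" "i < j" "j < n" using edgesE by blast
      with e show "e \<in> snd (?g (h E))"
        by (auto simp: h_def vertex_pairs_def)
    qed
  qed
  have hg: "h (snd (?g b)) = b" if "b \<in> S" for b
  proof (rule ext, clarify)
    fix i j
    show "h (snd (?g b)) (i, j) = b (i, j)"
      using that by (auto simp: h_def S_def PiE_dflt_def vertex_pairs_def doubleton_eq_iff)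
  qed
  have p: "pmf ?P b = (\<Prod>e\<in>edges n. if e \<in> snd (?g b) then edge_val W x e else 1 - edge_val W x e)"
    if b: "b \<in> S" for b
  proof -
    have "pmf ?P b = (\<Prod>p\<in>vertex_pairs n. pmf ((\<lambda>(i, j). bernoulli_pmf (W (x i, x j))) p) (b p))"
      using b by (intro pmf_Pi') (auto simp: S_def PiE_dflt_def)
    also have "\<dots> = (\<Prod>p\<in>vertex_pairs n. (\<lambda>e. if e \<in> snd (?g b) then edge_val W x e
        else 1 - edge_val W x e) (case p of (i, j) \<Rightarrow> {i, j}))"
    proof (rule prod.cong[OF refl])
      fix p assume "p \<in> vertex_pairs n"
      then obtain i j where p: "p = (i, j)" "i < j" "j < n"
        by (auto simp: vertex_pairs_def)
      have xij: "x i \<in> {0..<1}" "x j \<in> {0..<1}"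
        using p cube_coord[OF x] by auto
      have "{i, j} \<in> snd (?g b) \<longleftrightarrow> b (i, j)"
        using p by (auto simp: vertex_pairs_def doubleton_eq_iff)
      then show "pmf ((\<lambda>(i, j). bernoulli_pmf (W (x i, x j))) p) (b p) =
        (\<lambda>e. if e \<in> snd (?g b) then edge_val W x e
          else 1 - edge_val W x e) (case p of (i, j) \<Rightarrow> {i, j})"
        using p(1) edge_val_doubleton[OF W xij] graphon_bounds[OF W xij] by simp
    qed
    also have "\<dots> = (\<Prod>e\<in>edges n. if e \<in> snd (?g b) then edge_val W x e else 1 - edge_val W x e)"
      by (rule prod.reindex_bij_betw[OF bij_betw_vertex_pairs])
    finally show ?thesis .
  qed
  have "(\<Sum>b\<in>S \<inter> ?g -` A. pmf ?P b) = (\<Sum>E | E \<subseteq> edges n \<and> ({..<n}, E) \<in> A.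
      \<Prod>e\<in>edges n. if e \<in> E then edge_val W x e else 1 - edge_val W x e)"
  proof (rule sum.reindex_bij_witness[of _ h "\<lambda>b. snd (?g b)"])
    fix b assume b: "b \<in> S \<inter> ?g -` A"
    show "h (snd (?g b)) = b" using hg b by blast
    show "snd (?g b) \<in> {E. E \<subseteq> edges n \<and> ({..<n}, E) \<in> A}"
      using b snd_g[of b] by auto
    show "(\<Prod>e\<in>edges n. if e \<in> snd (?g b) then edge_val W x e else 1 - edge_val W x e) = pmf ?P b"
      using b by (simp only: p Int_iff)
  next
    fix E assume E: "E \<in> {E. E \<subseteq> edges n \<and> ({..<n}, E) \<in> A}"
    then show "snd (?g (h E)) = E" using gh by blast
    moreover have "h E \<in> S" by (auto simp: S_def PiE_dflt_def h_def)
    ultimately show "h E \<in> S \<inter> ?g -` A"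
      using E by simp
  qed
  with 1 show ?thesis by simp
qed

lemma graph_density_eq_sum:
  assumes "graphon W" and n: "card (fst H) = n"
  shows "graph_density H W =
    (\<Sum>E | E \<subseteq> edges n \<and> graph_isomorphic ({..<n}, E) H. ind_density W n E)"
proof -
  have "graph_density H W =
      (\<integral>x. measure (measure_pmf (sampled_graph_pmf W n x)) {G. graph_isomorphic G H} \<partial>cube {..<n})"
    unfolding graph_density_def random_graph_def n
    by (rule cube.measure_bind[OF measurable_sampled_graph_pmf[OF assms(1)]]) simp
  also have "\<dots> = (\<integral>x. (\<Sum>E | E \<subseteq> edges n \<and> graph_isomorphic ({..<n}, E) H.
      \<Prod>e\<in>edges n. if e \<in> E then edge_val W x e else 1 - edge_val W x e) \<partial>cube {..<n})"
    by (intro Bochner_Integration.integral_cong refl) (simp add: sampled_graph_prob[OF assms(1)])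
  also have "\<dots> = (\<Sum>E | E \<subseteq> edges n \<and> graph_isomorphic ({..<n}, E) H. ind_density W n E)"
    unfolding ind_density_def by (intro Bochner_Integration.integral_sum ind_integrable assms)
  finally show ?thesis .
qed

text \<open>The sample points are exchangeable: permuting coordinates preserves the product
  measure.\<close>

lemma ind_density_perm:
  assumes W: "graphon W" and f: "bij_betw f {..<n} {..<n}" and E: "E \<subseteq> edges n"
  shows "ind_density W n ((`) f ` E) = ind_density W n E"
proof -
  let ?T = "\<lambda>x. \<lambda>i\<in>{..<n}. x (f i)"
  let ?\<phi> = "\<lambda>E x. \<Prod>e\<in>edges n. if e \<in> E then edge_val W x e else 1 - edge_val W x e"
  have inj: "inj_on f {..<n}" and img: "f ` {..<n} = {..<n}"
    using f by (auto simp: bij_betw_def)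
  have dist: "distr (cube {..<n}) (cube {..<n}) ?T = cube {..<n}"
    by (rule distr_PiM_reindex) (use f inj in \<open>auto simp: bij_betw_def prob_space_unif01\<close>)
  have Tm: "?T \<in> measurable (cube {..<n}) (cube {..<n})"
    by (intro measurable_restrict measurable_component_singleton) (use img in auto)
  have inj': "inj_on ((`) f) (edges n)"
    using inj_on_image_Pow[OF inj] by (rule inj_on_subset) (auto simp: edges_def)
  have bij: "bij_betw ((`) f) (edges n) (edges n)"
  proof (rule bij_betw_imageI[OF inj'])
    have sub: "(`) f ` edges n \<subseteq> edges n"
    proof clarify
      fix e assume "e \<in> edges n"
      then obtain i j where "e = {i, j}" "i < j" "j < n" by (rule edgesE)
      then show "f ` e \<in> edges n"
        using img inj by (auto simp: inj_on_eq_iff)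
    qed
    show "(`) f ` edges n = edges n"
      by (rule endo_inj_surj[OF finite_edges sub inj'])
  qed
  have "ind_density W n E = integral\<^sup>L (distr (cube {..<n}) (cube {..<n}) ?T) (?\<phi> E)"
    by (simp add: ind_density_def dist)
  also have "\<dots> = (\<integral>x. ?\<phi> E (?T x) \<partial>cube {..<n})"
    by (intro integral_distr Tm borel_measurable_integrable ind_integrable W)
  also have "\<dots> = (\<integral>x. ?\<phi> ((`) f ` E) x \<partial>cube {..<n})"
  proof (intro Bochner_Integration.integral_cong refl)
    fix x assume x: "x \<in> space (cube {..<n})"
    have "?\<phi> ((`) f ` E) x = (\<Prod>e\<in>edges n. if f ` e \<in> (`) f ` E then edge_val W x (f ` e)
        else 1 - edge_val W x (f ` e))"
      by (rule prod.reindex_bij_betw[OF bij, symmetric])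
    also have "\<dots> = ?\<phi> E (?T x)"
    proof (rule prod.cong[OF refl])
      fix e assume e: "e \<in> edges n"
      then obtain i j where ij: "e = {i, j}" "i < j" "j < n" by (rule edgesE)
      have "f i < n" "f j < n" using ij img by auto
      then have xf: "x (f i) \<in> {0..<1}" "x (f j) \<in> {0..<1}"
        using cube_coord[OF x] by auto
      have "edge_val W x (f ` e) = edge_val W (?T x) e"
        using edge_val_doubleton[of W x "f i" "f j"] edge_val_doubleton[of W "?T x" i j] W xf ij
        by simp
      moreover have "f ` e \<in> (`) f ` E \<longleftrightarrow> e \<in> E"
        using inj_on_image_mem_iff[OF inj' e E] .
      ultimately show "(if f ` e \<in> (`) f ` E then edge_val W x (f ` e) else 1 - edge_val W x (f ` e))
         = (if e \<in> E then edge_val W (?T x) e else 1 - edge_val W (?T x) e)"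
        by simp
    qed
    finally show "?\<phi> E (?T x) = ?\<phi> ((`) f ` E) x" by simp
  qed
  finally show ?thesis by (simp add: ind_density_def)
qed

text \<open>All labelled graphs isomorphic to \<open>({..<n}, E)\<close> have the same induced
  density, so the unlabelled density is this number times a positive count that does not depend on
  the graphon.\<close>

lemma graph_density_ind_density:
  assumes W: "graphon W" "graphon W'" and E: "E \<subseteq> edges n"
    and eq: "graph_density ({..<n}, E) W = graph_density ({..<n}, E) W'"
  shows "ind_density W n E = ind_density W' n E"
proof -
  let ?I = "{E'. E' \<subseteq> edges n \<and> graph_isomorphic ({..<n}, E') ({..<n}, E)}"
  have iso: "ind_density V n E' = ind_density V n E" if "E' \<in> ?I" "graphon V" for V E'
  proof -
    from that obtain f where f: "bij_betw f {..<n} {..<n}"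
      and fE: "\<And>u v. u < n \<Longrightarrow> v < n \<Longrightarrow> {u, v} \<in> E' \<longleftrightarrow> {f u, f v} \<in> E"
      by (auto simp: graph_isomorphic_def)
    have E': "E' \<subseteq> edges n" using that by auto
    have "(`) f ` E' = E"
    proof
      show "(`) f ` E' \<subseteq> E"
      proof clarify
        fix e assume e: "e \<in> E'"
        then obtain i j where "e = {i, j}" "i < j" "j < n" using E' edgesE by blast
        then show "f ` e \<in> E" using fE[of i j] e by auto
      qed
      show "E \<subseteq> (`) f ` E'"
      proof
        fix e assume e: "e \<in> E"
        then obtain i j where ij: "e = {i, j}" "i < j" "j < n" using E edgesE by blast
        have "i \<in> f ` {..<n}" "j \<in> f ` {..<n}"
          using f ij by (auto simp: bij_betw_def)
        then obtain u v where uv: "u < n" "v < n" "f u = i" "f v = j" by blast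
        then have "{u, v} \<in> E'" using fE e ij by auto
        moreover have "e = f ` {u, v}" using uv ij by auto
        ultimately show "e \<in> (`) f ` E'" by blast
      qed
    qed
    with ind_density_perm[OF that(2) f E'] show ?thesis by simp
  qed
  have dens: "graph_density ({..<n}, E) V = real (card ?I) * ind_density V n E" if "graphon V" for V
  proof -
    have "graph_density ({..<n}, E) V = (\<Sum>E'\<in>?I. ind_density V n E')"
      by (rule graph_density_eq_sum[OF that]) simp
    also have "\<dots> = (\<Sum>E'\<in>?I. ind_density V n E)"
      by (rule sum.cong) (use iso that in auto)
    finally show ?thesis by simp
  qed
  have "finite ?I" by (rule finite_subset[of _ "Pow (edges n)"]) auto
  moreover have "E \<in> ?I"
    using E by (auto simp: graph_isomorphic_def intro!: exI[of _ id])
  ultimately have "card ?I \<noteq> 0" by (auto simp: card_eq_0_iff)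
  then have c: "real (card ?I) \<noteq> 0" by (simp only: of_nat_eq_0_iff not_False_eq_True)
  have "real (card ?I) * ind_density W n E = real (card ?I) * ind_density W' n E"
    by (rule trans[OF trans[OF dens[OF W(1), symmetric] eq] dens[OF W(2)]])
  then show ?thesis by (rule mult_left_cancel[OF c, THEN iffD1])
qed

lemma density_equiv_ind_density:
  assumes W: "graphon W" "graphon W'" and eq: "density_equiv N W W'"
    and n: "n \<le> N" and E: "E \<subseteq> edges n"
  shows "ind_density W n E = ind_density W' n E"
proof (rule graph_density_ind_density[OF W E])
  show "graph_density ({..<n}, E) W = graph_density ({..<n}, E) W'"
    using eq n E by (auto simp: density_equiv_def finite_graph_def edges_def)
qed

lemma density_equivI:
  assumes W: "graphon W" "graphon W'"
    and eq: "\<And>n E. n \<le> N \<Longrightarrow> E \<subseteq> edges n \<Longrightarrow> graph_density ({..<n}, E) W = graph_density ({..<n}, E) W'"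
  shows "density_equiv N W W'"
  unfolding density_equiv_def
proof (intro allI impI)
  fix H assume H: "finite_graph H \<and> card (fst H) \<le> N"
  have "ind_density W (card (fst H)) E = ind_density W' (card (fst H)) E" if "E \<subseteq> edges (card (fst H))" for E
    by (rule graph_density_ind_density[OF W that eq[OF _ that]]) (use H in simp)
  then show "graph_density H W = graph_density H W'"
    unfolding graph_density_eq_sum[OF W(1) refl] graph_density_eq_sum[OF W(2) refl]
    by (intro sum.cong) auto
qed

text \<open>A pair outside \<open>F\<close> contributes the factor 1, which is split as
  \<open>v e + (1 - v e)\<close>. The terms of the expanded product belong to the graphs that
  contain \<open>F\<close>.\<close>

lemma hom_density_eq_sum:
  assumes W: "graphon W" and F: "F \<subseteq> edges n"
  shows "hom_density W n F = (\<Sum>E | F \<subseteq> E \<and> E \<subseteq> edges n. ind_density W n E)"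
proof -
  have eq: "(\<Prod>e\<in>F. v e) = (\<Sum>E | F \<subseteq> E \<and> E \<subseteq> edges n. \<Prod>e\<in>edges n. if e \<in> E then v e else 1 - v e)"
    for v :: "nat set \<Rightarrow> real"
  proof -
    have "(\<Prod>e\<in>F. v e) = (\<Prod>e\<in>edges n. if e \<in> F then v e else 1)"
      using F by (simp add: prod.If_cases Int_absorb1)
    \<comment> \<open>For an edge of \<open>F\<close> the second summand is 0, so the expansion
      keeps only the sets that contain \<open>F\<close>.\<close>
    also have "\<dots> = (\<Prod>e\<in>edges n. v e + (if e \<in> F then 0 else 1 - v e))"
      by (intro prod.cong) auto
    also have "\<dots> = (\<Sum>E\<in>Pow (edges n). (\<Prod>e\<in>E. v e) * (\<Prod>e\<in>edges n - E. if e \<in> F then 0 else 1 - v e))"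
      by (rule prod_add) simp
    also have "\<dots> = (\<Sum>E | F \<subseteq> E \<and> E \<subseteq> edges n. (\<Prod>e\<in>E. v e) * (\<Prod>e\<in>edges n - E. if e \<in> F then 0 else 1 - v e))"
    proof (rule sum.mono_neutral_right)
      show "\<forall>E\<in>Pow (edges n) - {E. F \<subseteq> E \<and> E \<subseteq> edges n}.
         (\<Prod>e\<in>E. v e) * (\<Prod>e\<in>edges n - E. if e \<in> F then 0 else 1 - v e) = 0"
      proof
        fix E assume "E \<in> Pow (edges n) - {E. F \<subseteq> E \<and> E \<subseteq> edges n}"
        then obtain e where "e \<in> F" "e \<notin> E" by auto
        then have "(\<Prod>e\<in>edges n - E. if e \<in> F then 0 else 1 - v e) = 0"
          using F by (intro prod_zero) auto
        then show "(\<Prod>e\<in>E. v e) * (\<Prod>e\<in>edges n - E. if e \<in> F then 0 else 1 - v e) = 0" by simp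
      qed
    qed auto
    also have "\<dots> = (\<Sum>E | F \<subseteq> E \<and> E \<subseteq> edges n. \<Prod>e\<in>edges n. if e \<in> E then v e else 1 - v e)"
    proof (rule sum.cong[OF refl])
      fix E assume "E \<in> {E. F \<subseteq> E \<and> E \<subseteq> edges n}"
      then have E: "F \<subseteq> E" "E \<subseteq> edges n" by auto
      have "(\<Prod>e\<in>edges n. if e \<in> E then v e else 1 - v e) = (\<Prod>e\<in>E. v e) * (\<Prod>e\<in>edges n - E. 1 - v e)"
        using E by (simp add: prod.If_cases Int_absorb1 Diff_eq)
      also have "(\<Prod>e\<in>edges n - E. 1 - v e) = (\<Prod>e\<in>edges n - E. if e \<in> F then 0 else 1 - v e)"
        using E by (intro prod.cong) auto
      finally show "(\<Prod>e\<in>E. v e) * (\<Prod>e\<in>edges n - E. if e \<in> F then 0 else 1 - v e)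
          = (\<Prod>e\<in>edges n. if e \<in> E then v e else 1 - v e)" by simp
    qed
    finally show ?thesis .
  qed
  have "hom_density W n F = (\<integral>x. (\<Sum>E | F \<subseteq> E \<and> E \<subseteq> edges n.
      \<Prod>e\<in>edges n. if e \<in> E then edge_val W x e else 1 - edge_val W x e) \<partial>cube {..<n})"
    unfolding hom_density_def by (subst eq) (rule refl)
  also have "\<dots> = (\<Sum>E | F \<subseteq> E \<and> E \<subseteq> edges n. ind_density W n E)"
    unfolding ind_density_def by (intro Bochner_Integration.integral_sum ind_integrable W)
  finally show ?thesis .
qed

lemma density_equiv_hom_density:
  assumes "graphon W" "graphon W'" "density_equiv N W W'" "n \<le> N" "F \<subseteq> edges n"
  shows "hom_density W n F = hom_density W' n F"
proof -
  have "ind_density W n E = ind_density W' n E" if "E \<in> {E. F \<subseteq> E \<and> E \<subseteq> edges n}" for E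
    by (rule density_equiv_ind_density[OF assms(1-4)]) (use that in blast)
  then have "(\<Sum>E | F \<subseteq> E \<and> E \<subseteq> edges n. ind_density W n E) =
      (\<Sum>E | F \<subseteq> E \<and> E \<subseteq> edges n. ind_density W' n E)"
    by (rule sum.cong[OF refl])
  then show ?thesis
    by (simp only: hom_density_eq_sum[OF assms(1,5)] hom_density_eq_sum[OF assms(2,5)])
qed

subsection \<open>Polynomial functionals of a graphon\<close>

text \<open>A syntax is needed because determination by densities depends on how often an edge value
  is multiplied, and this is not visible in the function that an expression denotes.\<close>

datatype expr =
    Const real
  | Edge nat nat
  | Plus expr expr (infixl "\<oplus>" 65)
  | Times expr expr (infixl "\<odot>" 70)
  | Integ nat expr

primrec eval :: "(real \<times> real \<Rightarrow> real) \<Rightarrow> expr \<Rightarrow> (nat \<Rightarrow> real) \<Rightarrow> real" where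
  "eval W (Const c) x = c"
| "eval W (Edge i j) x = W (x i, x j)"
| "eval W (a \<oplus> b) x = eval W a x + eval W b x"
| "eval W (a \<odot> b) x = eval W a x * eval W b x"
| "eval W (Integ k a) x = (\<integral>t. eval W a (x(k := t)) \<partial>unif01)"

primrec fv :: "expr \<Rightarrow> nat set" where
  "fv (Const c) = {}"
| "fv (Edge i j) = {i, j}"
| "fv (a \<oplus> b) = fv a \<union> fv b"
| "fv (a \<odot> b) = fv a \<union> fv b"
| "fv (Integ k a) = fv a - {k}"

text \<open>An edge with an integrated endpoint is dropped: that endpoint becomes a new sample
  point, a different one for each factor, so such edges never coincide.\<close>

primrec free_edges :: "expr \<Rightarrow> nat set set" where
  "free_edges (Const c) = {}"
| "free_edges (Edge i j) = {{i, j}}"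
| "free_edges (a \<oplus> b) = free_edges a \<union> free_edges b"
| "free_edges (a \<odot> b) = free_edges a \<union> free_edges b"
| "free_edges (Integ k a) = {e \<in> free_edges a. k \<notin> e}"

text \<open>Densities of simple graphs cannot express powers of a single value \<open>W (x i, x j)\<close>, so
  the factors of a product may not share an edge between free variables.\<close>

primrec simple :: "expr \<Rightarrow> bool" where
  "simple (Const c) = True"
| "simple (Edge i j) = (i \<noteq> j)"
| "simple (a \<oplus> b) = (simple a \<and> simple b)"
| "simple (a \<odot> b) = (simple a \<and> simple b \<and> free_edges a \<inter> free_edges b = {})"
| "simple (Integ k a) = simple a"

lemma finite_fv [simp]: "finite (fv a)"
  by (induction a) auto

lemma free_edges_subset_fv: "e \<in> free_edges a \<Longrightarrow> e \<subseteq> fv a"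
  by (induction a arbitrary: e) (simp_all, blast+)

lemma eval_cong:
  "(\<And>i. i \<in> fv a \<Longrightarrow> x i = y i) \<Longrightarrow> eval W a x = eval W a y"
proof (induction a arbitrary: x y)
  case (Integ k a)
  have "eval W a (x(k := t)) = eval W a (y(k := t))" for t
    by (rule Integ.IH) (use Integ.prems in auto)
  then show ?case by simp
next
  case (Plus a b) 
  then show ?case by (metis UnCI eval.simps(3) fv.simps(3))
next
  case (Times a b) 
  then show ?case by (metis UnCI eval.simps(4) fv.simps(4))
qed auto

lemma eval_measurable:
  assumes W: "graphon W"
  shows "fv a \<subseteq> S \<Longrightarrow> eval W a \<in> borel_measurable (cube S)"
proof (induction a arbitrary: S)
  case (Const c)
  then show ?case by (simp cong: measurable_cong)
next
  case (Edge i j)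
  then have "(\<lambda>x. (x i, x j)) \<in> measurable (cube S) (unif01 \<Otimes>\<^sub>M unif01)"
    by (intro measurable_Pair measurable_component_singleton) auto
  from measurable_compose[OF this graphon_measurable[OF W]] show ?case
    by (simp cong: measurable_cong)
next
  case (Plus a b)
  then have "(\<lambda>x. eval W a x + eval W b x) \<in> borel_measurable (cube S)"
    by (intro borel_measurable_add) auto
  then show ?case by (simp cong: measurable_cong)
next
  case (Times a b)
  then have "(\<lambda>x. eval W a x * eval W b x) \<in> borel_measurable (cube S)"
    by (intro borel_measurable_times) auto
  then show ?case by (simp cong: measurable_cong)
next
  case (Integ k a)
  then have "eval W a \<in> borel_measurable (cube (insert k S))"
    by (intro Integ.IH) auto
  from measurable_compose[OF measurable_add_dim this]
  have "(\<lambda>p. eval W a (case p of (x, t) \<Rightarrow> x(k := t))) \<in> borel_measurable (cube S \<Otimes>\<^sub>M unif01)" .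
  then have "(\<lambda>(x, t). eval W a (x(k := t))) \<in> borel_measurable (cube S \<Otimes>\<^sub>M unif01)"
    by (simp add: case_prod_unfold)
  then have "(\<lambda>x. \<integral>t. eval W a (x(k := t)) \<partial>unif01) \<in> borel_measurable (cube S)"
    by (rule unif01.borel_measurable_lebesgue_integral)
  then show ?case by (simp cong: measurable_cong)
qed

lemma eval_bounded:
  assumes W: "graphon W"
  obtains B where "\<And>x. (\<And>i. i \<in> fv a \<Longrightarrow> x i \<in> {0..<1}) \<Longrightarrow> \<bar>eval W a x\<bar> \<le> B"
proof -
  have "\<exists>B. \<forall>x. (\<forall>i\<in>fv a. x i \<in> {0..<1}) \<longrightarrow> \<bar>eval W a x\<bar> \<le> B"
  proof (induction a)
    case (Edge i j)
    show ?case
      by (rule exI[of _ 1]) (auto simp: abs_le_iff intro: graphon_bounds[OF W] order_trans[OF _ graphon_bounds(1)[OF W]])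
  next
    case (Plus a b)
    then obtain A B where "\<And>x. (\<forall>i\<in>fv a. x i \<in> {0..<1}) \<Longrightarrow> \<bar>eval W a x\<bar> \<le> A"
      "\<And>x. (\<forall>i\<in>fv b. x i \<in> {0..<1}) \<Longrightarrow> \<bar>eval W b x\<bar> \<le> B" by blast
    then show ?case
      by (intro exI[of _ "A + B"]) (auto intro!: order_trans[OF abs_triangle_ineq] add_mono)
  next
    case (Times a b)
    then obtain A B where "\<And>x. (\<forall>i\<in>fv a. x i \<in> {0..<1}) \<Longrightarrow> \<bar>eval W a x\<bar> \<le> A"
      "\<And>x. (\<forall>i\<in>fv b. x i \<in> {0..<1}) \<Longrightarrow> \<bar>eval W b x\<bar> \<le> B" by blast
    then have AB: "\<bar>eval W a x\<bar> \<le> A" "\<bar>eval W b x\<bar> \<le> B"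
      if "\<forall>i\<in>fv (a \<odot> b). x i \<in> {0..<1}" for x
      using that by auto
    show ?case
    proof (intro exI[of _ "A * B"] allI impI)
      fix x :: "nat \<Rightarrow> real" assume x: "\<forall>i\<in>fv (a \<odot> b). x i \<in> {0..<1}"
      show "\<bar>eval W (a \<odot> b) x\<bar> \<le> A * B"
        using mult_mono[OF AB[OF x] order_trans[OF abs_ge_zero AB(1)[OF x]] abs_ge_zero]
        by (simp add: abs_mult)
    qed
  next
    case (Integ k a)
    then obtain B where B: "\<And>x. (\<forall>i\<in>fv a. x i \<in> {0..<1}) \<Longrightarrow> \<bar>eval W a x\<bar> \<le> B" by blast
    show ?case
    proof (intro exI[of _ "\<bar>B\<bar>"] allI impI)
      fix x :: "nat \<Rightarrow> real" assume x: "\<forall>i\<in>fv (Integ k a). x i \<in> {0..<1}"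
      have "\<bar>\<integral>t. eval W a (x(k := t)) \<partial>unif01\<bar> \<le> (\<integral>t. \<bar>eval W a (x(k := t))\<bar> \<partial>unif01)"
        by (rule integral_abs_bound)
      also have "\<dots> \<le> (\<integral>t. \<bar>B\<bar> \<partial>unif01)"
        by (rule integral_mono')
          (use x in \<open>auto intro!: order_trans[OF B]\<close>)
      also have "\<dots> = \<bar>B\<bar>" by simp
      finally show "\<bar>eval W (Integ k a) x\<bar> \<le> \<bar>B\<bar>" by simp
    qed
  qed (auto intro: exI)
  then show thesis using that by blast
qed

lemma eval_rename_measurable:
  assumes W: "graphon W" and \<rho>: "\<rho> ` fv a \<subseteq> S"
  shows "(\<lambda>x. eval W a (x \<circ> \<rho>)) \<in> borel_measurable (cube S)"
proof -
  have "(\<lambda>x. \<lambda>i\<in>fv a. x (\<rho> i)) \<in> measurable (cube S) (cube (fv a))"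
    by (intro measurable_restrict measurable_component_singleton) (use \<rho> in auto)
  from measurable_compose[OF this eval_measurable[OF W order_refl]]
  have "(\<lambda>x. eval W a (\<lambda>i\<in>fv a. x (\<rho> i))) \<in> borel_measurable (cube S)" .
  also have "(\<lambda>x. eval W a (\<lambda>i\<in>fv a. x (\<rho> i))) = (\<lambda>x. eval W a (x \<circ> \<rho>))"
    by (rule ext, rule eval_cong) auto
  finally show ?thesis .
qed

lemma eval_section_measurable:
  assumes W: "graphon W" and x: "\<And>i. i \<in> fv a \<Longrightarrow> i \<noteq> k \<Longrightarrow> x i \<in> {0..<1}"
  shows "(\<lambda>t. eval W a (x(k := t))) \<in> borel_measurable unif01"
proof -
  have "(\<lambda>t. \<lambda>i\<in>fv a. (x(k := t)) i) \<in> measurable unif01 (cube (fv a))"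
  proof (rule measurable_restrict)
    fix i assume "i \<in> fv a"
    then show "(\<lambda>t. (x(k := t)) i) \<in> measurable unif01 unif01"
      using x by (cases "i = k") auto
  qed
  from measurable_compose[OF this eval_measurable[OF W order_refl]]
  have "(\<lambda>t. eval W a (\<lambda>i\<in>fv a. (x(k := t)) i)) \<in> borel_measurable unif01" .
  also have "(\<lambda>t. eval W a (\<lambda>i\<in>fv a. (x(k := t)) i)) = (\<lambda>t. eval W a (x(k := t)))"
    by (rule ext, rule eval_cong) auto
  finally show ?thesis .
qed

lemma eval_section_integrable:
  assumes W: "graphon W" and x: "\<And>i. i \<in> fv a \<Longrightarrow> i \<noteq> k \<Longrightarrow> x i \<in> {0..<1}"
  shows "integrable unif01 (\<lambda>t. eval W a (x(k := t)))"
proof -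
  obtain B where B: "\<And>x. (\<And>i. i \<in> fv a \<Longrightarrow> x i \<in> {0..<1}) \<Longrightarrow> \<bar>eval W a x\<bar> \<le> B"
    using eval_bounded[OF W] by metis
  show ?thesis
    by (rule unif01.integrable_const_bound[of _ B])
      (use x in \<open>auto intro!: AE_I2 B eval_section_measurable W\<close>)
qed

lemma eval_Integ_eq_0_AE:
  assumes W: "graphon W" and x: "\<And>i. i \<in> fv a \<Longrightarrow> i \<noteq> k \<Longrightarrow> x i \<in> {0..<1}"
    and "eval W (Integ k a) x = 0" and "\<And>t. t \<in> {0..<1} \<Longrightarrow> 0 \<le> eval W a (x(k := t))"
  shows "AE t in unif01. eval W a (x(k := t)) = 0"
proof -
  have "integrable unif01 (\<lambda>t. eval W a (x(k := t)))"
    by (rule eval_section_integrable[OF W x])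
  moreover have "AE t in unif01. 0 \<le> eval W a (x(k := t))"
    by (rule AE_I2) (use assms(4) in simp)
  ultimately show ?thesis
    using assms(3) integral_nonneg_eq_0_iff_AE[of unif01 "\<lambda>t. eval W a (x(k := t))"] by simp
qed

section \<open>Polynomial functionals are determined by finitely many densities\<close>

type_synonym closures = "(expr \<times> (nat \<Rightarrow> nat)) list"

definition closure_edges :: "expr \<times> (nat \<Rightarrow> nat) \<Rightarrow> nat set set" where
  "closure_edges p = (`) (snd p) ` free_edges (fst p)"

text \<open>A sampled graph shows each edge once, so no edge value may occur twice among
  \<open>F\<close> and the factors of the list.\<close>

primrec disjoint_edges :: "nat set set \<Rightarrow> closures \<Rightarrow> bool" where
  "disjoint_edges F [] = True"
| "disjoint_edges F (p # ps) =
    (closure_edges p \<inter> F = {} \<and> disjoint_edges (F \<union> closure_edges p) ps)"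

definition admissible :: "nat \<Rightarrow> nat set set \<Rightarrow> closures \<Rightarrow> bool" where
  "admissible n F ps \<longleftrightarrow> F \<subseteq> edges n \<and> disjoint_edges F ps \<and>
    (\<forall>p\<in>set ps. simple (fst p) \<and> snd p ` fv (fst p) \<subseteq> {..<n} \<and> inj_on (snd p) (fv (fst p)))"

definition closures_val :: "(real \<times> real \<Rightarrow> real) \<Rightarrow> closures \<Rightarrow> (nat \<Rightarrow> real) \<Rightarrow> real" where
  "closures_val W ps x = (\<Prod>p\<leftarrow>ps. eval W (fst p) (x \<circ> snd p))"

text \<open>An intermediate state of the evaluation: \<open>F\<close> collects the edges that are
  already split off, and the list holds the factors still to be taken apart. A pair
  \<open>(a, \<rho>)\<close> is the factor \<open>a\<close> with its variable \<open>i\<close> read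
  at the sample point \<open>\<rho> i\<close>.\<close>

definition closures_int :: "nat \<Rightarrow> nat set set \<Rightarrow> closures \<Rightarrow> (real \<times> real \<Rightarrow> real) \<Rightarrow> real" where
  "closures_int n F ps W =
    (\<integral>x. (\<Prod>e\<in>F. edge_val W x e) * closures_val W ps x \<partial>cube {..<n})"

lemma disjoint_edges_mono: "disjoint_edges F' ps \<Longrightarrow> F \<subseteq> F' \<Longrightarrow> disjoint_edges F ps"
proof (induction ps arbitrary: F F')
  case (Cons p ps)
  from Cons.prems have "disjoint_edges (F' \<union> closure_edges p) ps" by simp
  then have "disjoint_edges (F \<union> closure_edges p) ps"
    by (rule Cons.IH) (use Cons.prems in auto)
  with Cons.prems show ?case by auto
qed simp

lemma disjoint_edges_union:
  "disjoint_edges F ps \<Longrightarrow> (\<And>p. p \<in> set ps \<Longrightarrow> closure_edges p \<inter> X = {}) \<Longrightarrow> disjoint_edges (F \<union> X) ps"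
proof (induction ps arbitrary: F)
  case (Cons p ps)
  have "disjoint_edges ((F \<union> closure_edges p) \<union> X) ps"
    by (rule Cons.IH) (use Cons.prems in simp_all)
  then have "disjoint_edges (F \<union> X \<union> closure_edges p) ps"
    by (simp only: Un_ac)
  moreover have "closure_edges p \<inter> X = {}" "closure_edges p \<inter> F = {}"
    using Cons.prems(1) Cons.prems(2)[of p] by simp_all
  ultimately show ?case by (simp add: Int_Un_distrib)
qed simp

lemma closures_val_measurable:
  assumes "graphon W" "\<And>p. p \<in> set ps \<Longrightarrow> snd p ` fv (fst p) \<subseteq> {..<n}"
  shows "closures_val W ps \<in> borel_measurable (cube {..<n})"
  using assms(2)
proof (induction ps)
  case (Cons p ps)
  have "(\<lambda>x. eval W (fst p) (x \<circ> snd p) * closures_val W ps x) \<in> borel_measurable (cube {..<n})"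
    by (intro borel_measurable_times eval_rename_measurable assms(1) Cons.IH Cons.prems)
      (simp_all add: Cons.prems)
  then show ?case by (simp add: closures_val_def cong: measurable_cong)
qed (simp add: closures_val_def cong: measurable_cong)

lemma closures_val_bounded:
  assumes W: "graphon W" and ps: "\<And>p. p \<in> set ps \<Longrightarrow> snd p ` fv (fst p) \<subseteq> {..<n}"
  shows "\<exists>B. \<forall>x\<in>space (cube {..<n}). \<bar>closures_val W ps x\<bar> \<le> B"
  using ps
proof (induction ps)
  case (Cons p ps)
  have "\<exists>B. \<forall>x\<in>space (cube {..<n}). \<bar>closures_val W ps x\<bar> \<le> B"
    by (rule Cons.IH) (simp add: Cons.prems)
  then obtain B where B: "\<And>x. x \<in> space (cube {..<n}) \<Longrightarrow> \<bar>closures_val W ps x\<bar> \<le> B" by blast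
  obtain A where A: "\<And>x. (\<And>i. i \<in> fv (fst p) \<Longrightarrow> x i \<in> {0..<1}) \<Longrightarrow> \<bar>eval W (fst p) x\<bar> \<le> A"
    using eval_bounded[OF W] by metis
  show ?case
  proof (intro exI[of _ "A * B"] ballI)
    fix x assume x: "x \<in> space (cube {..<n})"
    have a: "\<bar>eval W (fst p) (x \<circ> snd p)\<bar> \<le> A"
    proof (rule A)
      fix i assume "i \<in> fv (fst p)"
      then have "snd p i \<in> {..<n}" using Cons.prems[of p] by auto
      then show "(x \<circ> snd p) i \<in> {0..<1}" using cube_coord[OF x] by simp
    qed
    show "\<bar>closures_val W (p # ps) x\<bar> \<le> A * B"
      using mult_mono[OF a B[OF x] order_trans[OF abs_ge_zero a] abs_ge_zero]
      by (simp add: closures_val_def abs_mult)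
  qed
qed (auto simp: closures_val_def)

lemma closures_integrable:
  assumes W: "graphon W" and ps: "\<And>p. p \<in> set ps \<Longrightarrow> snd p ` fv (fst p) \<subseteq> {..<n}" and F: "F \<subseteq> edges n"
  shows "integrable (cube {..<n}) (\<lambda>x. (\<Prod>e\<in>F. edge_val W x e) * closures_val W ps x)"
proof -
  obtain B where B: "\<And>x. x \<in> space (cube {..<n}) \<Longrightarrow> \<bar>closures_val W ps x\<bar> \<le> B"
    using closures_val_bounded[OF W ps] by blast
  show ?thesis
  proof (rule cube.integrable_const_bound[of _ B])
    show "AE x in cube {..<n}. norm ((\<Prod>e\<in>F. edge_val W x e) * closures_val W ps x) \<le> B"
    proof (rule AE_I2)
      fix x assume x: "x \<in> space (cube {..<n})"
      have "\<bar>\<Prod>e\<in>F. edge_val W x e\<bar> \<le> 1"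
        by (rule prod_abs_le_one) (use F edge_val_bounds[OF W _ x] in blast)
      then show "norm ((\<Prod>e\<in>F. edge_val W x e) * closures_val W ps x) \<le> B"
        using mult_mono[OF _ B[OF x], of "\<bar>\<Prod>e\<in>F. edge_val W x e\<bar>" 1] by (simp add: abs_mult)
    qed
    show "(\<lambda>x. (\<Prod>e\<in>F. edge_val W x e) * closures_val W ps x) \<in> borel_measurable (cube {..<n})"
      using F by (intro borel_measurable_times borel_measurable_prod closures_val_measurable
        edge_val_measurable W ps) auto
  qed
qed

text \<open>The first factor is taken apart: a constant comes out, an edge moves to
  \<open>F\<close>, a sum splits the integral, a product becomes two list entries, and an integral
  adds one sample point. In the end only a homomorphism density is left.\<close>

lemma closures_int_determined:
  assumes "admissible n F ps"
  shows "\<exists>N. \<forall>W W'. graphon W \<and> graphon W' \<and> density_equiv N W W' \<longrightarrow>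
    closures_int n F ps W = closures_int n F ps W'"
  using assms
\<comment> \<open>Doubling the size pays for the additional list entry that a product
  creates.\<close>
proof (induction "\<Sum>p\<leftarrow>ps. Suc (2 * size (fst p))" arbitrary: n F ps rule: less_induct)
  case less
  note adm = less.prems
  have F: "F \<subseteq> edges n" and dj: "disjoint_edges F ps"
    and ps: "\<And>p. p \<in> set ps \<Longrightarrow> simple (fst p) \<and> snd p ` fv (fst p) \<subseteq> {..<n} \<and> inj_on (snd p) (fv (fst p))"
    using adm by (auto simp: admissible_def)
  show ?case
  proof (cases ps)
    case Nil
    have "closures_int n F ps W = hom_density W n F" for W
      by (simp add: closures_int_def hom_density_def closures_val_def Nil)
    then show ?thesis
      using density_equiv_hom_density[OF _ _ _ _ F] by (intro exI[of _ n]) auto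
  next
    case (Cons p qs)
    obtain a \<rho> where p: "p = (a, \<rho>)" by (cases p)
    have a: "simple a" "\<rho> ` fv a \<subseteq> {..<n}" "inj_on \<rho> (fv a)"
      using ps[of p] Cons p by auto
    have qs: "\<And>p. p \<in> set qs \<Longrightarrow> simple (fst p) \<and> snd p ` fv (fst p) \<subseteq> {..<n} \<and> inj_on (snd p) (fv (fst p))"
      using ps Cons by auto
    have dj1: "closure_edges (a, \<rho>) \<inter> F = {}" and dj2: "disjoint_edges (F \<union> closure_edges (a, \<rho>)) qs"
      using dj Cons p by auto
    show ?thesis
    proof (cases a)
      case (Const c)
      have "admissible n F qs"
        using F dj2 qs by (auto simp: admissible_def closure_edges_def Const)
      then obtain N where N: "\<And>W W'. graphon W \<and> graphon W' \<and> density_equiv N W W' \<Longrightarrow>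
          closures_int n F qs W = closures_int n F qs W'"
        using less.hyps[of qs n F] Cons by auto
      have "closures_int n F ps W = c * closures_int n F qs W" for W
        by (simp add: closures_int_def closures_val_def Cons p Const mult.left_commute)
      with N show ?thesis by auto
    next
      case (Edge i j)
      have ij: "\<rho> i < n" "\<rho> j < n" "\<rho> i \<noteq> \<rho> j"
        using a by (auto simp: Edge)
      have new: "{\<rho> i, \<rho> j} \<notin> F" using dj1 by (simp add: closure_edges_def Edge)
      have "admissible n (insert {\<rho> i, \<rho> j} F) qs"
        using F dj2 qs ij by (auto simp: admissible_def closure_edges_def Edge)
      then obtain N where N: "\<And>W W'. graphon W \<and> graphon W' \<and> density_equiv N W W' \<Longrightarrow>
          closures_int n (insert {\<rho> i, \<rho> j} F) qs W = closures_int n (insert {\<rho> i, \<rho> j} F) qs W'"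
        using less.hyps[of qs n "insert {\<rho> i, \<rho> j} F"] Cons by auto
      have "closures_int n F ps W = closures_int n (insert {\<rho> i, \<rho> j} F) qs W" if W: "graphon W" for W
        unfolding closures_int_def
      proof (intro Bochner_Integration.integral_cong refl)
        fix x assume x: "x \<in> space (cube {..<n})"
        have "W (x (\<rho> i), x (\<rho> j)) = edge_val W x {\<rho> i, \<rho> j}"
          using ij by (intro edge_val_doubleton[symmetric] W cube_coord[OF x]) auto
        moreover have "finite F" by (rule finite_subset[OF F finite_edges])
        ultimately show "(\<Prod>e\<in>F. edge_val W x e) * closures_val W ps x =
          (\<Prod>e\<in>insert {\<rho> i, \<rho> j} F. edge_val W x e) * closures_val W qs x"
          using new by (simp add: closures_val_def Cons p Edge)
      qed
      with N show ?thesis by auto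
    next
      case (Plus b c)
      have sub: "F \<union> closure_edges (b, \<rho>) \<subseteq> F \<union> closure_edges (a, \<rho>)"
        "F \<union> closure_edges (c, \<rho>) \<subseteq> F \<union> closure_edges (a, \<rho>)"
        by (auto simp: closure_edges_def Plus)
      have "admissible n F ((b, \<rho>) # qs)" "admissible n F ((c, \<rho>) # qs)"
        using F dj1 disjoint_edges_mono[OF dj2 sub(1)] disjoint_edges_mono[OF dj2 sub(2)] qs a
        by (auto simp: admissible_def closure_edges_def Plus inj_on_Un image_subset_iff)
      then obtain N M where
        N: "\<And>W W'. graphon W \<and> graphon W' \<and> density_equiv N W W' \<Longrightarrow>
          closures_int n F ((b, \<rho>) # qs) W = closures_int n F ((b, \<rho>) # qs) W'"
        and M: "\<And>W W'. graphon W \<and> graphon W' \<and> density_equiv M W W' \<Longrightarrow>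
          closures_int n F ((c, \<rho>) # qs) W = closures_int n F ((c, \<rho>) # qs) W'"
        using less.hyps[of "(b, \<rho>) # qs" n F] less.hyps[of "(c, \<rho>) # qs" n F] Cons p Plus
        by auto
      have eq: "closures_int n F ps W =
          closures_int n F ((b, \<rho>) # qs) W + closures_int n F ((c, \<rho>) # qs) W" if W: "graphon W" for W
      proof -
        have "closures_int n F ps W = (\<integral>x. (\<Prod>e\<in>F. edge_val W x e) * closures_val W ((b, \<rho>) # qs) x
            + (\<Prod>e\<in>F. edge_val W x e) * closures_val W ((c, \<rho>) # qs) x \<partial>cube {..<n})"
          unfolding closures_int_def
          by (intro Bochner_Integration.integral_cong refl)
            (simp add: closures_val_def Cons p Plus algebra_simps)
        also have "\<dots> = closures_int n F ((b, \<rho>) # qs) W + closures_int n F ((c, \<rho>) # qs) W"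
          unfolding closures_int_def
          by (rule Bochner_Integration.integral_add; rule closures_integrable[OF W _ F])
            (use qs a in \<open>auto simp: Plus image_subset_iff\<close>)
        finally show ?thesis .
      qed
      show ?thesis
      proof (intro exI[of _ "max N M"] allI impI)
        fix W W' assume H: "graphon W \<and> graphon W' \<and> density_equiv (max N M) W W'"
        then have "density_equiv N W W'" "density_equiv M W W'" by (auto simp: density_equiv_def)
        then show "closures_int n F ps W = closures_int n F ps W'"
          using H N M eq by metis
      qed
    next
      case (Times b c)
      have disj: "closure_edges (b, \<rho>) \<inter> closure_edges (c, \<rho>) = {}"
      proof -
        have "((`) \<rho> ` free_edges b) \<inter> ((`) \<rho> ` free_edges c) = (`) \<rho> ` (free_edges b \<inter> free_edges c)"
          by (rule inj_on_image_Int[symmetric, OF inj_on_image_Pow[OF a(3)]])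
            (use free_edges_subset_fv in \<open>auto simp: Times\<close>)
        then show ?thesis using a(1) by (simp add: closure_edges_def Times)
      qed
      have ce: "closure_edges (a, \<rho>) = closure_edges (b, \<rho>) \<union> closure_edges (c, \<rho>)"
        by (auto simp: closure_edges_def Times)
      have "admissible n F ((b, \<rho>) # (c, \<rho>) # qs)"
        using F dj1[unfolded ce] dj2[unfolded ce] qs a disj
        by (simp add: admissible_def Times inj_on_Un Un_assoc Int_Un_distrib Int_Un_distrib2 image_Un)
          (simp add: Int_commute)
      then obtain N where N: "\<And>W W'. graphon W \<and> graphon W' \<and> density_equiv N W W' \<Longrightarrow>
          closures_int n F ((b, \<rho>) # (c, \<rho>) # qs) W = closures_int n F ((b, \<rho>) # (c, \<rho>) # qs) W'"
        using less.hyps[of "(b, \<rho>) # (c, \<rho>) # qs" n F] Cons p Times by auto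
      have "closures_int n F ps W = closures_int n F ((b, \<rho>) # (c, \<rho>) # qs) W" for W
        by (simp add: closures_int_def closures_val_def Cons p Times mult.assoc)
      with N show ?thesis by auto
    next
      case (Integ k b)
      \<comment> \<open>The bound variable becomes the fresh sample point \<open>n\<close>. Edges
        that contain \<open>n\<close> are new and collide neither with \<open>F\<close> nor with the
        other factors, all of which live on the points below \<open>n\<close>.\<close>
      let ?\<rho> = "\<rho>(k := n)"
      have \<rho>lt: "\<rho> i < n" if "i \<in> fv b" "i \<noteq> k" for i
        using a(2) that by (auto simp: Integ)
      have inj: "inj_on ?\<rho> (fv b)"
      proof (rule inj_onI)
        fix i j assume ij: "i \<in> fv b" "j \<in> fv b" "?\<rho> i = ?\<rho> j"
        then show "i = j"
          using \<rho>lt[of i] \<rho>lt[of j] inj_onD[OF a(3), of i j]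
          by (auto simp: Integ split: if_splits)
      qed
      have img: "closure_edges (b, ?\<rho>) \<subseteq> closure_edges (a, \<rho>) \<union> {e. n \<in> e}"
      proof
        fix e assume "e \<in> closure_edges (b, ?\<rho>)"
        then obtain d where d: "d \<in> free_edges b" "e = ?\<rho> ` d" by (auto simp: closure_edges_def)
        show "e \<in> closure_edges (a, \<rho>) \<union> {e. n \<in> e}"
        proof (cases "k \<in> d")
          case True
          then have "n \<in> e" using d by (auto intro!: image_eqI[of _ _ k])
          then show ?thesis by simp
        next
          case False
          then have "e = \<rho> ` d" using d by (auto simp: image_def)
          with False d show ?thesis by (auto simp: closure_edges_def Integ)
        qed
      qed
      have nF: "n \<notin> e" if "e \<in> F" for e
        using F that by (auto simp: edges_def)
      have nq: "closure_edges q \<inter> {e. n \<in> e} = {}" if "q \<in> set qs" for q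
        using qs[OF that] free_edges_subset_fv[of _ "fst q"] by (fastforce simp: closure_edges_def)
      have "edges n \<subseteq> edges (Suc n)" by (auto simp: edges_def)
      moreover have "disjoint_edges ((F \<union> closure_edges (a, \<rho>)) \<union> {e. n \<in> e}) qs"
        by (rule disjoint_edges_union[OF dj2 nq])
      then have "disjoint_edges (F \<union> closure_edges (b, ?\<rho>)) qs"
        by (rule disjoint_edges_mono) (use img in blast)
      moreover have "closure_edges (b, ?\<rho>) \<inter> F = {}"
        using img dj1 nF by blast
      moreover have "?\<rho> ` fv b \<subseteq> {..<Suc n}"
        using \<rho>lt by (force simp: less_Suc_eq)
      moreover have "snd q ` fv (fst q) \<subseteq> {..<Suc n}" if "q \<in> set qs" for q
        using qs[OF that] by (auto simp: less_Suc_eq)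
      ultimately have adm': "admissible (Suc n) F ((b, ?\<rho>) # qs)"
        using F qs a inj by (simp add: admissible_def Integ)
      then obtain N where N: "\<And>W W'. graphon W \<and> graphon W' \<and> density_equiv N W W' \<Longrightarrow>
          closures_int (Suc n) F ((b, ?\<rho>) # qs) W = closures_int (Suc n) F ((b, ?\<rho>) # qs) W'"
        using less.hyps[of "(b, ?\<rho>) # qs" "Suc n" F] Cons p Integ by auto
      have "closures_int n F ps W = closures_int (Suc n) F ((b, ?\<rho>) # qs) W" if W: "graphon W" for W
      proof -
        let ?f = "\<lambda>x. (\<Prod>e\<in>F. edge_val W x e) * closures_val W ((b, ?\<rho>) # qs) x"
        have "integrable (cube {..<Suc n}) ?f"
          by (rule closures_integrable[OF W]) (use adm' in \<open>unfold admissible_def, blast\<close>)+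
        then have "closures_int (Suc n) F ((b, ?\<rho>) # qs) W = (\<integral>x. (\<integral>t. ?f (x(n := t)) \<partial>unif01) \<partial>cube {..<n})"
          unfolding closures_int_def lessThan_Suc by (intro cubes.product_integral_insert) auto
        also have "\<dots> = closures_int n F ps W"
          unfolding closures_int_def
        proof (intro Bochner_Integration.integral_cong refl)
          fix x assume x: "x \<in> space (cube {..<n})"
          have "?f (x(n := t)) = (\<Prod>e\<in>F. edge_val W x e) * closures_val W qs x * eval W b ((x \<circ> \<rho>)(k := t))" for t
          proof -
            have "edge_val W (x(n := t)) e = edge_val W x e" if "e \<in> F" for e
            proof -
              from that F obtain i j where "e = {i, j}" "i < j" "j < n" using edgesE by blast
              then show ?thesis by (simp add: edge_val_def)
            qed
            moreover have "eval W b (x(n := t) \<circ> ?\<rho>) = eval W b ((x \<circ> \<rho>)(k := t))"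
              by (rule eval_cong) (use \<rho>lt in fastforce)
            moreover have "closures_val W qs (x(n := t)) = closures_val W qs x"
            proof -
              have "eval W (fst q) (x(n := t) \<circ> snd q) = eval W (fst q) (x \<circ> snd q)" if "q \<in> set qs" for q
                by (rule eval_cong) (use qs[OF that] in auto)
              then show ?thesis unfolding closures_val_def by (metis (no_types, lifting) map_cong)
            qed
            ultimately show ?thesis
              by (simp add: closures_val_def)
          qed
          then show "(\<integral>t. ?f (x(n := t)) \<partial>unif01) = (\<Prod>e\<in>F. edge_val W x e) * closures_val W ps x"
            by (simp add: closures_val_def Cons p Integ)
        qed
        finally show ?thesis by simp
      qed
      with N show ?thesis by auto
    qed
  qed
qed

lemma eval_determined:
  assumes "simple a" "fv a = {}"
  obtains N where "\<And>W W' x. graphon W \<Longrightarrow> graphon W' \<Longrightarrow> density_equiv N W W' \<Longrightarrow>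
    eval W a x = eval W' a x"
proof -
  have "admissible 0 {} [(a, id)]"
    using assms by (auto simp: admissible_def)
  from closures_int_determined[OF this] obtain N where
    N: "\<And>W W'. graphon W \<Longrightarrow> graphon W' \<Longrightarrow> density_equiv N W W' \<Longrightarrow>
      closures_int 0 {} [(a, id)] W = closures_int 0 {} [(a, id)] W'" by blast
  have "closures_int 0 {} [(a, id)] W = eval W a x" for W x
  proof -
    have "eval W a = (\<lambda>_. eval W a x)"
      by (rule ext, rule eval_cong) (simp add: assms)
    then have "(\<integral>y. eval W a y \<partial>cube {}) = (\<integral>y. eval W a x \<partial>cube {})" by metis
    then show ?thesis by (simp add: closures_int_def closures_val_def cube.prob_space)
  qed
  with N that show thesis by metis
qed

interpretation square: pair_prob_space unif01 unif01 ..

lemma AE_mpI: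
  assumes "AE x in M. P x" "\<And>x. x \<in> space M \<Longrightarrow> P x \<Longrightarrow> Q x"
  shows "AE x in M. Q x"
  using assms(1) AE_space by eventually_elim (rule assms(2))

lemma unif01_top [simp]: "{0..<1} \<in> sets unif01"
  using sets.top[of unif01] by simp

subsection \<open>Kernels with vanishing four-cycle density\<close>

lemma integrable_bounded_kernel:
  assumes "case_prod f \<in> borel_measurable (unif01 \<Otimes>\<^sub>M unif01)"
    and "\<And>x y. x \<in> {0..<1} \<Longrightarrow> y \<in> {0..<1} \<Longrightarrow> \<bar>f x y\<bar> \<le> (B::real)"
  shows "integrable (unif01 \<Otimes>\<^sub>M unif01) (case_prod f)"
  by (rule square.P.integrable_const_bound[of _ B])
    (use assms in \<open>auto simp: space_pair_measure intro!: AE_I2\<close>)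

text \<open>The measure with density \<open>1 + D / B\<close> agrees with the product measure on
  rectangles, hence everywhere, and densities are unique almost everywhere. Dividing by the bound
  \<open>B\<close> keeps the density nonnegative.\<close>

lemma kernel_eq_0_if_rectangles_0:
  fixes D :: "real \<times> real \<Rightarrow> real"
  assumes [measurable]: "D \<in> borel_measurable (unif01 \<Otimes>\<^sub>M unif01)"
    and B: "\<And>x y. x \<in> {0..<1} \<Longrightarrow> y \<in> {0..<1} \<Longrightarrow> \<bar>D (x, y)\<bar> \<le> B" and "B > 0"
    and rect: "\<And>S T. S \<in> sets unif01 \<Longrightarrow> T \<in> sets unif01 \<Longrightarrow>
      (\<integral>p. D p * indicator (S \<times> T) p \<partial>(unif01 \<Otimes>\<^sub>M unif01)) = 0"
  shows "AE p in unif01 \<Otimes>\<^sub>M unif01. D p = 0"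
proof -
  let ?P = "unif01 \<Otimes>\<^sub>M unif01"
  let ?f = "\<lambda>p. ennreal (1 + D p / B)"
  have nn: "0 \<le> 1 + D p / B" if "p \<in> space ?P" for p
    using B[of "fst p" "snd p"] that \<open>B > 0\<close> by (auto simp: space_pair_measure field_simps abs_le_iff)
  have int: "integrable ?P D"
    using B by (intro square.P.integrable_const_bound[of _ B]) (auto simp: space_pair_measure intro!: AE_I2)
  have "?P = density ?P ?f"
  proof (rule pair_measure_eqI)
    show "sigma_finite_measure unif01" "sigma_finite_measure unif01" by unfold_locales
    show "sets ?P = sets (density ?P ?f)" by simp
    fix S T assume ST[measurable]: "S \<in> sets unif01" "T \<in> sets unif01"
    have i1: "integrable ?P (\<lambda>p. indicator (S \<times> T) p :: real)"
      by (intro square.P.integrable_const_bound[of _ 1]) (auto simp: indicator_def)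
    have i2: "integrable ?P (\<lambda>p. D p * indicator (S \<times> T) p)"
      by (rule Bochner_Integration.integrable_bound[OF int]) (auto simp: indicator_def)
    have "emeasure (density ?P ?f) (S \<times> T) = (\<integral>\<^sup>+p. ?f p * indicator (S \<times> T) p \<partial>?P)"
      by (rule emeasure_density) auto
    also have "\<dots> = (\<integral>\<^sup>+p. ennreal (indicator (S \<times> T) p + D p * indicator (S \<times> T) p / B) \<partial>?P)"
      by (intro nn_integral_cong) (auto simp: indicator_def)
    also have "\<dots> = ennreal (\<integral>p. indicator (S \<times> T) p + D p * indicator (S \<times> T) p / B \<partial>?P)"
      by (rule nn_integral_eq_integral) (use i1 i2 nn in \<open>auto simp: indicator_def intro!: AE_I2\<close>)
    also have "(\<integral>p. indicator (S \<times> T) p + D p * indicator (S \<times> T) p / B \<partial>?P) = measure ?P (S \<times> T)"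
      using i1 i2 rect[OF ST] by (subst Bochner_Integration.integral_add) auto
    also have "ennreal (measure ?P (S \<times> T)) = emeasure ?P (S \<times> T)"
      by (simp add: square.P.emeasure_eq_measure)
    also have "\<dots> = emeasure unif01 S * emeasure unif01 T"
      by (simp add: unif01.emeasure_pair_measure_Times)
    finally show "emeasure unif01 S * emeasure unif01 T = emeasure (density ?P ?f) (S \<times> T)" by simp
  qed
  then have "density ?P (\<lambda>_. 1) = density ?P ?f" by (simp add: density_1)
  then have "AE p in ?P. 1 = ?f p"
    by (subst (asm) finite_density_unique) (auto simp: square.P.emeasure_space_1)
  then show ?thesis
  proof (rule AE_mpI)
    fix p assume "p \<in> space ?P" "1 = ?f p"
    then have "1 + D p / B = 1" using nn by (metis ennreal_eq_1)
    then show "D p = 0" using \<open>B > 0\<close> by simp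
  qed
qed

text \<open>The four-cycle integral is the integral of the squared Gram kernel \<open>G\<close> of
  \<open>D\<close>. If it vanishes, so does \<open>G\<close>, and then the integral of
  \<open>D\<close> over every rectangle. Unlike the integral of the square of \<open>D\<close>, it
  repeats no value of \<open>D\<close>, so simple expressions can use it to test whether
  \<open>D\<close> is zero.\<close>

lemma kernel_eq_0_if_four_cycle_0:
  fixes D :: "real \<Rightarrow> real \<Rightarrow> real"
  assumes Dm[measurable]: "case_prod D \<in> borel_measurable (unif01 \<Otimes>\<^sub>M unif01)"
    and B: "\<And>x y. x \<in> {0..<1} \<Longrightarrow> y \<in> {0..<1} \<Longrightarrow> \<bar>D x y\<bar> \<le> B"
    and zero: "(\<integral>x. \<integral>x'. \<integral>q. \<integral>q'. D x q * D x q' * D x' q * D x' q'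
      \<partial>unif01 \<partial>unif01 \<partial>unif01 \<partial>unif01) = 0"
  shows "AE x in unif01. AE q in unif01. D x q = 0"
proof -
  define G where "G x x' = (\<integral>q. D x q * D x' q \<partial>unif01)" for x x'
  have B0: "0 \<le> B" using B[of 0 0] by simp
  have Gm[measurable]: "case_prod G \<in> borel_measurable (unif01 \<Otimes>\<^sub>M unif01)"
    unfolding G_def by measurable
  have GB: "\<bar>G x x'\<bar> \<le> B * B" if "x \<in> {0..<1}" "x' \<in> {0..<1}" for x x'
  proof -
    have "\<bar>G x x'\<bar> \<le> (\<integral>q. \<bar>D x q * D x' q\<bar> \<partial>unif01)"
      unfolding G_def by (rule integral_abs_bound)
    also have "\<dots> \<le> (\<integral>q. B * B \<partial>unif01)"
      by (rule integral_mono') (use that B B0 in \<open>auto simp: abs_mult intro!: mult_mono\<close>)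
    finally show ?thesis by (simp add: unif01.prob_space)
  qed
  have "(\<integral>q. \<integral>q'. D x q * D x q' * D x' q * D x' q' \<partial>unif01 \<partial>unif01) = (G x x')\<^sup>2" for x x'
  proof -
    have "(\<integral>q. \<integral>q'. D x q * D x q' * D x' q * D x' q' \<partial>unif01 \<partial>unif01) =
      (\<integral>q. D x q * D x' q * (\<integral>q'. D x q' * D x' q' \<partial>unif01) \<partial>unif01)"
      by (simp add: integral_mult_right_zero[symmetric] mult_ac del: integral_mult_right_zero)
    also have "\<dots> = (G x x')\<^sup>2" by (simp add: G_def power2_eq_square)
    finally show ?thesis .
  qed
  with zero have z: "(\<integral>x. \<integral>x'. (G x x')\<^sup>2 \<partial>unif01 \<partial>unif01) = 0" by simp
  have GGm[measurable]: "(\<lambda>(x, x'). (G x x')\<^sup>2) \<in> borel_measurable (unif01 \<Otimes>\<^sub>M unif01)" by measurable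
  have GG: "integrable (unif01 \<Otimes>\<^sub>M unif01) (\<lambda>(x, x'). (G x x')\<^sup>2)"
  proof (rule integrable_bounded_kernel[where B = "(B * B)\<^sup>2"])
    fix x y :: real assume "x \<in> {0..<1}" "y \<in> {0..<1}"
    from GB[OF this] show "\<bar>(G x y)\<^sup>2\<bar> \<le> (B * B)\<^sup>2"
      by (metis abs_ge_zero abs_power2 power2_abs power_mono)
  qed measurable
  have i1: "integrable unif01 (\<lambda>x. \<integral>x'. (G x x')\<^sup>2 \<partial>unif01)"
    using square.integrable_fst[OF GG] by simp
  have "AE x in unif01. (\<integral>x'. (G x x')\<^sup>2 \<partial>unif01) = 0"
    using z integral_nonneg_eq_0_iff_AE[OF i1] by simp
  then have G0: "AE x in unif01. AE x' in unif01. G x x' = 0"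
  proof (rule AE_mpI)
    fix x assume x: "x \<in> space unif01" and 0: "(\<integral>x'. (G x x')\<^sup>2 \<partial>unif01) = 0"
    have "integrable unif01 (\<lambda>x'. (G x x')\<^sup>2)"
    proof (rule unif01.integrable_const_bound[of _ "(B * B)\<^sup>2"])
      show "AE x' in unif01. norm ((G x x')\<^sup>2) \<le> (B * B)\<^sup>2"
        using GB x by (intro AE_I2) (metis abs_ge_zero abs_power2 power2_abs power_mono real_norm_def space_unif01)
      show "(\<lambda>x'. (G x x')\<^sup>2) \<in> borel_measurable unif01" using x by measurable
    qed
    from integral_nonneg_eq_0_iff_AE[OF this] 0 show "AE x' in unif01. G x x' = 0" by simp
  qed
  have "AE p in unif01 \<Otimes>\<^sub>M unif01. case_prod D p = 0"
  proof (rule kernel_eq_0_if_rectangles_0[of _ "B + 1"])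
    show "B + 1 > 0" using B0 by simp
    fix x y :: real assume "x \<in> {0..<1}" "y \<in> {0..<1}"
    from B[OF this] show "\<bar>case_prod D (x, y)\<bar> \<le> B + 1" by simp
  next
    fix S T assume ST[measurable]: "S \<in> sets unif01" "T \<in> sets unif01"
    define H where "H q = (\<integral>x. indicator S x * D x q \<partial>unif01)" for q
    have Hm[measurable]: "H \<in> borel_measurable unif01" unfolding H_def by measurable
    have HB: "\<bar>H q\<bar> \<le> B" if "q \<in> {0..<1}" for q
    proof -
      have "\<bar>H q\<bar> \<le> (\<integral>x. \<bar>indicator S x * D x q\<bar> \<partial>unif01)"
        unfolding H_def by (rule integral_abs_bound)
      also have "\<dots> \<le> (\<integral>q. B \<partial>unif01)"
        by (rule integral_mono') (use that B B0 in \<open>auto simp: indicator_def\<close>)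
      finally show ?thesis by (simp add: unif01.prob_space)
    qed
    have 1: "(\<integral>q. D x q * H q \<partial>unif01) = (\<integral>x'. indicator S x' * G x x' \<partial>unif01)" if x: "x \<in> {0..<1}" for x
    proof -
      have [measurable]: "x \<in> space unif01" using x by simp
      have int: "integrable (unif01 \<Otimes>\<^sub>M unif01) (\<lambda>(x', q). D x q * (indicator S x' * D x' q))"
      proof (rule integrable_bounded_kernel[where B = "B * B"])
        fix x' q :: real assume "x' \<in> {0..<1}" "q \<in> {0..<1}"
        then show "\<bar>D x q * (indicator S x' * D x' q)\<bar> \<le> B * B"
          using B[OF x, of q] B[of x' q] B0 by (auto simp: indicator_def abs_mult intro!: mult_mono)
      qed measurable
      have "(\<integral>q. D x q * H q \<partial>unif01) = (\<integral>q. \<integral>x'. D x q * (indicator S x' * D x' q) \<partial>unif01 \<partial>unif01)"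
        by (simp add: H_def)
      also have "\<dots> = (\<integral>x'. \<integral>q. D x q * (indicator S x' * D x' q) \<partial>unif01 \<partial>unif01)"
        by (rule square.Fubini_integral[OF int])
      also have "\<dots> = (\<integral>x'. indicator S x' * G x x' \<partial>unif01)"
        unfolding G_def by (intro Bochner_Integration.integral_cong refl)
          (simp add: integral_mult_right_zero[symmetric] mult_ac del: integral_mult_right_zero)
      finally show ?thesis .
    qed
    \<comment> \<open>Expanding one factor \<open>H\<close> and exchanging the integrals shows that
      the second moment of \<open>H\<close> is the integral of \<open>G\<close> over
      \<open>S \<times> S\<close>, which is 0.\<close>
    have "(\<integral>q. H q * H q \<partial>unif01) = (\<integral>q. \<integral>x. indicator S x * D x q * H q \<partial>unif01 \<partial>unif01)"
      by (simp add: H_def)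
    also have "\<dots> = (\<integral>x. \<integral>q. indicator S x * D x q * H q \<partial>unif01 \<partial>unif01)"
    proof (rule square.Fubini_integral, rule integrable_bounded_kernel[where B = "B * B"])
      fix x q :: real assume "x \<in> {0..<1}" "q \<in> {0..<1}"
      then show "\<bar>indicator S x * D x q * H q\<bar> \<le> B * B"
        using B[of x q] HB[of q] B0 by (auto simp: indicator_def abs_mult intro!: mult_mono)
    qed measurable
    also have "\<dots> = (\<integral>x. indicator S x * (\<integral>x'. indicator S x' * G x x' \<partial>unif01) \<partial>unif01)"
      by (intro Bochner_Integration.integral_cong refl) (simp add: 1[symmetric] mult.assoc)
    also have "\<dots> = (\<integral>x. 0 \<partial>unif01)"
    proof (rule integral_cong_AE)
      show "AE x in unif01. indicator S x * (\<integral>x'. indicator S x' * G x x' \<partial>unif01) = 0"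
        using G0
      proof (rule AE_mpI)
        fix x assume x: "x \<in> space unif01" and "AE x' in unif01. G x x' = 0"
        then have "(\<integral>x'. indicator S x' * G x x' \<partial>unif01) = (\<integral>x'. 0 \<partial>unif01)"
          by (intro integral_cong_AE) (auto intro: AE_mp)
        then show "indicator S x * (\<integral>x'. indicator S x' * G x x' \<partial>unif01) = 0" by simp
      qed
    qed measurable
    finally have HH: "(\<integral>q. H q * H q \<partial>unif01) = 0" by simp
    have "integrable unif01 (\<lambda>q. H q * H q)"
    proof (rule unif01.integrable_const_bound[of _ "B * B"])
      show "AE q in unif01. norm (H q * H q) \<le> B * B"
      proof (rule AE_I2)
        fix q assume "q \<in> space unif01"
        then have "\<bar>H q\<bar> \<le> B" using HB by simp
        from mult_mono[OF this this B0 abs_ge_zero] show "norm (H q * H q) \<le> B * B"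
          by (simp add: abs_mult)
      qed
    qed measurable
    from integral_nonneg_eq_0_iff_AE[OF this] HH have H0: "AE q in unif01. H q = 0" by simp
    have "(\<integral>p. case_prod D p * indicator (S \<times> T) p \<partial>(unif01 \<Otimes>\<^sub>M unif01)) =
      (\<integral>p. (\<lambda>(x, q). D x q * (indicator S x * indicator T q)) p \<partial>(unif01 \<Otimes>\<^sub>M unif01))"
      by (intro Bochner_Integration.integral_cong refl) (auto simp: indicator_def)
    also have "\<dots> = (\<integral>q. \<integral>x. D x q * (indicator S x * indicator T q) \<partial>unif01 \<partial>unif01)"
    proof (rule square.integral_snd[symmetric], rule integrable_bounded_kernel[where B = B])
      fix x q :: real assume "x \<in> {0..<1}" "q \<in> {0..<1}"
      then show "\<bar>D x q * (indicator S x * indicator T q)\<bar> \<le> B"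
        using B[of x q] B0 by (auto simp: indicator_def)
    qed measurable
    also have "\<dots> = (\<integral>q. indicator T q * H q \<partial>unif01)"
      unfolding H_def by (intro Bochner_Integration.integral_cong refl)
        (simp add: integral_mult_right_zero[symmetric] mult_ac del: integral_mult_right_zero)
    also have "\<dots> = (\<integral>q. 0 \<partial>unif01)"
      by (rule integral_cong_AE) (use H0 in \<open>auto intro: AE_mp\<close>)
    finally show "(\<integral>p. case_prod D p * indicator (S \<times> T) p \<partial>(unif01 \<Otimes>\<^sub>M unif01)) = 0" by simp
  qed measurable
  from square.AE_pair[OF this] show ?thesis by simp
qed

subsection \<open>Crossing two strands\<close>

text \<open>The joint law of two different coordinates of the cube is the product measure of the
  square.\<close>

lemma AE_cube_pair:
  assumes ij: "i < n" "j < n" "i \<noteq> j"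
    and AE: "AE p in unif01 \<Otimes>\<^sub>M unif01. P p"
  shows "AE z in cube {..<n}. P (z i, z j)"
proof -
  let ?T = "\<lambda>z :: nat \<Rightarrow> real. (z i, z j)"
  have Tm[measurable]: "?T \<in> measurable (cube {..<n}) (unif01 \<Otimes>\<^sub>M unif01)"
    using ij by (intro measurable_Pair measurable_component_singleton) auto
  have eq: "unif01 \<Otimes>\<^sub>M unif01 = distr (cube {..<n}) (unif01 \<Otimes>\<^sub>M unif01) ?T"
  proof (rule pair_measure_eqI)
    show "sigma_finite_measure unif01" "sigma_finite_measure unif01" by unfold_locales
    fix A B assume AB: "A \<in> sets unif01" "B \<in> sets unif01"
    let ?X = "\<lambda>k. if k = i then A else if k = j then B else space unif01"
    have sub: "A \<subseteq> space unif01" "B \<subseteq> space unif01" using AB sets.sets_into_space by blast+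
    have "emeasure (distr (cube {..<n}) (unif01 \<Otimes>\<^sub>M unif01) ?T) (A \<times> B) =
        emeasure (cube {..<n}) (?T -` (A \<times> B) \<inter> space (cube {..<n}))"
      using AB by (intro emeasure_distr) auto
    also have "?T -` (A \<times> B) \<inter> space (cube {..<n}) = PiE {..<n} ?X"
    proof (intro set_eqI iffI)
      fix z assume "z \<in> ?T -` (A \<times> B) \<inter> space (cube {..<n})"
      then show "z \<in> PiE {..<n} ?X" by (simp add: space_PiM PiE_iff)
    next
      fix z assume z: "z \<in> PiE {..<n} ?X"
      have "z i \<in> A" "z j \<in> B" using PiE_mem[OF z, of i] PiE_mem[OF z, of j] ij by auto
      moreover have "z k \<in> space unif01" if "k < n" for k
        using PiE_mem[OF z, of k] that sub by (auto split: if_splits)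
      ultimately show "z \<in> ?T -` (A \<times> B) \<inter> space (cube {..<n})"
        using z by (simp add: space_PiM PiE_iff)
    qed
    also have "emeasure (cube {..<n}) (PiE {..<n} ?X) = (\<Prod>k<n. emeasure unif01 (?X k))"
      using AB by (intro cubes.emeasure_PiM) auto
    also have "\<dots> = emeasure unif01 A * emeasure unif01 B"
    proof -
      have "(\<Prod>k<n. emeasure unif01 (?X k)) = (\<Prod>k\<in>{i, j}. emeasure unif01 (?X k))"
        using ij unif01.emeasure_space_1 by (intro prod.mono_neutral_right) auto
      then show ?thesis using ij by simp
    qed
    finally show "emeasure unif01 A * emeasure unif01 B =
      emeasure (distr (cube {..<n}) (unif01 \<Otimes>\<^sub>M unif01) ?T) (A \<times> B)" by simp
  qed simp
  have "AE p in distr (cube {..<n}) (unif01 \<Otimes>\<^sub>M unif01) ?T. P p"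
    by (subst eq[symmetric]) (rule AE)
  from AE_distrD[OF Tm this] show ?thesis .
qed

lemma ind_density_cong_AE:
  assumes W: "graphon W" "graphon W'"
    and eq: "AE x in unif01. AE y in unif01. W (x, y) = W' (x, y)"
  shows "ind_density W n E = ind_density W' n E"
proof -
  note [measurable] = W[THEN graphon_measurable]
  have "AE p in unif01 \<Otimes>\<^sub>M unif01. W p = W' p"
    by (rule square.AE_pair_measure) (use eq in measurable)
  then have "AE z in cube {..<n}. W (z i, z j) = W' (z i, z j)" if "i < n" "j < n" "i \<noteq> j" for i j
    using AE_cube_pair[OF that] by blast
  then have "AE z in cube {..<n}. edge_val W z e = edge_val W' z e" if "e \<in> edges n" for e
    using that unfolding edge_val_def by (elim edgesE) auto
  then have "AE z in cube {..<n}. \<forall>e\<in>edges n. edge_val W z e = edge_val W' z e"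
    by (intro AE_ball_countable[THEN iffD2] countable_finite) auto
  then have "AE z in cube {..<n}.
      (\<Prod>e\<in>edges n. if e \<in> E then edge_val W z e else 1 - edge_val W z e) =
      (\<Prod>e\<in>edges n. if e \<in> E then edge_val W' z e else 1 - edge_val W' z e)"
    by eventually_elim (rule prod.cong, auto)
  then show ?thesis
    unfolding ind_density_def
    by (intro integral_cong_AE borel_measurable_integrable ind_integrable W)
qed

text \<open>Reflexive on purpose: an atom has positive mass and is completely joined to
  itself.\<close>

definition adjacent :: "nat \<Rightarrow> nat \<Rightarrow> bool" where
  "adjacent i j \<longleftrightarrow> i \<le> Suc j \<and> j \<le> Suc i"

definition crossed :: "(nat \<Rightarrow> bool \<Rightarrow> real set) \<Rightarrow> real \<Rightarrow> real \<Rightarrow> bool" where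
  "crossed U x y \<longleftrightarrow> (\<exists>s s'. x \<in> U 0 s \<and> y \<in> U 1 s' \<or> x \<in> U 1 s \<and> y \<in> U 0 s')"

text \<open>In the application the values between the positions 0 and 1 are almost everywhere
  \<open>of_bool (s = s')\<close>, so complementing them exchanges the two ways of joining the
  strands there.\<close>

definition cross :: "(nat \<Rightarrow> bool \<Rightarrow> real set) \<Rightarrow> (real \<times> real \<Rightarrow> real) \<Rightarrow> real \<times> real \<Rightarrow> real" where
  "cross U W = (\<lambda>p\<in>{0..<1} \<times> {0..<1}. if crossed U (fst p) (snd p) then 1 - W p else W p)"

lemma cross_eq:
  "x \<in> {0..<1} \<Longrightarrow> y \<in> {0..<1} \<Longrightarrow>
    cross U W (x, y) = (if crossed U x y then 1 - W (x, y) else W (x, y))"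
  by (simp add: cross_def)

lemma crossed_sym: "crossed U x y = crossed U y x"
  by (auto simp: crossed_def)

lemma graphon_cross:
  assumes W: "graphon W" and [measurable]: "\<And>j s. U j s \<in> sets unif01"
  shows "graphon (cross U W)"
  unfolding graphon_def
proof (intro conjI ballI)
  note [measurable] = graphon_measurable[OF W]
  show "cross U W \<in> {0..<1} \<times> {0..<1} \<rightarrow>\<^sub>E {0..1}"
    using graphon_bounds[OF W] by (auto simp: cross_def)
  show "cross U W (x, y) = cross U W (y, x)" if "x \<in> {0..<1}" "y \<in> {0..<1}" for x y
    using that graphon_sym[OF W, of x y] by (simp add: cross_eq crossed_sym[of U x])
  have eq: "crossed U (fst p) (snd p) \<longleftrightarrow> p \<in> (\<Union>s. \<Union>s'. U 0 s \<times> U 1 s' \<union> U 1 s \<times> U 0 s')" for p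
    by (cases p) (auto simp: crossed_def)
  have "(\<Union>s. \<Union>s'. U 0 s \<times> U 1 s' \<union> U 1 s \<times> U 0 s') \<in> sets (unif01 \<Otimes>\<^sub>M unif01)"
    by measurable
  then have "(\<lambda>p. if p \<in> (\<Union>s. \<Union>s'. U 0 s \<times> U 1 s' \<union> U 1 s \<times> U 0 s') then 1 - W p else W p)
      \<in> borel_measurable (unif01 \<Otimes>\<^sub>M unif01)"
    by measurable
  then show "cross U W \<in> borel_measurable (unif01 \<Otimes>\<^sub>M unif01)"
    unfolding eq[symmetric]
    by (rule measurable_cong[THEN iffD1, rotated]) (auto simp: cross_def space_pair_measure)
qed

text \<open>\<open>U j s\<close> is the \<open>j\<close>-th atom of strand \<open>s\<close>. Swapping the two strands at the positions
  \<open>1, \<dots>, t - 1\<close> turns the crossing between the positions 0 and 1 into one between \<open>t - 1\<close>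
  and \<open>t\<close>, which is invisible to samples that miss position \<open>t\<close>.\<close>

locale two_strands =
  fixes W :: "real \<times> real \<Rightarrow> real" and U :: "nat \<Rightarrow> bool \<Rightarrow> real set"
    and h :: "nat \<Rightarrow> real \<Rightarrow> real" and K :: nat
  assumes W: "graphon W" and K2: "2 \<le> K"
    and U_sets [measurable]: "\<And>j s. U j s \<in> sets unif01"
    and U_disj: "\<And>j s j' s' x. x \<in> U j s \<Longrightarrow> x \<in> U j' s' \<Longrightarrow> j \<le> K \<Longrightarrow> j' \<le> K \<Longrightarrow> j = j' \<and> s = s'"
    and U_mass: "\<And>j. j \<le> K \<Longrightarrow> measure unif01 (U j True) = measure unif01 (U j False)"
    and U_pos: "\<And>j s. j \<le> K \<Longrightarrow> U j s \<noteq> {}"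
    and h_meas [measurable]: "\<And>j. h j \<in> borel_measurable unif01"
    and h_range: "\<And>j x. x \<in> {0..<1} \<Longrightarrow> h j x \<in> {0..1}"
    and interior: "\<And>j s. 1 \<le> j \<Longrightarrow> j < K \<Longrightarrow> AE x in unif01. x \<in> U j s \<longrightarrow>
      (AE y in unif01. W (x, y) = (if \<exists>j'\<le>K. \<exists>s'. y \<in> U j' s'
        then of_bool (\<exists>j'\<le>K. y \<in> U j' s \<and> adjacent j j') else h j y))"
begin

text \<open>The prescribed row of the interior atom \<open>j\<close> of strand \<open>s\<close>. Off
  the two strands it depends on \<open>j\<close> alone, which is why the two atoms of an interior
  position can be exchanged.\<close>

definition H :: "nat \<Rightarrow> bool \<Rightarrow> real \<Rightarrow> real" where
  "H j s y = (if \<exists>j'\<le>K. \<exists>s'. y \<in> U j' s'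
    then of_bool (\<exists>j'\<le>K. y \<in> U j' s \<and> adjacent j j') else h j y)"

definition inner :: "real set" where
  "inner = (\<Union>j\<in>{1..<K}. \<Union>s. U j s)"

text \<open>A lookup by interior atom, written as a sum of indicators so that measurability in
  \<open>x\<close> is immediate.\<close>

definition sel :: "(nat \<Rightarrow> bool \<Rightarrow> real) \<Rightarrow> real \<Rightarrow> real" where
  "sel a x = (\<Sum>j\<in>{1..<K}. \<Sum>s\<in>UNIV. indicator (U j s) x * a j s)"

lemma U_space: "x \<in> U j s \<Longrightarrow> x \<in> {0..<1}"
  using sets.sets_into_space[OF U_sets, of j s] by auto

lemma sel_in: "sel a x = a j s" if "x \<in> U j s" "1 \<le> j" "j < K"
proof -
  have "sel a x = (\<Sum>j'\<in>{1..<K}. \<Sum>s'\<in>UNIV. if j' = j then (if s' = s then a j s else 0) else 0)"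
    unfolding sel_def
  proof (intro sum.cong refl)
    fix j' s' assume "j' \<in> {1..<K}"
    then have "j' \<le> K" by simp
    then have "x \<in> U j' s' \<longleftrightarrow> j' = j \<and> s' = s"
      using U_disj[OF that(1), of j' s'] that by auto
    then show "indicator (U j' s') x * a j' s' = (if j' = j then (if s' = s then a j s else 0) else 0)"
      by (simp add: indicator_def)
  qed
  also have "\<dots> = (\<Sum>j'\<in>{1..<K}. if j' = j then a j s else 0)"
    by (intro sum.cong refl) (auto simp: sum.delta)
  also have "\<dots> = a j s" using that by (simp add: sum.delta)
  finally show ?thesis .
qed

lemma inner_sets [measurable]: "inner \<in> sets unif01"
  unfolding inner_def by measurable

lemma H_measurable [measurable]: "H j s \<in> borel_measurable unif01"
proof -
  have "{y \<in> space unif01. \<exists>j'\<le>K. \<exists>s'. y \<in> U j' s'} = (\<Union>j'\<in>{..K}. \<Union>s'. U j' s')"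
    using U_space by auto
  then have [measurable]: "Measurable.pred unif01 (\<lambda>y. \<exists>j'\<le>K. \<exists>s'. y \<in> U j' s')"
    unfolding pred_def by (auto intro!: sets.finite_UN)
  have "{y \<in> space unif01. \<exists>j'\<le>K. y \<in> U j' s \<and> adjacent j j'} = (\<Union>j'\<in>{j'\<in>{..K}. adjacent j j'}. U j' s)"
    using U_space by auto
  then have [measurable]: "Measurable.pred unif01 (\<lambda>y. \<exists>j'\<le>K. y \<in> U j' s \<and> adjacent j j')"
    unfolding pred_def by (auto intro!: sets.finite_UN)
  show ?thesis unfolding H_def by measurable
qed

lemma H_range: "y \<in> {0..<1} \<Longrightarrow> H j s y \<in> {0..1}"
  using h_range by (auto simp: H_def)

text \<open>A version of \<open>W\<close> with the prescribed rows at every interior point and not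
  just at almost every one. Below, a whole atom is moved to a single representative, and that point
  might lie in an exceptional null set of \<open>W\<close>.\<close>

definition W1 :: "real \<times> real \<Rightarrow> real" where
  "W1 = (\<lambda>p\<in>{0..<1} \<times> {0..<1}. if fst p \<in> inner then sel (\<lambda>j s. H j s (snd p)) (fst p)
    else if snd p \<in> inner then sel (\<lambda>j s. H j s (fst p)) (snd p) else W p)"

lemma innerE:
  assumes "x \<in> inner" obtains j s where "x \<in> U j s" "1 \<le> j" "j < K"
  using assms by (auto simp: inner_def)

lemma inner_iff: "x \<in> U j s \<Longrightarrow> j \<le> K \<Longrightarrow> x \<in> inner \<longleftrightarrow> 1 \<le> j \<and> j < K"
proof -
  assume x: "x \<in> U j s" "j \<le> K"
  have "1 \<le> j \<and> j < K" if "x \<in> inner"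
  proof -
    from that obtain j' s' where "x \<in> U j' s'" "1 \<le> j'" "j' < K" by (rule innerE)
    then show ?thesis using U_disj[OF x(1), of j' s'] x(2) by simp
  qed
  then show ?thesis using x unfolding inner_def by auto
qed

lemma H_U: "y \<in> U j' s' \<Longrightarrow> j' \<le> K \<Longrightarrow> H j s y = of_bool (s = s' \<and> adjacent j j')"
proof -
  assume y: "y \<in> U j' s'" "j' \<le> K"
  have "(\<exists>i\<le>K. y \<in> U i s \<and> adjacent j i) \<longleftrightarrow> s = s' \<and> adjacent j j'"
    using U_disj[OF y(1)] y by blast
  moreover have "\<exists>j'\<le>K. \<exists>s'. y \<in> U j' s'" using y by blast
  ultimately show ?thesis unfolding H_def by simp
qed

lemma H_out: "(\<And>j' s'. j' \<le> K \<Longrightarrow> y \<notin> U j' s') \<Longrightarrow> H j s y = h j y"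
  by (auto simp: H_def)

lemma W1_left: "x \<in> U j s \<Longrightarrow> 1 \<le> j \<Longrightarrow> j < K \<Longrightarrow> y \<in> {0..<1} \<Longrightarrow> W1 (x, y) = H j s y"
  using U_space[of x j s] inner_iff[of x j s] by (simp add: W1_def sel_in)

lemma W1_right: "y \<in> U j s \<Longrightarrow> 1 \<le> j \<Longrightarrow> j < K \<Longrightarrow> x \<in> {0..<1} \<Longrightarrow> W1 (x, y) = H j s x"
proof -
  assume y: "y \<in> U j s" "1 \<le> j" "j < K" and x: "x \<in> {0..<1}"
  show ?thesis
  proof (cases "x \<in> inner")
    case True
    then obtain j' s' where x': "x \<in> U j' s'" "1 \<le> j'" "j' < K" by (rule innerE)
    have "W1 (x, y) = H j' s' y" using x' y U_space by (intro W1_left) auto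
    also have "\<dots> = H j s x" using x' y by (simp add: H_U adjacent_def) auto
    finally show ?thesis .
  next
    case False
    then show ?thesis using y x U_space[of y j s] inner_iff[of y j s] by (simp add: W1_def sel_in)
  qed
qed

lemma W1_outer: "x \<notin> inner \<Longrightarrow> y \<notin> inner \<Longrightarrow> x \<in> {0..<1} \<Longrightarrow> y \<in> {0..<1} \<Longrightarrow> W1 (x, y) = W (x, y)"
  by (simp add: W1_def)

lemma graphon_W1: "graphon W1"
  unfolding graphon_def
proof (intro conjI ballI)
  note [measurable] = graphon_measurable[OF W]
  show "W1 \<in> {0..<1} \<times> {0..<1} \<rightarrow>\<^sub>E {0..1}"
  proof (rule PiE_I)
    fix p :: "real \<times> real" assume "p \<in> {0..<1} \<times> {0..<1}"
    then obtain x y where p: "p = (x, y)" "x \<in> {0..<1}" "y \<in> {0..<1}" by auto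
    show "W1 p \<in> {0..1}"
    proof (cases "x \<in> inner")
      case True
      then obtain j s where "x \<in> U j s" "1 \<le> j" "j < K" by (rule innerE)
      then show ?thesis using p W1_left H_range by simp
    next
      case x: False
      show ?thesis
      proof (cases "y \<in> inner")
        case True
        then obtain j s where "y \<in> U j s" "1 \<le> j" "j < K" by (rule innerE)
        then show ?thesis using p W1_right H_range by simp
      next
        case False
        then show ?thesis using p x W1_outer graphon_bounds[OF W] by simp
      qed
    qed
  qed (auto simp: W1_def)
  show "W1 (x, y) = W1 (y, x)" if xy: "x \<in> {0..<1}" "y \<in> {0..<1}" for x y
  proof (cases "x \<in> inner")
    case True
    then obtain j s where "x \<in> U j s" "1 \<le> j" "j < K" by (rule innerE)
    then show ?thesis using xy W1_left W1_right by simp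
  next
    case x: False
    show ?thesis
    proof (cases "y \<in> inner")
      case True
      then obtain j s where "y \<in> U j s" "1 \<le> j" "j < K" by (rule innerE)
      then show ?thesis using xy W1_left W1_right by simp
    next
      case False
      then show ?thesis using xy x W1_outer graphon_sym[OF W] by simp
    qed
  qed
  have "(\<lambda>p. if fst p \<in> inner then sel (\<lambda>j s. H j s (snd p)) (fst p)
    else if snd p \<in> inner then sel (\<lambda>j s. H j s (fst p)) (snd p) else W p)
    \<in> borel_measurable (unif01 \<Otimes>\<^sub>M unif01)"
    unfolding sel_def by measurable
  then show "W1 \<in> borel_measurable (unif01 \<Otimes>\<^sub>M unif01)"
    by (rule measurable_cong[THEN iffD1, rotated]) (auto simp: W1_def space_pair_measure)
qed

lemma W1_AE: "AE x in unif01. AE y in unif01. W (x, y) = W1 (x, y)"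
proof -
  note [measurable] = graphon_measurable[OF W]
  have 1: "AE x in unif01. \<forall>j\<in>{1..<K}. \<forall>s. x \<in> U j s \<longrightarrow> (AE y in unif01. W (x, y) = H j s y)"
  proof -
    have "AE x in unif01. \<forall>j\<in>{1..<K}. \<forall>s\<in>UNIV. x \<in> U j s \<longrightarrow> (AE y in unif01. W (x, y) = H j s y)"
      using interior unfolding H_def[abs_def]
      by (intro AE_ball_countable[THEN iffD2] ballI countable_finite) auto
    then show ?thesis by simp
  qed
  have "AE y in unif01. AE x in unif01. x \<in> U j s \<longrightarrow> W (x, y) = H j s y" if "1 \<le> j" "j < K" for j s
  proof (subst square.AE_commute[symmetric])
    show "AE x in unif01. AE y in unif01. x \<in> U j s \<longrightarrow> W (x, y) = H j s y"
      using 1 by (rule AE_mp) (use that in \<open>auto intro!: AE_I2\<close>)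
  qed measurable
  then have 2: "AE x in unif01. \<forall>j\<in>{1..<K}. \<forall>s\<in>UNIV. AE y in unif01. y \<in> U j s \<longrightarrow> W (y, x) = H j s x"
    by (intro AE_ball_countable[THEN iffD2] ballI countable_finite) auto
  from 1 2 AE_space show ?thesis
  proof (eventually_elim)
    fix x assume a: "\<forall>j\<in>{1..<K}. \<forall>s. x \<in> U j s \<longrightarrow> (AE y in unif01. W (x, y) = H j s y)"
      and "\<forall>j\<in>{1..<K}. \<forall>s\<in>UNIV. AE y in unif01. y \<in> U j s \<longrightarrow> W (y, x) = H j s x"
      and x0: "x \<in> space unif01"
    then have b: "AE y in unif01. \<forall>j\<in>{1..<K}. \<forall>s\<in>UNIV. y \<in> U j s \<longrightarrow> W (y, x) = H j s x"
      by (intro AE_ball_countable[THEN iffD2] ballI countable_finite) auto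
    have x: "x \<in> {0..<1}" using x0 by simp
    show "AE y in unif01. W (x, y) = W1 (x, y)"
    proof (cases "x \<in> inner")
      case True
      then obtain j s where js: "x \<in> U j s" "1 \<le> j" "j < K" by (rule innerE)
      with a have "AE y in unif01. W (x, y) = H j s y" by auto
      then show ?thesis by (rule AE_mp) (use js W1_left in \<open>auto intro!: AE_I2\<close>)
    next
      case False
      show ?thesis
        using b
      proof (rule AE_mpI)
        fix y assume y: "y \<in> space unif01"
          and c: "\<forall>j\<in>{1..<K}. \<forall>s\<in>UNIV. y \<in> U j s \<longrightarrow> W (y, x) = H j s x"
        show "W (x, y) = W1 (x, y)"
        proof (cases "y \<in> inner")
          case True
          then obtain j s where js: "y \<in> U j s" "1 \<le> j" "j < K" by (rule innerE)
          then show ?thesis using c W1_right[OF js x] graphon_sym[OF W x, of y] y by auto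
        qed (use False x y W1_outer in auto)
      qed
    qed
  qed
qed

definition W2 :: "real \<times> real \<Rightarrow> real" where
  "W2 = cross U W1"

lemma graphon_W2: "graphon W2"
  unfolding W2_def by (rule graphon_cross[OF graphon_W1 U_sets])

lemma W2_AE: "AE x in unif01. AE y in unif01. cross U W (x, y) = W2 (x, y)"
  using W1_AE AE_space
proof eventually_elim
  case (elim x)
  from elim(1) AE_space show ?case
    by eventually_elim (use elim(2) in \<open>simp add: W2_def cross_eq\<close>)
qed

section \<open>Exchanging the strands below a position\<close>

definition cd :: "nat \<Rightarrow> bool \<Rightarrow> real" where
  "cd j s = (SOME x. x \<in> U j s)"

lemma cd_in: "j \<le> K \<Longrightarrow> cd j s \<in> U j s"
proof -
  assume "j \<le> K"
  then have "\<exists>x. x \<in> U j s" using U_pos by blast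
  then show ?thesis unfolding cd_def by (rule someI_ex)
qed

definition q :: "nat \<Rightarrow> real \<Rightarrow> real" where
  "q t x = (if x \<in> inner then sel (\<lambda>j s. cd j (s \<noteq> (j < t))) x else x)"

lemma q_in: "x \<in> U j s \<Longrightarrow> 1 \<le> j \<Longrightarrow> j < K \<Longrightarrow> q t x = cd j (s \<noteq> (j < t))"
  by (simp add: q_def inner_iff sel_in)

lemma q_out: "x \<notin> inner \<Longrightarrow> q t x = x"
  by (simp add: q_def)

lemma q_space: "x \<in> {0..<1} \<Longrightarrow> q t x \<in> {0..<1}"
proof (cases "x \<in> inner")
  case True
  then obtain j s where "x \<in> U j s" "1 \<le> j" "j < K" by (rule innerE)
  then show ?thesis using q_in cd_in[of j] U_space less_imp_le by metis
qed (simp add: q_out)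

lemma q_measurable [measurable]: "q t \<in> measurable unif01 unif01"
proof -
  have [measurable]: "(\<lambda>x. x) \<in> borel_measurable unif01"
    by (simp add: unif01_def measurable_restrict_space1)
  have "q t \<in> borel_measurable unif01"
    unfolding q_def sel_def by measurable
  then have "q t \<in> measurable unif01 lborel" by simp
  moreover have "q t \<in> space unif01 \<rightarrow> {0..<1}" using q_space by auto
  ultimately have "q t \<in> measurable unif01 (restrict_space lborel {0..<1})"
    by (intro measurable_restrict_space2) auto
  then show ?thesis by (simp add: unif01_def)
qed

lemma q_U: "j \<le> K \<Longrightarrow> (\<exists>s. q t x \<in> U j s) \<longleftrightarrow> (\<exists>s. x \<in> U j s)"
proof (cases "x \<in> inner")
  case True
  assume j: "j \<le> K"
  from True obtain j' s where x: "x \<in> U j' s" "1 \<le> j'" "j' < K" by (rule innerE)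
  have "q t x \<in> U j' (s \<noteq> (j' < t))" using x q_in cd_in[of j'] by simp
  then show ?thesis using x j U_disj[of _ j' _ j] less_imp_le[OF x(3)] by metis
qed (simp add: q_out)

text \<open>The image measure consists of the part outside \<open>inner\<close> and of point masses
  at the representatives. Changing \<open>t\<close> only permutes the two point masses of a
  position, and these are equal by \<open>U_mass\<close>.\<close>

lemma distr_q: "distr unif01 unif01 (q t) = distr unif01 unif01 (q t')"
proof -
  have ind: "indicator A (q t x) = indicator (A - inner) x +
      (\<Sum>j\<in>{1..<K}. \<Sum>s\<in>UNIV. indicator (U j s) x * indicator A (cd j (s \<noteq> (j < t))) :: ennreal)" for A t x
  proof (cases "x \<in> inner")
    case True
    then obtain j s where x: "x \<in> U j s" "1 \<le> j" "j < K" by (rule innerE)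
    have "(\<Sum>j\<in>{1..<K}. \<Sum>s\<in>UNIV. indicator (U j s) x * indicator A (cd j (s \<noteq> (j < t))) :: ennreal)
      = (\<Sum>j'\<in>{1..<K}. \<Sum>s'\<in>UNIV. if j' = j then (if s' = s then indicator A (cd j (s \<noteq> (j < t))) else 0) else 0)"
    proof (intro sum.cong refl)
      fix j' s' assume "j' \<in> {1..<K}"
      then have "j' \<le> K" by simp
      then have "x \<in> U j' s' \<longleftrightarrow> j' = j \<and> s' = s"
        using U_disj[OF x(1), of j' s'] x by auto
      then show "indicator (U j' s') x * indicator A (cd j' (s' \<noteq> (j' < t))) =
        (if j' = j then (if s' = s then indicator A (cd j (s \<noteq> (j < t))) else 0) else 0 :: ennreal)"
        by (auto simp: indicator_def)
    qed
    also have "\<dots> = (\<Sum>j'\<in>{1..<K}. if j' = j then indicator A (cd j (s \<noteq> (j < t))) else 0)"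
      by (intro sum.cong refl) (auto simp: sum.delta)
    also have "\<dots> = indicator A (cd j (s \<noteq> (j < t)))" using x by (simp add: sum.delta)
    finally show ?thesis using True q_in[OF x] by simp
  next
    case False
    then have "(\<Sum>j\<in>{1..<K}. \<Sum>s\<in>UNIV. indicator (U j s) x * indicator A (cd j (s \<noteq> (j < t))) :: ennreal) = 0"
      by (intro sum.neutral ballI) (auto simp: inner_def indicator_def)
    then show ?thesis using False by (simp add: q_out indicator_def)
  qed
  have em: "emeasure (distr unif01 unif01 (q t)) A = emeasure unif01 (A - inner) +
      (\<Sum>j\<in>{1..<K}. \<Sum>s\<in>UNIV. emeasure unif01 (U j s) * indicator A (cd j (s \<noteq> (j < t))))"
    if A[measurable]: "A \<in> sets unif01" for A t
  proof -
    have "emeasure (distr unif01 unif01 (q t)) A = (\<integral>\<^sup>+x. indicator A x \<partial>distr unif01 unif01 (q t))"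
      by (simp add: A)
    also have "\<dots> = (\<integral>\<^sup>+x. indicator A (q t x) \<partial>unif01)"
      by (rule nn_integral_distr) auto
    also have "\<dots> = emeasure unif01 (A - inner) +
      (\<Sum>j\<in>{1..<K}. \<Sum>s\<in>UNIV. emeasure unif01 (U j s) * indicator A (cd j (s \<noteq> (j < t))))"
    proof -
      let ?f = "\<lambda>j s x. indicator (U j s) x * indicator A (cd j (s \<noteq> (j < t))) :: ennreal"
      have "(\<integral>\<^sup>+x. indicator A (q t x) \<partial>unif01) =
          (\<integral>\<^sup>+x. indicator (A - inner) x + (\<Sum>j\<in>{1..<K}. \<Sum>s\<in>UNIV. ?f j s x) \<partial>unif01)"
        unfolding ind ..
      also have "\<dots> = (\<integral>\<^sup>+x. indicator (A - inner) x \<partial>unif01) +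
          (\<integral>\<^sup>+x. (\<Sum>j\<in>{1..<K}. \<Sum>s\<in>UNIV. ?f j s x) \<partial>unif01)"
        by (rule nn_integral_add) measurable
      also have "(\<integral>\<^sup>+x. indicator (A - inner) x \<partial>unif01) = emeasure unif01 (A - inner)"
        by (rule nn_integral_indicator) measurable
      also have "(\<integral>\<^sup>+x. (\<Sum>j\<in>{1..<K}. \<Sum>s\<in>UNIV. ?f j s x) \<partial>unif01) =
          (\<Sum>j\<in>{1..<K}. \<integral>\<^sup>+x. (\<Sum>s\<in>UNIV. ?f j s x) \<partial>unif01)"
        by (rule nn_integral_sum) measurable
      also have "\<dots> = (\<Sum>j\<in>{1..<K}. \<Sum>s\<in>UNIV. \<integral>\<^sup>+x. ?f j s x \<partial>unif01)"
        by (rule sum.cong[OF refl], rule nn_integral_sum) measurable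
      also have "\<dots> = (\<Sum>j\<in>{1..<K}. \<Sum>s\<in>UNIV. emeasure unif01 (U j s) * indicator A (cd j (s \<noteq> (j < t))))"
      proof (rule sum.cong[OF refl], rule sum.cong[OF refl])
        fix j s
        have "(\<integral>\<^sup>+x. ?f j s x \<partial>unif01) =
            (\<integral>\<^sup>+x. indicator (U j s) x \<partial>unif01) * indicator A (cd j (s \<noteq> (j < t)))"
          by (rule nn_integral_multc) measurable
        then show "(\<integral>\<^sup>+x. ?f j s x \<partial>unif01) =
            emeasure unif01 (U j s) * indicator A (cd j (s \<noteq> (j < t)))"
          by (simp only: nn_integral_indicator[OF U_sets])
      qed
      finally show ?thesis .
    qed
    finally show ?thesis .
  qed
  show ?thesis
  proof (rule measure_eqI)
    fix A assume "A \<in> sets (distr unif01 unif01 (q t))"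
    then have A: "A \<in> sets unif01" by simp
    have *: "emeasure unif01 (U j True) = emeasure unif01 (U j False)" if "j < K" for j
      using U_mass[of j] that by (simp add: unif01.emeasure_eq_measure)
    have **: "(\<Sum>s\<in>UNIV. emeasure unif01 (U j s) * indicator A (cd j (s \<noteq> (j < t)))) =
        emeasure unif01 (U j False) * (indicator A (cd j True) + indicator A (cd j False))" if "j < K" for j t
    proof -
      have "(\<Sum>s\<in>UNIV. g s) = g False + g True" for g :: "bool \<Rightarrow> ennreal"
        by (simp add: UNIV_bool)
      note this[of "\<lambda>s. emeasure unif01 (U j s) * indicator A (cd j (s \<noteq> (j < t)))"]
      also have "emeasure unif01 (U j False) * indicator A (cd j (False \<noteq> (j < t))) +
          emeasure unif01 (U j True) * indicator A (cd j (True \<noteq> (j < t))) =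
          emeasure unif01 (U j False) * (indicator A (cd j True) + indicator A (cd j False))"
        using * that by (cases "j < t") (simp_all add: distrib_left add.commute)
      finally show ?thesis .
    qed
    have "(\<Sum>j\<in>{1..<K}. \<Sum>s\<in>UNIV. emeasure unif01 (U j s) * indicator A (cd j (s \<noteq> (j < t)))) =
      (\<Sum>j\<in>{1..<K}. \<Sum>s\<in>UNIV. emeasure unif01 (U j s) * indicator A (cd j (s \<noteq> (j < t'))))"
      by (rule sum.cong[OF refl]) (simp only: ** atLeastLessThan_iff)
    then show "emeasure (distr unif01 unif01 (q t)) A = emeasure (distr unif01 unif01 (q t')) A"
      unfolding em[OF A] by (rule arg_cong)
  qed simp
qed

lemma W1_q0:
  assumes "a \<in> {0..<1}" "b \<in> {0..<1}"
  shows "W1 (q 0 a, q 0 b) = W1 (a, b)"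
proof (cases "a \<in> inner")
  case True
  then obtain j s where a: "a \<in> U j s" "1 \<le> j" "j < K" by (rule innerE)
  have qa: "q 0 a \<in> U j s" using q_in[OF a] cd_in[of j s] a by simp
  show ?thesis
  proof (cases "b \<in> inner")
    case True
    then obtain j' s' where b: "b \<in> U j' s'" "1 \<le> j'" "j' < K" by (rule innerE)
    have qb: "q 0 b \<in> U j' s'" using q_in[OF b] cd_in[of j' s'] b by simp
    show ?thesis
      using W1_left[OF qa a(2,3) q_space[OF assms(2)]] W1_left[OF a assms(2)] H_U[OF qb] H_U[OF b(1)] b by simp
  next
    case False
    then show ?thesis
      using W1_left[OF qa a(2,3) assms(2)] W1_left[OF a assms(2)] by (simp add: q_out)
  qed
next
  case a: False
  show ?thesis
  proof (cases "b \<in> inner")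
    case True
    then obtain j' s' where b: "b \<in> U j' s'" "1 \<le> j'" "j' < K" by (rule innerE)
    have qb: "q 0 b \<in> U j' s'" using q_in[OF b] cd_in[of j' s'] b by simp
    show ?thesis
      using W1_right[OF qb b(2,3) assms(1)] W1_right[OF b assms(1)] a by (simp add: q_out)
  qed (simp add: a q_out)
qed

text \<open>Adjacent positions other than \<open>t\<close> lie on the same side of \<open>t\<close>,
  so both points change strand or neither does. The only exception is position 0: it is never moved,
  while its neighbour 1 is, being below \<open>t\<close>. This exception is the crossing.\<close>

lemma W1_q_left:
  assumes t: "1 \<le> t" "t < K" and a: "a \<in> U j s" "1 \<le> j" "j < K" and jt: "j \<noteq> t"
    and b: "b \<in> {0..<1}" "\<And>s. b \<notin> U t s"
  shows "W1 (q t a, q t b) = (if crossed U a b then 1 - W1 (a, b) else W1 (a, b))"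
proof -
  have qa: "q t a \<in> U j (s \<noteq> (j < t))" using q_in[OF a] cd_in[of j] a by simp
  have 1: "W1 (q t a, q t b) = H j (s \<noteq> (j < t)) (q t b)"
    by (rule W1_left[OF qa a(2,3) q_space[OF b(1)]])
  have 2: "W1 (a, b) = H j s b" by (rule W1_left[OF a b(1)])
  show ?thesis
  proof (cases "\<exists>j'\<le>K. \<exists>s'. b \<in> U j' s'")
    case True
    then obtain j' s' where b': "j' \<le> K" "b \<in> U j' s'" by auto
    have j't: "j' \<noteq> t" using b' b(2) by auto
    have cr: "crossed U a b \<longleftrightarrow> j = 1 \<and> j' = 0"
    proof
      show "crossed U a b \<Longrightarrow> j = 1 \<and> j' = 0"
        using U_disj[OF a(1), of 0] U_disj[OF a(1), of 1] U_disj[OF b'(2), of 0] a K2 b'(1)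
        unfolding crossed_def by auto
      show "j = 1 \<and> j' = 0 \<Longrightarrow> crossed U a b" using a b' by (auto simp: crossed_def)
    qed
    show ?thesis
    proof (cases "b \<in> inner")
      case True
      then have j': "1 \<le> j'" "j' < K" using inner_iff[OF b'(2,1)] by auto
      have "q t b \<in> U j' (s' \<noteq> (j' < t))" using q_in[OF b'(2) j'] cd_in[of j'] j' by simp
      then have "H j (s \<noteq> (j < t)) (q t b) = of_bool ((s \<noteq> (j < t)) = (s' \<noteq> (j' < t)) \<and> adjacent j j')"
        using b' by (intro H_U) auto
      moreover have "adjacent j j' \<Longrightarrow> (j < t) = (j' < t)"
        using jt j't by (auto simp: adjacent_def)
      ultimately show ?thesis
        using 1 2 H_U[OF b'(2,1), of j s] cr j' by auto
    next
      case False
      then have j': "j' = 0 \<or> j' = K" using inner_iff[OF b'(2,1)] b' by auto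
      have "H j (s \<noteq> (j < t)) (q t b) = of_bool ((s \<noteq> (j < t)) = s' \<and> adjacent j j')"
        using b' False by (simp add: q_out H_U)
      then show ?thesis
        using 1 2 H_U[OF b'(2,1), of j s] cr j' a(2,3) jt t by (auto simp: adjacent_def)
    qed
  next
    case False
    then have "b \<notin> inner" by (auto simp: inner_def)
    moreover have "\<not> crossed U a b" using False K2 by (auto simp: crossed_def)
    ultimately show ?thesis
      using 1 2 H_out[of b j s] H_out[of b j "s \<noteq> (j < t)"] False by (simp add: q_out)
  qed
qed

lemma W2_eq:
  assumes t: "1 \<le> t" "t < K" and ab: "a \<in> {0..<1}" "b \<in> {0..<1}"
    and nt: "\<And>s. a \<notin> U t s" "\<And>s. b \<notin> U t s"
  shows "W2 (a, b) = W1 (q t a, q t b)"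
proof (cases "a \<in> inner")
  case True
  then obtain j s where a: "a \<in> U j s" "1 \<le> j" "j < K" by (rule innerE)
  then have "j \<noteq> t" using nt by auto
  with W1_q_left[OF t a _ ab(2) nt(2)] show ?thesis using ab by (simp add: W2_def cross_eq)
next
  case a: False
  show ?thesis
  proof (cases "b \<in> inner")
    case True
    then obtain j s where b: "b \<in> U j s" "1 \<le> j" "j < K" by (rule innerE)
    then have "j \<noteq> t" using nt by auto
    with W1_q_left[OF t b _ ab(1) nt(1)]
    have "W1 (q t b, q t a) = (if crossed U b a then 1 - W1 (b, a) else W1 (b, a))" by simp
    moreover have "crossed U b a = crossed U a b" by (rule crossed_sym)
    ultimately show ?thesis
      using ab graphon_sym[OF graphon_W1, of a b]
        graphon_sym[OF graphon_W1 q_space[OF ab(1)] q_space[OF ab(2)], of t t]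
      by (simp add: W2_def cross_eq)
  next
    case False
    have "\<not> crossed U a b"
      using a False K2 inner_iff[of a 1] inner_iff[of b 1] by (auto simp: crossed_def)
    then show ?thesis using a False ab by (simp add: W2_def cross_eq q_out)
  qed
qed

text \<open>On the event \<open>R t\<close> that \<open>t\<close> is the first interior position
  missed by the sample, the polynomial of \<open>W2\<close> at \<open>x\<close> is that of
  \<open>W1\<close> at the exchanged sample \<open>q t\<close>. The event is invariant under the
  exchange, and the exchanged sample has the same law as the merely collapsed one. Summing over
  \<open>t\<close> compares the densities.\<close>

lemma ind_density_W2:
  assumes m: "Suc m < K"
  shows "ind_density W2 m E = ind_density W1 m E"
proof -
  let ?C = "cube {..<m}"
  let ?F = "\<lambda>V x. \<Prod>e\<in>edges m. if e \<in> E then edge_val V x e else 1 - edge_val V x e"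
  let ?q = "\<lambda>t. compose {..<m} (q t)"
  define R where "R t x \<longleftrightarrow> (\<forall>i\<in>{..<m}. \<not> (\<exists>s. x i \<in> U t s)) \<and>
    (\<forall>t'\<in>{1..<t}. \<exists>i\<in>{..<m}. \<exists>s. x i \<in> U t' s)" for t x
  have Rm: "{x \<in> space ?C. R t x} \<in> sets ?C" for t
  proof -
    have "(\<lambda>x. x i) \<in> measurable ?C unif01" if "i \<in> {..<m}" for i
      using that by (intro measurable_component_singleton)
    then have "Measurable.pred ?C (\<lambda>x. x i \<in> U j s)" if "i \<in> {..<m}" for i j s
      using that by measurable
    then have "Measurable.pred ?C (R t)"
      unfolding R_def by (intro pred_intros_logic pred_intros_finite) auto
    then show ?thesis by (simp add: pred_def)
  qed
  have Fm: "?F W1 \<in> borel_measurable ?C" "?F W2 \<in> borel_measurable ?C"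
    using ind_integrable[OF graphon_W1] ind_integrable[OF graphon_W2] by blast+
  have qm: "?q t \<in> measurable ?C ?C" for t
    unfolding compose_def
    by (rule measurable_restrict, rule measurable_compose[OF _ q_measurable],
        rule measurable_component_singleton)
  have qsp: "?q t x \<in> space ?C" if "x \<in> space ?C" for t x
    using qm that by (rule measurable_space)
  have qd: "distr ?C ?C (?q t) = distr ?C ?C (?q t')" for t t'
  proof -
    have "distr ?C ?C (?q t) = PiM {..<m} (\<lambda>_. distr unif01 unif01 (q t))" for t
      by (rule distr_PiM_finite_prob_space') (auto simp: prob_space_unif01)
    then show ?thesis using distr_q[of t t'] by simp
  qed
  have Rq: "R t (?q t' x) \<longleftrightarrow> R t x" if "t < K" for t t' x
    unfolding R_def using that q_U[of _ t'] by (auto simp: compose_def)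
  have Fq0: "?F W1 (?q 0 x) = ?F W1 x" if x: "x \<in> space ?C" for x
  proof (rule prod.cong[OF refl])
    fix e assume "e \<in> edges m"
    then obtain i j where e: "e = {i, j}" "i < j" "j < m" by (rule edgesE)
    have "x i \<in> {0..<1}" "x j \<in> {0..<1}" using cube_coord[OF x] e by auto
    then have "edge_val W1 (?q 0 x) e = edge_val W1 x e"
      using e W1_q0 by (simp add: edge_val_def compose_def)
    then show "(if e \<in> E then edge_val W1 (?q 0 x) e else 1 - edge_val W1 (?q 0 x) e) =
      (if e \<in> E then edge_val W1 x e else 1 - edge_val W1 x e)" by simp
  qed
  have Fqt: "?F W1 (?q t x) = ?F W2 x" if x: "x \<in> space ?C" and t: "1 \<le> t" "t < K" and R: "R t x" for t x
  proof (rule prod.cong[OF refl])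
    fix e assume "e \<in> edges m"
    then obtain i j where e: "e = {i, j}" "i < j" "j < m" by (rule edgesE)
    have "x i \<in> {0..<1}" "x j \<in> {0..<1}" using cube_coord[OF x] e by auto
    moreover have "x i \<notin> U t s" "x j \<notin> U t s" for s using R e by (auto simp: R_def)
    ultimately have "edge_val W1 (?q t x) e = edge_val W2 x e"
      using e W2_eq[OF t] by (simp add: edge_val_def compose_def)
    then show "(if e \<in> E then edge_val W1 (?q t x) e else 1 - edge_val W1 (?q t x) e) =
      (if e \<in> E then edge_val W2 x e else 1 - edge_val W2 x e)" by simp
  qed
  \<comment> \<open>Each sample point lies in at most one atom, so at most \<open>m\<close> of the
    \<open>K - 1\<close> interior positions are hit, and there is exactly one first position that is
    not.\<close>
  have R1: "(\<Sum>t\<in>{1..<K}. of_bool (R t x)) = (1::real)" if x: "x \<in> space ?C" for x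
  proof -
    define hit where "hit = {t \<in> {1..<K}. \<exists>i\<in>{..<m}. \<exists>s. x i \<in> U t s}"
    have "hit \<subseteq> (\<lambda>i. THE t. t \<le> K \<and> (\<exists>s. x i \<in> U t s)) ` {..<m}"
    proof
      fix t assume "t \<in> hit"
      then obtain i s where t: "t < K" "i < m" "x i \<in> U t s" by (auto simp: hit_def)
      have "(THE t. t \<le> K \<and> (\<exists>s. x i \<in> U t s)) = t"
      proof (rule the_equality)
        show "t \<le> K \<and> (\<exists>s. x i \<in> U t s)" using t by auto
      next
        fix t' assume "t' \<le> K \<and> (\<exists>s. x i \<in> U t' s)"
        then obtain s' where "t' \<le> K" "x i \<in> U t' s'" by blast
        then show "t' = t" using U_disj[OF t(3), of t' s'] t(1) by simp
      qed
      then show "t \<in> (\<lambda>i. THE t. t \<le> K \<and> (\<exists>s. x i \<in> U t s)) ` {..<m}"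
        using t(2) by (metis (no_types, lifting) imageI lessThan_iff)
    qed
    then have "card hit \<le> card ((\<lambda>i. THE t. t \<le> K \<and> (\<exists>s. x i \<in> U t s)) ` {..<m})"
      by (intro card_mono finite_imageI finite_lessThan)
    also have "\<dots> \<le> m" using card_image_le[OF finite_lessThan[of m]] by simp
    finally have "card hit \<noteq> card {1..<K}" using m by simp
    then have "hit \<noteq> {1..<K}" by auto
    moreover have "hit \<subseteq> {1..<K}" unfolding hit_def by blast
    ultimately have ex: "\<exists>t. t \<in> {1..<K} \<and> t \<notin> hit" by blast
    define t where "t = (LEAST t. t \<in> {1..<K} \<and> t \<notin> hit)"
    have t: "t \<in> {1..<K}" "t \<notin> hit" unfolding t_def using LeastI_ex[OF ex] by auto
    have least: "t' \<in> hit" if "t' \<in> {1..<t}" for t'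
      using not_less_Least[of t' "\<lambda>t. t \<in> {1..<K} \<and> t \<notin> hit"] that t by (auto simp: t_def)
    have "R t' x \<longleftrightarrow> t' = t" if "t' \<in> {1..<K}" for t'
    proof
      assume R': "R t' x"
      show "t' = t"
      proof (rule linorder_cases[of t' t])
        assume "t' < t"
        then have "t' \<in> hit" using least that by auto
        then show ?thesis using R' by (auto simp: hit_def R_def)
      next
        assume "t < t'"
        then have "\<exists>i\<in>{..<m}. \<exists>s. x i \<in> U t s" using R' t by (auto simp: R_def)
        then show ?thesis using t by (auto simp: hit_def)
      qed
    next
      assume "t' = t"
      then show "R t' x" using t least unfolding R_def hit_def by auto
    qed
    then have "(\<Sum>t'\<in>{1..<K}. of_bool (R t' x)) = (\<Sum>t'\<in>{1..<K}. if t' = t then 1 else (0::real))"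
      by (intro sum.cong) auto
    then show ?thesis using t by (simp add: sum.delta)
  qed
  define f where "f t x = of_bool (R t x) * ?F W1 x" for t x
  have fm[measurable]: "f t \<in> borel_measurable ?C" for t
  proof -
    have "(\<lambda>x. of_bool (R t x) :: real) \<in> borel_measurable ?C"
      unfolding of_bool_def by (rule measurable_If[OF _ _ Rm]) auto
    then show ?thesis unfolding f_def using Fm by (intro borel_measurable_times)
  qed
  have Fb: "\<bar>?F W1 x\<bar> \<le> 1" if "x \<in> space ?C" for x
    by (rule prod_abs_le_one) (use edge_val_bounds[OF graphon_W1 _ that] in auto)
  have fb: "\<bar>f t x\<bar> \<le> 1" if "x \<in> space ?C" for t x
    using Fb[OF that] by (simp add: f_def)
  have fi: "integrable ?C (f t)" "integrable ?C (\<lambda>x. f t (?q t' x))" for t t'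
    using fb qsp qm by (auto intro!: cube.integrable_const_bound[of _ 1] AE_I2 measurable_compose[OF qm fm])
  have "ind_density W2 m E = (\<integral>x. (\<Sum>t\<in>{1..<K}. f t (?q t x)) \<partial>?C)"
    unfolding ind_density_def
  proof (intro Bochner_Integration.integral_cong refl)
    fix x assume x: "x \<in> space ?C"
    have "(\<Sum>t\<in>{1..<K}. f t (?q t x)) = (\<Sum>t\<in>{1..<K}. of_bool (R t x) * ?F W2 x)"
      unfolding f_def using Rq Fqt[OF x] by (intro sum.cong refl) auto
    also have "\<dots> = ?F W2 x"
      using R1[OF x] by (simp add: sum_distrib_right[symmetric])
    finally show "?F W2 x = (\<Sum>t\<in>{1..<K}. f t (?q t x))" by simp
  qed
  also have "\<dots> = (\<Sum>t\<in>{1..<K}. \<integral>x. f t (?q t x) \<partial>?C)"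
    by (rule Bochner_Integration.integral_sum) (rule fi)
  \<comment> \<open>Each term is an integral against the law of the exchanged sample, which does not
    depend on \<open>t\<close>.\<close>
  also have "\<dots> = (\<Sum>t\<in>{1..<K}. \<integral>x. f t (?q 0 x) \<partial>?C)"
  proof (rule sum.cong[OF refl])
    fix t
    have "(\<integral>x. f t (?q t x) \<partial>?C) = integral\<^sup>L (distr ?C ?C (?q t)) (f t)"
      by (rule integral_distr[symmetric, OF qm fm])
    also have "\<dots> = integral\<^sup>L (distr ?C ?C (?q 0)) (f t)" by (simp add: qd[of t 0])
    also have "\<dots> = (\<integral>x. f t (?q 0 x) \<partial>?C)" by (rule integral_distr[OF qm fm])
    finally show "(\<integral>x. f t (?q t x) \<partial>?C) = (\<integral>x. f t (?q 0 x) \<partial>?C)" .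
  qed
  also have "\<dots> = (\<integral>x. (\<Sum>t\<in>{1..<K}. f t (?q 0 x)) \<partial>?C)"
    by (rule Bochner_Integration.integral_sum[symmetric]) (rule fi)
  also have "\<dots> = ind_density W1 m E"
    unfolding ind_density_def
  proof (intro Bochner_Integration.integral_cong refl)
    fix x assume x: "x \<in> space ?C"
    have "(\<Sum>t\<in>{1..<K}. f t (?q 0 x)) = (\<Sum>t\<in>{1..<K}. of_bool (R t x) * ?F W1 x)"
      unfolding f_def using Rq Fq0[OF x] by (intro sum.cong refl) auto
    also have "\<dots> = ?F W1 x"
      using R1[OF x] by (simp add: sum_distrib_right[symmetric])
    finally show "(\<Sum>t\<in>{1..<K}. f t (?q 0 x)) = ?F W1 x" .
  qed
  finally show ?thesis .
qed

lemma crossing_density_equiv: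
  assumes "Suc n < K"
  shows "density_equiv n W (cross U W)"
  unfolding density_equiv_def
proof (intro allI impI)
  fix H :: graph assume H: "finite_graph H \<and> card (fst H) \<le> n"
  have "ind_density W (card (fst H)) E = ind_density (cross U W) (card (fst H)) E" for E
  proof -
    have "ind_density W (card (fst H)) E = ind_density W1 (card (fst H)) E"
      by (rule ind_density_cong_AE[OF W graphon_W1 W1_AE])
    also have "\<dots> = ind_density W2 (card (fst H)) E"
      by (rule ind_density_W2[symmetric]) (use H assms in linarith)
    also have "\<dots> = ind_density (cross U W) (card (fst H)) E"
      by (rule ind_density_cong_AE[OF graphon_cross[OF W U_sets] graphon_W2 W2_AE, symmetric])
    finally show ?thesis .
  qed
  then show "graph_density H W = graph_density H (cross U W)"
    using graph_density_eq_sum[OF W refl] graph_density_eq_sum[OF graphon_cross[OF W U_sets] refl] by simp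
qed

end

subsection \<open>Degree classes and labels\<close>

text \<open>Class 0 consists of the vertices proper; the classes 1 to 4 are markers.  A proper vertex
  \<open>t\<close> carries the labels \<open>lab W k t\<close>, the values of \<open>W\<close> between \<open>t\<close> and the \<open>k\<close>-th marker class:
  its level (1), its position on the strand (2), a mark at the ends of the strand (3), and a number (4)
  which makes the degree of \<open>t\<close> equal to the degree of class 0.\<close>

definition class_degree :: "nat \<Rightarrow> real" where
  "class_degree k = (if k = 0 then 1/2 else if k = 1 then 1/8 else if k = 2 then 1/4
    else if k = 3 then 3/8 else 7/16)"

text \<open>Class 4 is heavy because it has to supply the degree that a vertex lacks by means of a
  label of at most 1. The four masses leave 1/8 for class 0. The degrees are distinct and chosen
  such that the densities between the markers of the model stay in the unit interval.\<close>

definition class_mass :: "nat \<Rightarrow> real" where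
  "class_mass k = (if k = 4 then 1/2 else 1/8)"

definition other_classes :: "nat \<Rightarrow> nat list" where
  "other_classes k = filter (\<lambda>l. l \<noteq> k) [0, 1, 2, 3, 4]"

text \<open>The Lagrange basis polynomial at the five degrees: it turns membership in a class into a
  polynomial of the degree.\<close>

definition lagrange :: "nat \<Rightarrow> real \<Rightarrow> real" where
  "lagrange k d = (\<Prod>l\<leftarrow>other_classes k. 1 / (class_degree k - class_degree l) * (d - class_degree l))"

definition deg :: "(real \<times> real \<Rightarrow> real) \<Rightarrow> real \<Rightarrow> real" where
  "deg W t = (\<integral>s. W (t, s) \<partial>unif01)"

definition ind :: "(real \<times> real \<Rightarrow> real) \<Rightarrow> nat \<Rightarrow> real \<Rightarrow> real" where
  "ind W k t = lagrange k (deg W t)"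

definition lab :: "(real \<times> real \<Rightarrow> real) \<Rightarrow> nat \<Rightarrow> real \<Rightarrow> real" where
  "lab W k t = (\<integral>s. W (t, s) * (1 / class_mass k * ind W k s) \<partial>unif01)"

lemma lagrange_class_degree:
  assumes "k < 5" "l < 5"
  shows "lagrange k (class_degree l) = of_bool (k = l)"
proof -
  have "k = 0 \<or> k = 1 \<or> k = 2 \<or> k = 3 \<or> k = 4" "l = 0 \<or> l = 1 \<or> l = 2 \<or> l = 3 \<or> l = 4"
    using assms by auto
  then show ?thesis
    by (elim disjE) (simp_all add: lagrange_def other_classes_def class_degree_def)
qed

definition Minus :: "expr \<Rightarrow> expr \<Rightarrow> expr" (infixl "\<ominus>" 65) where
  "a \<ominus> b = a \<oplus> Const (-1) \<odot> b"

definition Sq :: "expr \<Rightarrow> expr" where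
  "Sq a = a \<odot> a"

primrec Prods :: "expr list \<Rightarrow> expr" where
  "Prods [] = Const 1"
| "Prods (a # as) = a \<odot> Prods as"

text \<open>Bound variables are numbered upwards from \<open>i\<close>, so they never capture it.
  The resulting expressions have no free edges, hence degrees, indicators and labels may be
  multiplied and squared at will.\<close>

definition Deg :: "nat \<Rightarrow> expr" where
  "Deg i = Integ (Suc i) (Edge i (Suc i))"

definition Ind :: "nat \<Rightarrow> nat \<Rightarrow> expr" where
  "Ind k i = Prods (map (\<lambda>l. Const (1 / (class_degree k - class_degree l)) \<odot> (Deg i \<ominus> Const (class_degree l)))
    (other_classes k))"

definition Lab :: "nat \<Rightarrow> nat \<Rightarrow> expr" where
  "Lab k i = Integ (Suc i) (Edge i (Suc i) \<odot> (Const (1 / class_mass k) \<odot> Ind k (Suc i)))"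

lemma Minus_simps [simp]:
  "eval W (a \<ominus> b) x = eval W a x - eval W b x"
  "fv (a \<ominus> b) = fv a \<union> fv b"
  "free_edges (a \<ominus> b) = free_edges a \<union> free_edges b"
  "simple (a \<ominus> b) \<longleftrightarrow> simple a \<and> simple b"
  by (auto simp: Minus_def)

lemma Sq_simps [simp]:
  "eval W (Sq a) x = (eval W a x)\<^sup>2"
  "fv (Sq a) = fv a"
  "free_edges (Sq a) = free_edges a"
  "simple (Sq a) \<longleftrightarrow> simple a \<and> free_edges a = {}"
  by (auto simp: Sq_def power2_eq_square)

lemma Prods_simps:
  "eval W (Prods as) x = (\<Prod>a\<leftarrow>as. eval W a x)"
  "fv (Prods as) = (\<Union>a\<in>set as. fv a)"
  "free_edges (Prods as) = (\<Union>a\<in>set as. free_edges a)"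
  "(\<And>a. a \<in> set as \<Longrightarrow> simple a \<and> free_edges a = {}) \<Longrightarrow> simple (Prods as)"
  by (induction as) auto

lemma Deg_simps [simp]:
  "eval W (Deg i) x = deg W (x i)" "fv (Deg i) = {i}" "free_edges (Deg i) = {}" "simple (Deg i)"
  by (auto simp: Deg_def deg_def)

lemma Ind_simps [simp]:
  "eval W (Ind k i) x = ind W k (x i)" "fv (Ind k i) = {i}" "free_edges (Ind k i) = {}" "simple (Ind k i)"
proof -
  show "eval W (Ind k i) x = ind W k (x i)"
    by (simp add: Ind_def Prods_simps ind_def lagrange_def comp_def)
  have "other_classes k \<noteq> []" by (simp add: other_classes_def)
  then show "fv (Ind k i) = {i}" by (auto simp: Ind_def Prods_simps)
  show "free_edges (Ind k i) = {}" by (auto simp: Ind_def Prods_simps)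
  show "simple (Ind k i)" unfolding Ind_def by (rule Prods_simps(4)) auto
qed

lemma Lab_simps [simp]:
  "eval W (Lab k i) x = lab W k (x i)" "fv (Lab k i) = {i}" "free_edges (Lab k i) = {}" "simple (Lab k i)"
  by (auto simp: Lab_def lab_def)

lemma deg_measurable [measurable]:
  assumes "graphon W" shows "deg W \<in> borel_measurable unif01"
proof -
  note [measurable] = graphon_measurable[OF assms]
  show ?thesis unfolding deg_def by measurable
qed

lemma ind_measurable [measurable]:
  assumes "graphon W" shows "ind W k \<in> borel_measurable unif01"
proof -
  note [measurable] = deg_measurable[OF assms]
  have "(\<lambda>t. \<Prod>l\<leftarrow>ls. 1 / (class_degree k - class_degree l) * (deg W t - class_degree l)) \<in> borel_measurable unif01" for ls
    by (induction ls) auto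
  then show ?thesis by (simp add: ind_def lagrange_def cong: measurable_cong)
qed

lemma lab_measurable [measurable]:
  assumes "graphon W" shows "lab W k \<in> borel_measurable unif01"
proof -
  note [measurable] = graphon_measurable[OF assms] ind_measurable[OF assms]
  show ?thesis unfolding lab_def by measurable
qed

subsection \<open>The defining identities\<close>

abbreviation "KK \<equiv> Lab 1"
abbreviation "RR \<equiv> Lab 2"
abbreviation "BB \<equiv> Lab 3"
abbreviation "QQ \<equiv> Lab 4"
text \<open>Squaring makes the weight of an integrand nonnegative at every point, also where the
  degree is none of the five prescribed ones.\<close>

abbreviation "VV i \<equiv> Sq (Ind 0 i)"

definition Phi :: "nat \<Rightarrow> nat \<Rightarrow> expr" where
  "Phi i j = (Const 2 \<odot> KK i \<ominus> KK j) \<odot> (Const 2 \<odot> KK j \<ominus> KK i)"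

definition Chi :: "nat \<Rightarrow> nat \<Rightarrow> expr" where
  "Chi i j = Phi i j \<odot> (Sq (KK i) \<ominus> Sq (RR i \<ominus> RR j))"

definition Fstep :: "nat \<Rightarrow> nat \<Rightarrow> expr" where
  "Fstep i j = Phi i j \<odot> ((RR j \<ominus> RR i) \<odot> (RR j \<ominus> RR i \<oplus> KK i))"

definition phi :: "real \<Rightarrow> real \<Rightarrow> real" where
  "phi k k' = (2 * k - k') * (2 * k' - k)"

definition chi :: "(real \<times> real \<Rightarrow> real) \<Rightarrow> real \<Rightarrow> real \<Rightarrow> real" where
  "chi W s t = phi (lab W 1 s) (lab W 1 t) * ((lab W 1 s)\<^sup>2 - (lab W 2 s - lab W 2 t)\<^sup>2)"

definition fstep :: "(real \<times> real \<Rightarrow> real) \<Rightarrow> real \<Rightarrow> real \<Rightarrow> real" where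
  "fstep W s t = phi (lab W 1 s) (lab W 1 t) *
    ((lab W 2 t - lab W 2 s) * (lab W 2 t - lab W 2 s + lab W 1 s))"

definition bstep :: "(real \<times> real \<Rightarrow> real) \<Rightarrow> real \<Rightarrow> real \<Rightarrow> real" where
  "bstep W s t = phi (lab W 1 s) (lab W 1 t) *
    ((lab W 2 s - lab W 2 t) * (lab W 2 s - lab W 2 t + lab W 1 s))"

definition Bstep :: "nat \<Rightarrow> nat \<Rightarrow> expr" where
  "Bstep i j = Phi i j \<odot> ((RR i \<ominus> RR j) \<odot> (RR i \<ominus> RR j \<oplus> KK i))"

lemma Phi_simps [simp]:
  "eval W (Phi i j) x = phi (lab W 1 (x i)) (lab W 1 (x j))" "fv (Phi i j) = {i, j}"
  "free_edges (Phi i j) = {}" "simple (Phi i j)"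
  by (auto simp: Phi_def phi_def)

lemma Chi_simps [simp]:
  "eval W (Chi i j) x = chi W (x i) (x j)" "fv (Chi i j) = {i, j}"
  "free_edges (Chi i j) = {}" "simple (Chi i j)"
  by (auto simp: Chi_def chi_def)

lemma Fstep_simps [simp]:
  "eval W (Fstep i j) x = fstep W (x i) (x j)" "fv (Fstep i j) = {i, j}"
  "free_edges (Fstep i j) = {}" "simple (Fstep i j)"
  by (auto simp: Fstep_def fstep_def)

lemma Bstep_simps [simp]:
  "eval W (Bstep i j) x = bstep W (x i) (x j)" "fv (Bstep i j) = {i, j}"
  "free_edges (Bstep i j) = {}" "simple (Bstep i j)"
  by (auto simp: Bstep_def bstep_def)

text \<open>On labels in \<open>{0, 1}\<close> this is a polynomial form of the test whether the
  label equals \<open>of_bool \<alpha>\<close>.\<close>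

definition Select :: "bool \<Rightarrow> expr \<Rightarrow> expr" where
  "Select \<alpha> a = (if \<alpha> then a else Const 1 \<ominus> a)"

definition select :: "bool \<Rightarrow> real \<Rightarrow> real" where
  "select \<alpha> r = (if \<alpha> then r else 1 - r)"

lemma Select_simps [simp]:
  "eval W (Select \<alpha> a) x = select \<alpha> (eval W a x)" "fv (Select \<alpha> a) = fv a"
  "free_edges (Select \<alpha> a) = free_edges a" "simple (Select \<alpha> a) \<longleftrightarrow> simple a"
  by (auto simp: Select_def select_def)

text \<open>Adjacent vertices have equal levels or levels that differ by a factor of 2, where \<open>phi\<close> vanishes.
  So, among the neighbours of a vertex of level \<open>k\<close>, \<open>chi\<close>, \<open>fstep\<close> and \<open>bstep\<close> vanish
  outside its own atom, the next and the previous one, and are there \<open>k\<^sup>4\<close>, \<open>2 k\<^sup>4\<close> and \<open>2 k\<^sup>4\<close>.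
  The constants 1/16 and 1/8 below express that these atoms have the mass \<open>k\<^sup>2 / (16 (1 + k))\<close>; 3/256 is the
  product of 1/64, from the mass of an atom at level \<open>k / 2\<close>, and of \<open>(k - k/2) (2 k - k/2) = 3/4 k\<^sup>2\<close>.\<close>

definition ex_degree :: expr where
  "ex_degree = Integ 0 (Sq (Prods (map (\<lambda>l. Deg 0 \<ominus> Const (class_degree l)) [0, 1, 2, 3, 4])))"

definition ex_mass :: "nat \<Rightarrow> expr" where
  "ex_mass k = Integ 0 (Ind k 0) \<ominus> Const (class_mass k)"

text \<open>The deviation of \<open>W\<close> from its average over a marker class. It contains a
  free edge and cannot be squared, hence the four-cycle in \<open>ex_twin\<close>.\<close>

definition Twin :: "nat \<Rightarrow> nat \<Rightarrow> nat \<Rightarrow> expr" where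
  "Twin k i j = Ind 0 i \<odot> Ind k j \<odot> (Edge i j \<ominus> Lab k i)"

definition ex_twin :: "nat \<Rightarrow> expr" where
  "ex_twin k = Integ 0 (Integ 1 (Integ 2 (Integ 3 (Twin k 0 2 \<odot> Twin k 0 3 \<odot> Twin k 1 2 \<odot> Twin k 1 3))))"

text \<open>The third square is the degree equation of an interior vertex, which sees three atoms of
  class 0. It reads \<open>q / 2 + (k + r + b) / 8 + 3 * m = 1/2\<close> with
  \<open>m = k^2 / (16 * (1 + k))\<close>, hence the constant 3/8. It determines the fourth label,
  so that interior atoms of equal level and position have the same four labels.\<close>

definition ex_label :: expr where
  "ex_label = Integ 0 (VV 0 \<odot> (Sq (BB 0 \<odot> ((BB 0 \<ominus> Const (1/2)) \<odot> (BB 0 \<ominus> Const 1))) \<oplus>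
    (Sq ((BB 0 \<ominus> Const (1/2)) \<odot> (RR 0 \<odot> (RR 0 \<ominus> Const 1))) \<oplus>
     Sq (BB 0 \<odot> ((BB 0 \<ominus> Const 1) \<odot>
       ((Const 1 \<oplus> KK 0) \<odot> (QQ 0 \<ominus> Const 1 \<oplus> Const (1/4) \<odot> (KK 0 \<oplus> RR 0 \<oplus> BB 0))
         \<oplus> Const (3/8) \<odot> Sq (KK 0)))))))"

text \<open>The sum of squares imposes all conditions of \<open>edge_rule\<close> at once, while the
  edge itself occurs only to the first power.\<close>

definition ex_edge :: expr where
  "ex_edge = Integ 0 (Integ 1 (VV 0 \<odot> (VV 1 \<odot> (Edge 0 1 \<odot>
    (Sq ((KK 0 \<ominus> KK 1) \<odot> ((KK 0 \<ominus> Const 2 \<odot> KK 1) \<odot> (KK 1 \<ominus> Const 2 \<odot> KK 0))) \<oplus>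
    (Sq ((KK 0 \<ominus> KK 1) \<odot> (BB 0 \<odot> (BB 0 \<ominus> Const 1))) \<oplus>
    (Sq ((KK 0 \<ominus> KK 1) \<odot> (BB 1 \<odot> (BB 1 \<ominus> Const 1))) \<oplus>
    (Sq (Chi 0 1 \<odot> (RR 0 \<ominus> RR 1)) \<oplus>
     Sq (Chi 0 1 \<odot> (BB 0 \<ominus> BB 1))))))))))"

text \<open>The condition of \<open>ex_congr\<close> with the variables in another order: the vertex
  outside the atom comes first, and so does its almost-everywhere quantifier.\<close>

definition ex_closed :: expr where
  "ex_closed = Integ 0 (Integ 1 (Integ 2 (VV 0 \<odot> (VV 1 \<odot> (VV 2 \<odot>
    (Edge 0 1 \<odot> (Edge 1 2 \<odot> (Sq (Chi 1 2) \<odot> (Const 1 \<ominus> Edge 0 2)))))))))"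

text \<open>Among the neighbours of a vertex, \<open>Chi\<close> is nonzero on its own atom. The
  factor \<open>Const 1 \<ominus> Edge 1 2\<close> demands the value 1 and not just a positive one;
  together with \<open>ex_congr'\<close> this forces the values 0 and 1 inside class 0.\<close>

definition ex_congr :: expr where
  "ex_congr = Integ 0 (Integ 1 (Integ 2 (VV 0 \<odot> (VV 1 \<odot> (VV 2 \<odot>
    (Edge 0 1 \<odot> (Sq (Chi 0 1) \<odot> (Edge 0 2 \<odot> (Const 1 \<ominus> Edge 1 2)))))))))"

definition ex_congr' :: expr where
  "ex_congr' = Integ 0 (Integ 1 (Integ 2 (VV 0 \<odot> (VV 1 \<odot> (VV 2 \<odot>
    (Edge 0 1 \<odot> (Sq (Chi 0 1) \<odot> (Edge 1 2 \<odot> (Const 1 \<ominus> Edge 0 2)))))))))"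

text \<open>For admissible labels the first factor vanishes only at mark 0 or 1 and position 1, that
  is, at the last atom of a strand, which has no successor. In \<open>ex_back\<close> it is the
  first atom that is exempted.\<close>

definition ex_step :: expr where
  "ex_step = Integ 0 (VV 0 \<odot> Sq ((BB 0 \<odot> (Const 1 \<ominus> BB 0) \<oplus> (Const 1 \<ominus> RR 0)) \<odot>
    ((Const 1 \<oplus> KK 0) \<odot> Integ 1 (VV 1 \<odot> (Edge 0 1 \<odot> Fstep 0 1))
      \<ominus> Const (1/8) \<odot> (Sq (KK 0) \<odot> Sq (Sq (KK 0))))))"

definition ex_back :: expr where
  "ex_back = Integ 0 (VV 0 \<odot> Sq ((BB 0 \<odot> (Const 1 \<ominus> BB 0) \<oplus> RR 0) \<odot>
    ((Const 1 \<oplus> KK 0) \<odot> Integ 1 (VV 1 \<odot> (Edge 0 1 \<odot> Bstep 0 1))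
      \<ominus> Const (1/8) \<odot> (Sq (KK 0) \<odot> Sq (Sq (KK 0))))))"

definition ex_atom :: expr where
  "ex_atom = Integ 0 (VV 0 \<odot> Sq (
    (Const 1 \<oplus> KK 0) \<odot> Integ 1 (VV 1 \<odot> (Edge 0 1 \<odot> Chi 0 1))
      \<ominus> Const (1/16) \<odot> (Sq (KK 0) \<odot> Sq (Sq (KK 0)))))"

text \<open>The two linear factors vanish at the own level and at the doubled level, so only
  neighbours of half the level count. \<open>Select\<close> then asks for each end and each mark
  separately, and the factor \<open>BB 0 \<ominus> Const (1/2)\<close> restricts the demand to the
  ends of strands.\<close>

definition ex_next :: "bool \<Rightarrow> bool \<Rightarrow> expr" where
  "ex_next \<alpha> \<beta> = Integ 0 (VV 0 \<odot> Sq ((BB 0 \<ominus> Const (1/2)) \<odot>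
    ((Const 1 \<oplus> Const (1/2) \<odot> KK 0) \<odot> Integ 1 (VV 1 \<odot> (Edge 0 1 \<odot>
      (((KK 0 \<ominus> KK 1) \<odot> (Const 2 \<odot> KK 0 \<ominus> KK 1)) \<odot> (Select \<alpha> (RR 1) \<odot> Select \<beta> (BB 1)))))
      \<ominus> Const (3/256) \<odot> Sq (Sq (KK 0)))))"

text \<open>Its positivity is not an identity, but its value is determined by densities just as
  well. It provides the first vertex of positive level.\<close>

definition ex_pos :: expr where
  "ex_pos = Integ 0 (VV 0 \<odot> KK 0)"

definition zero_exprs :: "expr list" where
  "zero_exprs = [ex_degree, ex_mass 1, ex_mass 2, ex_mass 3, ex_mass 4, ex_twin 1, ex_twin 2, ex_twin 3,
    ex_twin 4, ex_label, ex_edge, ex_closed, ex_congr, ex_congr', ex_step, ex_back, ex_atom,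
    ex_next False False, ex_next False True, ex_next True False, ex_next True True]"

lemmas ex_defs = ex_degree_def ex_mass_def ex_twin_def Twin_def ex_label_def ex_edge_def ex_closed_def
  ex_congr_def ex_congr'_def ex_step_def ex_back_def ex_atom_def ex_next_def ex_pos_def

lemma zero_exprs_simple: "a \<in> set (ex_pos # zero_exprs) \<Longrightarrow> simple a \<and> fv a = {}"
  unfolding zero_exprs_def
  by (auto simp: ex_defs Prods_simps doubleton_eq_iff)

definition structured :: "(real \<times> real \<Rightarrow> real) \<Rightarrow> bool" where
  "structured W \<longleftrightarrow> graphon W \<and> (\<forall>a\<in>set zero_exprs. eval W a (\<lambda>_. 0) = 0) \<and>
    0 < eval W ex_pos (\<lambda>_. 0)"

text \<open>Every closed simple expression has its own bound on the size of the graphs; finitely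
  many expressions have a common one.\<close>

lemma structured_determined:
  obtains N where "\<And>W W'. structured W \<Longrightarrow> graphon W' \<Longrightarrow> density_equiv N W W' \<Longrightarrow> structured W'"
proof -
  have "\<exists>N. \<forall>W W'. graphon W \<longrightarrow> graphon W' \<longrightarrow> density_equiv N W W' \<longrightarrow>
    (\<forall>a\<in>set as. eval W a (\<lambda>_. 0) = eval W' a (\<lambda>_. 0))"
    if "\<And>a. a \<in> set as \<Longrightarrow> simple a \<and> fv a = {}" for as
    using that
  proof (induction as)
    case (Cons a as)
    have "\<exists>N. \<forall>W W'. graphon W \<longrightarrow> graphon W' \<longrightarrow> density_equiv N W W' \<longrightarrow>
      (\<forall>a\<in>set as. eval W a (\<lambda>_. 0) = eval W' a (\<lambda>_. 0))"
      by (rule Cons.IH) (simp add: Cons.prems)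
    then obtain N where N: "\<And>W W'. graphon W \<Longrightarrow> graphon W' \<Longrightarrow> density_equiv N W W' \<Longrightarrow>
      (\<forall>a\<in>set as. eval W a (\<lambda>_. 0) = eval W' a (\<lambda>_. 0))" by blast
    obtain M where M: "\<And>W W' x. graphon W \<Longrightarrow> graphon W' \<Longrightarrow> density_equiv M W W' \<Longrightarrow>
      eval W a x = eval W' a x"
      using eval_determined[of a] Cons.prems[of a] by auto
    show ?case
    proof (intro exI[of _ "max N M"] allI impI)
      fix W W' assume "graphon W" "graphon W'" "density_equiv (max N M) W W'"
      moreover from this have "density_equiv N W W'" "density_equiv M W W'"
        by (auto simp: density_equiv_def)
      ultimately show "\<forall>b\<in>set (a # as). eval W b (\<lambda>_. 0) = eval W' b (\<lambda>_. 0)"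
        using N[of W W'] M[of W W'] by simp
    qed
  qed simp
  from this[of "ex_pos # zero_exprs"] zero_exprs_simple obtain N where
    N: "\<And>W W'. graphon W \<Longrightarrow> graphon W' \<Longrightarrow> density_equiv N W W' \<Longrightarrow>
      (\<forall>a\<in>set (ex_pos # zero_exprs). eval W a (\<lambda>_. 0) = eval W' a (\<lambda>_. 0))" by blast
  show thesis
  proof (rule that[of N])
    fix W W' assume W: "structured W" "graphon W'" "density_equiv N W W'"
    then have "\<forall>a\<in>set (ex_pos # zero_exprs). eval W a (\<lambda>_. 0) = eval W' a (\<lambda>_. 0)"
      using N[of W W'] by (simp add: structured_def)
    with W show "structured W'" by (simp add: structured_def)
  qed
qed

lemma eval_Integ_nonneg:
  assumes "\<And>t. t \<in> {0..<1} \<Longrightarrow> 0 \<le> eval W a (x(k := t))"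
  shows "0 \<le> eval W (Integ k a) x"
  unfolding eval.simps by (rule Bochner_Integration.integral_nonneg) (use assms in simp)

lemma eval_Integ2_eq_0_AE:
  assumes W: "graphon W" and "fv a \<subseteq> {0, 1}" "eval W (Integ 0 (Integ 1 a)) x = 0"
    and nn: "\<And>s t. s \<in> {0..<1} \<Longrightarrow> t \<in> {0..<1} \<Longrightarrow> 0 \<le> eval W a (x(0 := s, 1 := t))"
  shows "AE s in unif01. AE t in unif01. eval W a (x(0 := s, 1 := t)) = 0"
proof -
  have "AE s in unif01. eval W (Integ 1 a) (x(0 := s)) = 0"
    by (rule eval_Integ_eq_0_AE[OF W _ assms(3)]) (use assms(2) nn in \<open>auto intro!: eval_Integ_nonneg simp del: eval.simps\<close>)
  then show ?thesis
  proof (rule AE_mpI)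
    fix s assume s: "s \<in> space unif01" and z: "eval W (Integ 1 a) (x(0 := s)) = 0"
    show "AE t in unif01. eval W a (x(0 := s, 1 := t)) = 0"
      by (rule eval_Integ_eq_0_AE[OF W _ z]) (use assms(2) nn s in auto)
  qed
qed

lemma eval_Integ3_eq_0_AE:
  assumes W: "graphon W" and "fv a \<subseteq> {0, 1, 2}" "eval W (Integ 0 (Integ 1 (Integ 2 a))) x = 0"
    and nn: "\<And>s t u. s \<in> {0..<1} \<Longrightarrow> t \<in> {0..<1} \<Longrightarrow> u \<in> {0..<1} \<Longrightarrow> 0 \<le> eval W a (x(0 := s, 1 := t, 2 := u))"
  shows "AE s in unif01. AE t in unif01. AE u in unif01. eval W a (x(0 := s, 1 := t, 2 := u)) = 0"
proof -
  have "AE s in unif01. AE t in unif01. eval W (Integ 2 a) (x(0 := s, 1 := t)) = 0"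
    by (rule eval_Integ2_eq_0_AE[OF W _ assms(3)]) (use assms(2) nn in \<open>auto intro!: eval_Integ_nonneg simp del: eval.simps\<close>)
  then show ?thesis
  proof (rule AE_mpI)
    fix s assume s: "s \<in> space unif01" and "AE t in unif01. eval W (Integ 2 a) (x(0 := s, 1 := t)) = 0"
    from this(2) show "AE t in unif01. AE u in unif01. eval W a (x(0 := s, 1 := t, 2 := u)) = 0"
    proof (rule AE_mpI)
      fix t assume t: "t \<in> space unif01" and z: "eval W (Integ 2 a) (x(0 := s, 1 := t)) = 0"
      show "AE u in unif01. eval W a (x(0 := s, 1 := t, 2 := u)) = 0"
        by (rule eval_Integ_eq_0_AE[OF W _ z]) (use assms(2) nn s t in auto)
    qed
  qed
qed

subsection \<open>The structure forced by the identities\<close>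

text \<open>Two strands of \<open>1 / k + 1\<close> atoms each then weigh \<open>k / 8\<close>
  together, and the levels 1/2, 1/4, ... of the model fill exactly the mass 1/8 of class 0.\<close>

definition atom_mass :: "real \<Rightarrow> real" where
  "atom_mass k = k\<^sup>2 / (16 * (1 + k))"

lemma atom_mass_pos: "0 < k \<Longrightarrow> 0 < atom_mass k"
  by (simp add: atom_mass_def)

lemma measure_pos_ex:
  assumes "0 < measure unif01 A" "A \<in> sets unif01" "AE x in unif01. P x"
  obtains x where "x \<in> A" "P x"
proof -
  have "\<exists>x\<in>A. P x"
  proof (rule ccontr)
    assume "\<not> (\<exists>x\<in>A. P x)"
    with assms(3) have "AE x in unif01. x \<notin> A" by (auto elim: AE_mp)
    then have "measure unif01 A = 0"
      using assms(2) by (simp add: AE_iff_measurable[OF _ refl] unif01.prob_eq_0)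
    with assms(1) show False by simp
  qed
  with that show thesis by blast
qed

lemma AE_iff_of_measure_eq:
  assumes A: "A \<in> sets unif01" "B \<in> sets unif01" and "AE x in unif01. x \<in> A \<longrightarrow> x \<in> B"
    and eq: "measure unif01 A = measure unif01 B"
  shows "AE x in unif01. x \<in> A \<longleftrightarrow> x \<in> B"
proof -
  have "measure unif01 (A \<inter> B) = measure unif01 A"
    by (rule unif01.finite_measure_eq_AE) (use assms in \<open>auto elim!: AE_mp\<close>)
  then have "measure unif01 (B - A) = 0"
    using unif01.finite_measure_Diff'[OF A(2) A(1)] eq by (simp add: Int_commute)
  then have "AE x in unif01. x \<notin> B - A"
    using A by (subst unif01.prob_eq_0[symmetric]) auto
  with assms(3) show ?thesis by eventually_elim auto
qed

locale structured_graphon =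
  fixes W :: "real \<times> real \<Rightarrow> real"
  assumes structured: "structured W"
begin

definition vtx :: "real \<Rightarrow> bool" where "vtx t \<longleftrightarrow> deg W t = 1/2"

abbreviation "lev \<equiv> lab W 1"
abbreviation "pos \<equiv> lab W 2"
abbreviation "mrk \<equiv> lab W 3"

lemma W: "graphon W" using structured by (simp add: structured_def)

lemmas [measurable] = graphon_measurable[OF W] deg_measurable[OF W] ind_measurable[OF W] lab_measurable[OF W]

lemma eval_0: "a \<in> set zero_exprs \<Longrightarrow> eval W a (\<lambda>_. 0) = 0"
  using structured by (simp add: structured_def)

lemma W_range: "s \<in> {0..<1} \<Longrightarrow> t \<in> {0..<1} \<Longrightarrow> 0 \<le> W (s, t)" "s \<in> {0..<1} \<Longrightarrow> t \<in> {0..<1} \<Longrightarrow> W (s, t) \<le> 1"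
  using graphon_bounds[OF W] by auto

lemma W_section [measurable]: "x \<in> {0..<1} \<Longrightarrow> (\<lambda>y. W (x, y)) \<in> borel_measurable unif01"
  by (rule measurable_compose[OF measurable_Pair1' graphon_measurable[OF W]]) simp

lemma class_AE: "AE t in unif01. \<exists>l<5. deg W t = class_degree l"
proof -
  have "ex_degree \<in> set zero_exprs" by (simp add: zero_exprs_def)
  from eval_0[OF this] have "AE t in unif01. eval W (Sq (Prods (map (\<lambda>l. Deg 0 \<ominus> Const (class_degree l)) [0, 1, 2, 3, 4])))
      ((\<lambda>_. 0)(0 := t)) = 0"
    unfolding ex_degree_def by (rule eval_Integ_eq_0_AE[OF W, rotated]) (auto simp: Prods_simps)
  then show ?thesis
  proof (rule AE_mpI)
    fix t assume "eval W (Sq (Prods (map (\<lambda>l. Deg 0 \<ominus> Const (class_degree l)) [0, 1, 2, 3, 4])))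
      ((\<lambda>_. 0)(0 := t)) = 0"
    then have "deg W t = class_degree 0 \<or> deg W t = class_degree 1 \<or> deg W t = class_degree 2 \<or>
      deg W t = class_degree 3 \<or> deg W t = class_degree 4"
      by (simp add: Prods_simps)
    then show "\<exists>l<5. deg W t = class_degree l"
      by (elim disjE) (rule exI, rule conjI[rotated], assumption, simp)+
  qed
qed

lemma ind_class: "deg W t = class_degree l \<Longrightarrow> l < 5 \<Longrightarrow> k < 5 \<Longrightarrow> ind W k t = of_bool (k = l)"
  by (simp add: ind_def lagrange_class_degree)

lemma ind_vtx: "vtx t \<Longrightarrow> ind W 0 t = 1"
  using ind_class[of t 0 0] by (simp add: class_degree_def vtx_def)

lemma vtx_iff_class: "l < 5 \<Longrightarrow> class_degree l = 1/2 \<longleftrightarrow> l = 0"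
  by (auto simp: class_degree_def)

lemma ind_AE: "AE t in unif01. ind W 0 t = of_bool (vtx t)"
  using class_AE
proof (rule AE_mpI)
  fix t assume "\<exists>l<5. deg W t = class_degree l"
  then obtain l where l: "l < 5" "deg W t = class_degree l" by blast
  then show "ind W 0 t = of_bool (vtx t)"
    using ind_class[OF l(2,1), of 0] vtx_iff_class[OF l(1)] by (auto simp: vtx_def)
qed

text \<open>The four-cycle criterion, applied to the deviation of \<open>W\<close> from the
  label.\<close>

lemma twin_AE:
  assumes k: "k \<in> {1, 2, 3, 4}"
  shows "AE x in unif01. vtx x \<longrightarrow> (AE q in unif01. deg W q = class_degree k \<longrightarrow> W (x, q) = lab W k x)"
proof -
  let ?D = "\<lambda>x q. ind W 0 x * ind W k q * (W (x, q) - lab W k x)"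
  have k5: "k < 5" using k by auto
  have "ex_twin k \<in> set zero_exprs" using k by (auto simp: zero_exprs_def)
  from eval_0[OF this] have z: "(\<integral>x. \<integral>x'. \<integral>q. \<integral>q'. ?D x q * ?D x q' * ?D x' q * ?D x' q'
      \<partial>unif01 \<partial>unif01 \<partial>unif01 \<partial>unif01) = 0"
    by (simp add: ex_twin_def Twin_def)
  obtain B where B: "\<And>x. (\<And>i. i \<in> fv (Twin k 0 1) \<Longrightarrow> x i \<in> {0..<1}) \<Longrightarrow> \<bar>eval W (Twin k 0 1) x\<bar> \<le> B"
    using eval_bounded[OF W] by metis
  have "AE x in unif01. AE q in unif01. ?D x q = 0"
  proof (rule kernel_eq_0_if_four_cycle_0[OF _ _ z])
    show "(\<lambda>(x, q). ?D x q) \<in> borel_measurable (unif01 \<Otimes>\<^sub>M unif01)" by measurable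
    fix x y :: real assume "x \<in> {0..<1}" "y \<in> {0..<1}"
    then show "\<bar>?D x y\<bar> \<le> B"
      using B[of "\<lambda>i. if i = 0 then x else y"] by (simp add: Twin_def)
  qed
  then show ?thesis
  proof (rule AE_mpI, intro impI)
    fix x assume "AE q in unif01. ?D x q = 0" and x: "vtx x"
    from this(1) show "AE q in unif01. deg W q = class_degree k \<longrightarrow> W (x, q) = lab W k x"
    proof (rule AE_mpI, intro impI)
      fix q assume "?D x q = 0" "deg W q = class_degree k"
      then show "W (x, q) = lab W k x"
        using ind_vtx[OF x] ind_class[of q k k] k5 by simp
    qed
  qed
qed

lemma class_nonnull:
  assumes k: "k \<in> {1, 2, 3, 4}"
  shows "\<not> (AE q in unif01. deg W q \<noteq> class_degree k)"
proof
  assume "AE q in unif01. deg W q \<noteq> class_degree k"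
  with class_AE have "AE q in unif01. ind W k q = 0"
  proof eventually_elim
    case (elim q)
    then obtain l where "l < 5" "deg W q = class_degree l" by auto
    with elim k show ?case using ind_class[of q l k] by auto
  qed
  then have "(\<integral>q. ind W k q \<partial>unif01) = (\<integral>q. 0 \<partial>unif01)"
    by (intro integral_cong_AE) auto
  moreover have "ex_mass k \<in> set zero_exprs" using k by (auto simp: zero_exprs_def)
  from eval_0[OF this] have "(\<integral>q. ind W k q \<partial>unif01) = class_mass k"
    by (simp add: ex_mass_def)
  ultimately show False by (auto simp: class_mass_def split: if_splits)
qed

text \<open>The marker class is not null, so the label is an actual value of
  \<open>W\<close>.\<close>

lemma label_range_AE:
  assumes k: "k \<in> {1, 2, 3, 4}"
  shows "AE x in unif01. vtx x \<longrightarrow> 0 \<le> lab W k x \<and> lab W k x \<le> 1"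
  using twin_AE[OF k]
proof (rule AE_mpI, intro impI)
  fix x assume x: "x \<in> space unif01" "vtx x"
    and "vtx x \<longrightarrow> (AE q in unif01. deg W q = class_degree k \<longrightarrow> W (x, q) = lab W k x)"
  then have "AE q in unif01. deg W q = class_degree k \<longrightarrow> W (x, q) = lab W k x" by simp
  then have *: "AE q in unif01. deg W q = class_degree k \<longrightarrow> 0 \<le> lab W k x \<and> lab W k x \<le> 1"
  proof (rule AE_mpI, intro impI)
    fix q assume "q \<in> space unif01" "deg W q = class_degree k \<longrightarrow> W (x, q) = lab W k x"
      "deg W q = class_degree k"
    then show "0 \<le> lab W k x \<and> lab W k x \<le> 1" using W_range[of x q] x by simp
  qed
  show "0 \<le> lab W k x \<and> lab W k x \<le> 1"
  proof (rule ccontr)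
    assume "\<not> (0 \<le> lab W k x \<and> lab W k x \<le> 1)"
    with * have "AE q in unif01. deg W q \<noteq> class_degree k" by simp
    with class_nonnull[OF k] show False by simp
  qed
qed

lemma mark_AE: "AE x in unif01. vtx x \<longrightarrow> (mrk x = 0 \<or> mrk x = 1/2 \<or> mrk x = 1) \<and>
    (mrk x \<noteq> 1/2 \<longrightarrow> pos x = 0 \<or> pos x = 1) \<and>
    (mrk x = 1/2 \<longrightarrow> (1 + lev x) * (lab W 4 x - 1 + 1/4 * (lev x + pos x + mrk x)) + 3/8 * (lev x)\<^sup>2 = 0)"
proof -
  let ?a = "VV 0 \<odot> (Sq (BB 0 \<odot> ((BB 0 \<ominus> Const (1/2)) \<odot> (BB 0 \<ominus> Const 1))) \<oplus>
    (Sq ((BB 0 \<ominus> Const (1/2)) \<odot> (RR 0 \<odot> (RR 0 \<ominus> Const 1))) \<oplus>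
     Sq (BB 0 \<odot> ((BB 0 \<ominus> Const 1) \<odot>
       ((Const 1 \<oplus> KK 0) \<odot> (QQ 0 \<ominus> Const 1 \<oplus> Const (1/4) \<odot> (KK 0 \<oplus> RR 0 \<oplus> BB 0))
         \<oplus> Const (3/8) \<odot> Sq (KK 0))))))"
  have "ex_label \<in> set zero_exprs" by (simp add: zero_exprs_def)
  from eval_0[OF this] have "AE t in unif01. eval W ?a ((\<lambda>_. 0)(0 := t)) = 0"
    unfolding ex_label_def
    by (rule eval_Integ_eq_0_AE[OF W, rotated]) (auto intro!: mult_nonneg_nonneg add_nonneg_nonneg)
  then show ?thesis
  proof (rule AE_mpI, intro impI)
    fix t assume e: "eval W ?a ((\<lambda>_. 0)(0 := t)) = 0" and t: "vtx t"
    have *: "x\<^sup>2 + (y\<^sup>2 + z\<^sup>2) = 0 \<longleftrightarrow> x = 0 \<and> y = 0 \<and> z = 0" for x y z :: real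
      by (simp add: add_nonneg_eq_0_iff)
    from e ind_vtx[OF t] show "(mrk t = 0 \<or> mrk t = 1/2 \<or> mrk t = 1) \<and>
    (mrk t \<noteq> 1/2 \<longrightarrow> pos t = 0 \<or> pos t = 1) \<and>
    (mrk t = 1/2 \<longrightarrow> (1 + lev t) * (lab W 4 t - 1 + 1/4 * (lev t + pos t + mrk t)) + 3/8 * (lev t)\<^sup>2 = 0)"
      by (auto simp: *)
  qed
qed

definition edge_rule :: "real \<Rightarrow> real \<Rightarrow> bool" where
  "edge_rule x y \<longleftrightarrow> (lev x = lev y \<or> lev x = 2 * lev y \<or> lev y = 2 * lev x) \<and>
    (lev x \<noteq> lev y \<longrightarrow> (mrk x = 0 \<or> mrk x = 1) \<and> (mrk y = 0 \<or> mrk y = 1)) \<and>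
    (chi W x y \<noteq> 0 \<longrightarrow> pos x = pos y \<and> mrk x = mrk y)"

lemma edge_AE: "AE x in unif01. vtx x \<longrightarrow> (AE y in unif01. vtx y \<longrightarrow> W (x, y) \<noteq> 0 \<longrightarrow> edge_rule x y)"
proof -
  let ?S = "Sq ((KK 0 \<ominus> KK 1) \<odot> ((KK 0 \<ominus> Const 2 \<odot> KK 1) \<odot> (KK 1 \<ominus> Const 2 \<odot> KK 0))) \<oplus>
    (Sq ((KK 0 \<ominus> KK 1) \<odot> (BB 0 \<odot> (BB 0 \<ominus> Const 1))) \<oplus>
    (Sq ((KK 0 \<ominus> KK 1) \<odot> (BB 1 \<odot> (BB 1 \<ominus> Const 1))) \<oplus>
    (Sq (Chi 0 1 \<odot> (RR 0 \<ominus> RR 1)) \<oplus>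
     Sq (Chi 0 1 \<odot> (BB 0 \<ominus> BB 1)))))"
  have nn: "0 \<le> eval W ?S x" for x by simp
  have "ex_edge \<in> set zero_exprs" by (simp add: zero_exprs_def)
  from eval_0[OF this]
  have "AE s in unif01. AE t in unif01. eval W (VV 0 \<odot> (VV 1 \<odot> (Edge 0 1 \<odot> ?S))) ((\<lambda>_. 0)(0 := s, 1 := t)) = 0"
    unfolding ex_edge_def
  proof (rule eval_Integ2_eq_0_AE[OF W, rotated])
    fix s t :: real assume "s \<in> {0..<1}" "t \<in> {0..<1}"
    then show "0 \<le> eval W (VV 0 \<odot> (VV 1 \<odot> (Edge 0 1 \<odot> ?S))) ((\<lambda>_. 0)(0 := s, 1 := t))"
      using nn W_range by (simp del: nn add: mult_nonneg_nonneg)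
  qed simp
  then show ?thesis
  proof (rule AE_mpI, intro impI)
    fix s assume "AE t in unif01. eval W (VV 0 \<odot> (VV 1 \<odot> (Edge 0 1 \<odot> ?S))) ((\<lambda>_. 0)(0 := s, 1 := t)) = 0"
      and s: "vtx s"
    from this(1) show "AE y in unif01. vtx y \<longrightarrow> W (s, y) \<noteq> 0 \<longrightarrow> edge_rule s y"
    proof (rule AE_mpI, intro impI)
      fix t assume e: "eval W (VV 0 \<odot> (VV 1 \<odot> (Edge 0 1 \<odot> ?S))) ((\<lambda>_. 0)(0 := s, 1 := t)) = 0"
        and t: "vtx t" "W (s, t) \<noteq> 0"
      have *: "a\<^sup>2 + (b\<^sup>2 + (c\<^sup>2 + (d\<^sup>2 + e\<^sup>2))) = 0 \<longleftrightarrow> a = 0 \<and> b = 0 \<and> c = 0 \<and> d = 0 \<and> e = 0"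
        for a b c d e :: real by (simp add: add_nonneg_eq_0_iff)
      from e ind_vtx[OF s] ind_vtx[OF t(1)] t(2) show "edge_rule s t"
        unfolding edge_rule_def by (auto simp: *)
    qed
  qed
qed

lemma AE3_edges:
  assumes "Integ 0 (Integ 1 (Integ 2 (VV 0 \<odot> (VV 1 \<odot> (VV 2 \<odot> a))))) \<in> set zero_exprs"
    and "fv a \<subseteq> {0, 1, 2}"
    and "\<And>s t u. s \<in> {0..<1} \<Longrightarrow> t \<in> {0..<1} \<Longrightarrow> u \<in> {0..<1} \<Longrightarrow> 0 \<le> eval W a ((\<lambda>_. 0)(0 := s, 1 := t, 2 := u))"
  shows "AE s in unif01. vtx s \<longrightarrow> (AE t in unif01. vtx t \<longrightarrow> (AE u in unif01. vtx u \<longrightarrow>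
    eval W a ((\<lambda>_. 0)(0 := s, 1 := t, 2 := u)) = 0))"
proof -
  from eval_0[OF assms(1)]
  have "AE s in unif01. AE t in unif01. AE u in unif01.
    eval W (VV 0 \<odot> (VV 1 \<odot> (VV 2 \<odot> a))) ((\<lambda>_. 0)(0 := s, 1 := t, 2 := u)) = 0"
    by (rule eval_Integ3_eq_0_AE[OF W, rotated]) (use assms(2,3) in \<open>auto intro!: mult_nonneg_nonneg\<close>)
  then show ?thesis
  proof (rule AE_mpI, intro impI)
    fix s assume "AE t in unif01. AE u in unif01.
      eval W (VV 0 \<odot> (VV 1 \<odot> (VV 2 \<odot> a))) ((\<lambda>_. 0)(0 := s, 1 := t, 2 := u)) = 0" and s: "vtx s"
    from this(1) show "AE t in unif01. vtx t \<longrightarrow> (AE u in unif01. vtx u \<longrightarrow>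
        eval W a ((\<lambda>_. 0)(0 := s, 1 := t, 2 := u)) = 0)"
    proof (rule AE_mpI, intro impI)
      fix t assume "AE u in unif01.
        eval W (VV 0 \<odot> (VV 1 \<odot> (VV 2 \<odot> a))) ((\<lambda>_. 0)(0 := s, 1 := t, 2 := u)) = 0" and t: "vtx t"
      from this(1) show "AE u in unif01. vtx u \<longrightarrow> eval W a ((\<lambda>_. 0)(0 := s, 1 := t, 2 := u)) = 0"
        by (rule AE_mpI) (use ind_vtx s t in force)
    qed
  qed
qed

lemma closed_AE: "AE x in unif01. vtx x \<longrightarrow> (AE y in unif01. vtx y \<longrightarrow> (AE z in unif01. vtx z \<longrightarrow>
    W (x, y) \<noteq> 0 \<longrightarrow> W (y, z) \<noteq> 0 \<longrightarrow> chi W y z \<noteq> 0 \<longrightarrow> W (x, z) = 1))"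
  using AE3_edges[of "Edge 0 1 \<odot> (Edge 1 2 \<odot> (Sq (Chi 1 2) \<odot> (Const 1 \<ominus> Edge 0 2)))"] W_range
  by (simp add: zero_exprs_def ex_closed_def disj_imp mult_nonneg_nonneg)

lemma congr_AE: "AE y in unif01. vtx y \<longrightarrow> (AE z in unif01. vtx z \<longrightarrow> (AE w in unif01. vtx w \<longrightarrow>
    W (y, z) \<noteq> 0 \<longrightarrow> chi W y z \<noteq> 0 \<longrightarrow> W (y, w) \<noteq> 0 \<longrightarrow> W (z, w) = 1))"
  using AE3_edges[of "Edge 0 1 \<odot> (Sq (Chi 0 1) \<odot> (Edge 0 2 \<odot> (Const 1 \<ominus> Edge 1 2)))"] W_range
  by (simp add: zero_exprs_def ex_congr_def disj_imp mult_nonneg_nonneg)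

lemma congr'_AE: "AE y in unif01. vtx y \<longrightarrow> (AE z in unif01. vtx z \<longrightarrow> (AE w in unif01. vtx w \<longrightarrow>
    W (y, z) \<noteq> 0 \<longrightarrow> chi W y z \<noteq> 0 \<longrightarrow> W (z, w) \<noteq> 0 \<longrightarrow> W (y, w) = 1))"
  using AE3_edges[of "Edge 0 1 \<odot> (Sq (Chi 0 1) \<odot> (Edge 1 2 \<odot> (Const 1 \<ominus> Edge 0 2)))"] W_range
  by (simp add: zero_exprs_def ex_congr'_def disj_imp mult_nonneg_nonneg)

lemma AE1_square:
  assumes "Integ 0 (VV 0 \<odot> Sq a) \<in> set zero_exprs" "fv a \<subseteq> {0}"
  shows "AE t in unif01. vtx t \<longrightarrow> eval W a ((\<lambda>_. 0)(0 := t)) = 0"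
proof -
  from eval_0[OF assms(1)] have "AE t in unif01. eval W (VV 0 \<odot> Sq a) ((\<lambda>_. 0)(0 := t)) = 0"
    by (rule eval_Integ_eq_0_AE[OF W, rotated]) (use assms(2) in auto)
  then show ?thesis
    by (rule AE_mpI) (use ind_vtx in force)
qed

lemma fstep_AE: "AE x in unif01. vtx x \<longrightarrow> mrk x * (1 - mrk x) + (1 - pos x) = 0 \<or>
    (1 + lev x) * (\<integral>y. (ind W 0 y)\<^sup>2 * (W (x, y) * fstep W x y) \<partial>unif01) = 1/8 * (lev x) ^ 6"
proof -
  have p: "k\<^sup>2 * (k\<^sup>2)\<^sup>2 = k ^ 6" for k :: real by (simp add: power2_eq_square power_def numeral_eq_Suc)
  show ?thesis
    using AE1_square[of "(BB 0 \<odot> (Const 1 \<ominus> BB 0) \<oplus> (Const 1 \<ominus> RR 0)) \<odot>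
    ((Const 1 \<oplus> KK 0) \<odot> Integ 1 (VV 1 \<odot> (Edge 0 1 \<odot> Fstep 0 1))
      \<ominus> Const (1/8) \<odot> (Sq (KK 0) \<odot> Sq (Sq (KK 0))))"]
    by (simp add: zero_exprs_def ex_step_def p insert_Diff_if)
qed

lemma bstep_AE: "AE x in unif01. vtx x \<longrightarrow> mrk x * (1 - mrk x) + pos x = 0 \<or>
    (1 + lev x) * (\<integral>y. (ind W 0 y)\<^sup>2 * (W (x, y) * bstep W x y) \<partial>unif01) = 1/8 * (lev x) ^ 6"
proof -
  have p: "k\<^sup>2 * (k\<^sup>2)\<^sup>2 = k ^ 6" for k :: real by (simp add: power2_eq_square power_def numeral_eq_Suc)
  show ?thesis
    using AE1_square[of "(BB 0 \<odot> (Const 1 \<ominus> BB 0) \<oplus> RR 0) \<odot>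
    ((Const 1 \<oplus> KK 0) \<odot> Integ 1 (VV 1 \<odot> (Edge 0 1 \<odot> Bstep 0 1))
      \<ominus> Const (1/8) \<odot> (Sq (KK 0) \<odot> Sq (Sq (KK 0))))"]
    by (simp add: zero_exprs_def ex_back_def p insert_Diff_if)
qed

lemma atom_AE: "AE x in unif01. vtx x \<longrightarrow>
    (1 + lev x) * (\<integral>y. (ind W 0 y)\<^sup>2 * (W (x, y) * chi W x y) \<partial>unif01) = 1/16 * (lev x) ^ 6"
proof -
  have p: "k\<^sup>2 * (k\<^sup>2)\<^sup>2 = k ^ 6" for k :: real by (simp add: power2_eq_square power_def numeral_eq_Suc)
  show ?thesis
    using AE1_square[of "(Const 1 \<oplus> KK 0) \<odot> Integ 1 (VV 1 \<odot> (Edge 0 1 \<odot> Chi 0 1))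
      \<ominus> Const (1/16) \<odot> (Sq (KK 0) \<odot> Sq (Sq (KK 0)))"]
    by (simp add: zero_exprs_def ex_atom_def p insert_Diff_if)
qed

lemma next_AE: "AE x in unif01. vtx x \<longrightarrow> mrk x = 1/2 \<or>
    (1 + 1/2 * lev x) * (\<integral>y. (ind W 0 y)\<^sup>2 * (W (x, y) * ((lev x - lev y) * (2 * lev x - lev y) *
      (select \<alpha> (pos y) * select \<beta> (mrk y)))) \<partial>unif01) = 3/256 * (lev x) ^ 4"
proof -
  have p: "(k\<^sup>2)\<^sup>2 = k ^ 4" for k :: real by (simp add: power2_eq_square power_def numeral_eq_Suc)
  have "ex_next \<alpha> \<beta> \<in> set zero_exprs" by (cases \<alpha>; cases \<beta>) (simp_all add: zero_exprs_def)
  then show ?thesis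
    using AE1_square[of "(BB 0 \<ominus> Const (1/2)) \<odot>
    ((Const 1 \<oplus> Const (1/2) \<odot> KK 0) \<odot> Integ 1 (VV 1 \<odot> (Edge 0 1 \<odot>
      (((KK 0 \<ominus> KK 1) \<odot> (Const 2 \<odot> KK 0 \<ominus> KK 1)) \<odot> (Select \<alpha> (RR 1) \<odot> Select \<beta> (BB 1)))))
      \<ominus> Const (3/256) \<odot> Sq (Sq (KK 0)))"]
    by (simp add: ex_next_def p insert_Diff_if)
qed

end

section \<open>Atoms of a structured graphon\<close>

context structured_graphon begin

text \<open>Strands are built from individual points. So the almost-everywhere consequences of the
  identities are collected in a property of a single point, which almost every vertex of positive
  level has.\<close>

definition good :: "real \<Rightarrow> bool" where
  "good x \<longleftrightarrow> x \<in> {0..<1} \<and> vtx x \<and> 0 < lev x \<and>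
    (\<forall>k\<in>{1, 2, 3, 4}. 0 \<le> lab W k x \<and> lab W k x \<le> 1 \<and>
      (AE q in unif01. deg W q = class_degree k \<longrightarrow> W (x, q) = lab W k x)) \<and>
    ((mrk x = 0 \<or> mrk x = 1/2 \<or> mrk x = 1) \<and> (mrk x \<noteq> 1/2 \<longrightarrow> pos x = 0 \<or> pos x = 1) \<and>
    (mrk x = 1/2 \<longrightarrow> (1 + lev x) * (lab W 4 x - 1 + 1/4 * (lev x + pos x + mrk x)) + 3/8 * (lev x)\<^sup>2 = 0)) \<and>
    (AE y in unif01. vtx y \<longrightarrow> W (x, y) \<noteq> 0 \<longrightarrow> edge_rule x y) \<and>
    (AE y in unif01. vtx y \<longrightarrow> (AE z in unif01. vtx z \<longrightarrow>
      W (x, y) \<noteq> 0 \<longrightarrow> W (y, z) \<noteq> 0 \<longrightarrow> chi W y z \<noteq> 0 \<longrightarrow> W (x, z) = 1)) \<and>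
    (AE z in unif01. vtx z \<longrightarrow> (AE w in unif01. vtx w \<longrightarrow>
      W (x, z) \<noteq> 0 \<longrightarrow> chi W x z \<noteq> 0 \<longrightarrow> W (x, w) \<noteq> 0 \<longrightarrow> W (z, w) = 1)) \<and>
    (AE z in unif01. vtx z \<longrightarrow> (AE w in unif01. vtx w \<longrightarrow>
      W (x, z) \<noteq> 0 \<longrightarrow> chi W x z \<noteq> 0 \<longrightarrow> W (z, w) \<noteq> 0 \<longrightarrow> W (x, w) = 1)) \<and>
    (mrk x * (1 - mrk x) + (1 - pos x) = 0 \<or>
      (1 + lev x) * (\<integral>y. (ind W 0 y)\<^sup>2 * (W (x, y) * fstep W x y) \<partial>unif01) = 1/8 * (lev x) ^ 6) \<and>
    (mrk x * (1 - mrk x) + pos x = 0 \<or>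
      (1 + lev x) * (\<integral>y. (ind W 0 y)\<^sup>2 * (W (x, y) * bstep W x y) \<partial>unif01) = 1/8 * (lev x) ^ 6) \<and>
    (1 + lev x) * (\<integral>y. (ind W 0 y)\<^sup>2 * (W (x, y) * chi W x y) \<partial>unif01) = 1/16 * (lev x) ^ 6 \<and>
    (\<forall>\<alpha> \<beta>. mrk x = 1/2 \<or>
      (1 + 1/2 * lev x) * (\<integral>y. (ind W 0 y)\<^sup>2 * (W (x, y) * ((lev x - lev y) * (2 * lev x - lev y) *
      (select \<alpha> (pos y) * select \<beta> (mrk y)))) \<partial>unif01) = 3/256 * (lev x) ^ 4)"

lemma good_AE: "AE x in unif01. vtx x \<longrightarrow> 0 < lev x \<longrightarrow> good x"
proof -
  have 1: "AE x in unif01. \<forall>k\<in>{1, 2, 3, 4}. vtx x \<longrightarrow> 0 \<le> lab W k x \<and> lab W k x \<le> 1"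
    using label_range_AE by (intro AE_ball_countable[THEN iffD2] ballI countable_finite) auto
  have 2: "AE x in unif01. \<forall>k\<in>{1, 2, 3, 4}. vtx x \<longrightarrow>
      (AE q in unif01. deg W q = class_degree k \<longrightarrow> W (x, q) = lab W k x)"
    using twin_AE by (intro AE_ball_countable[THEN iffD2] ballI countable_finite) auto
  have 3: "AE x in unif01. \<forall>p\<in>UNIV. vtx x \<longrightarrow> mrk x = 1/2 \<or>
      (1 + 1/2 * lev x) * (\<integral>y. (ind W 0 y)\<^sup>2 * (W (x, y) * ((lev x - lev y) * (2 * lev x - lev y) *
      (select (fst p) (pos y) * select (snd p) (mrk y)))) \<partial>unif01) = 3/256 * (lev x) ^ 4"
    by (rule AE_ball_countable[THEN iffD2]) (use next_AE in auto)
  from 1 2 3 mark_AE edge_AE closed_AE congr_AE congr'_AE fstep_AE bstep_AE atom_AE AE_space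
  show ?thesis
  proof eventually_elim
    case (elim x)
    show ?case
    proof (intro impI)
      assume v: "vtx x" "0 < lev x"
      show "good x"
        unfolding good_def
      proof (intro conjI ballI allI)
        show "x \<in> {0..<1}" using elim(12) by simp
        fix \<alpha> \<beta>
        show "mrk x = 1/2 \<or> (1 + 1/2 * lev x) * (\<integral>y. (ind W 0 y)\<^sup>2 * (W (x, y) *
          ((lev x - lev y) * (2 * lev x - lev y) * (select \<alpha> (pos y) * select \<beta> (mrk y)))) \<partial>unif01)
          = 3/256 * (lev x) ^ 4"
          using elim(3)[rule_format, of "(\<alpha>, \<beta>)"] v unfolding fst_conv snd_conv by blast
      qed (use v elim(1,2,4-11) in blast)+
    qed
  qed
qed

lemma
  assumes "good x"
  shows good_space: "x \<in> {0..<1}" and good_vtx: "vtx x" and good_lev: "0 < lev x"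
    and good_range: "k \<in> {1, 2, 3, 4} \<Longrightarrow> 0 \<le> lab W k x" "k \<in> {1, 2, 3, 4} \<Longrightarrow> lab W k x \<le> 1"
    and good_twin: "k \<in> {1, 2, 3, 4} \<Longrightarrow> AE q in unif01. deg W q = class_degree k \<longrightarrow> W (x, q) = lab W k x"
    and good_mark: "mrk x = 0 \<or> mrk x = 1/2 \<or> mrk x = 1"
    and good_end: "mrk x \<noteq> 1/2 \<Longrightarrow> pos x = 0 \<or> pos x = 1"
    and good_lab4: "mrk x = 1/2 \<Longrightarrow>
      (1 + lev x) * (lab W 4 x - 1 + 1/4 * (lev x + pos x + mrk x)) + 3/8 * (lev x)\<^sup>2 = 0"
    and good_edge: "AE y in unif01. vtx y \<longrightarrow> W (x, y) \<noteq> 0 \<longrightarrow> edge_rule x y"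
    and good_closed: "AE y in unif01. vtx y \<longrightarrow> (AE z in unif01. vtx z \<longrightarrow>
      W (x, y) \<noteq> 0 \<longrightarrow> W (y, z) \<noteq> 0 \<longrightarrow> chi W y z \<noteq> 0 \<longrightarrow> W (x, z) = 1)"
    and good_congr: "AE z in unif01. vtx z \<longrightarrow> (AE w in unif01. vtx w \<longrightarrow>
      W (x, z) \<noteq> 0 \<longrightarrow> chi W x z \<noteq> 0 \<longrightarrow> W (x, w) \<noteq> 0 \<longrightarrow> W (z, w) = 1)"
    and good_congr': "AE z in unif01. vtx z \<longrightarrow> (AE w in unif01. vtx w \<longrightarrow>
      W (x, z) \<noteq> 0 \<longrightarrow> chi W x z \<noteq> 0 \<longrightarrow> W (z, w) \<noteq> 0 \<longrightarrow> W (x, w) = 1)"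
    and good_fstep: "mrk x * (1 - mrk x) + (1 - pos x) = 0 \<or>
      (1 + lev x) * (\<integral>y. (ind W 0 y)\<^sup>2 * (W (x, y) * fstep W x y) \<partial>unif01) = 1/8 * (lev x) ^ 6"
    and good_bstep: "mrk x * (1 - mrk x) + pos x = 0 \<or>
      (1 + lev x) * (\<integral>y. (ind W 0 y)\<^sup>2 * (W (x, y) * bstep W x y) \<partial>unif01) = 1/8 * (lev x) ^ 6"
    and good_atom: "(1 + lev x) * (\<integral>y. (ind W 0 y)\<^sup>2 * (W (x, y) * chi W x y) \<partial>unif01) = 1/16 * (lev x) ^ 6"
    and good_next: "mrk x = 1/2 \<or>
      (1 + 1/2 * lev x) * (\<integral>y. (ind W 0 y)\<^sup>2 * (W (x, y) * ((lev x - lev y) * (2 * lev x - lev y) *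
      (select \<alpha> (pos y) * select \<beta> (mrk y)))) \<partial>unif01) = 3/256 * (lev x) ^ 4"
  using assms unfolding good_def by blast+

lemma good_pos: assumes "good x" shows "0 \<le> pos x" "pos x \<le> 1"
  using good_range[OF assms, of 2] by auto

text \<open>Different atoms may carry the same labels, so adjacency to \<open>x\<close> is part of
  the description of its atom.\<close>

definition cls :: "real \<Rightarrow> real set" where
  "cls x = {y \<in> {0..<1}. vtx y \<and> W (x, y) \<noteq> 0 \<and> lev y = lev x \<and> pos y = pos x \<and> mrk y = mrk x}"

text \<open>The parameter \<open>d\<close> is 1 for the successors and -1 for the predecessors on the strand.\<close>

definition nb :: "real \<Rightarrow> real \<Rightarrow> real set" where
  "nb d x = {y \<in> {0..<1}. vtx y \<and> W (x, y) \<noteq> 0 \<and> lev y = lev x \<and> pos y = pos x + d * lev x}"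

lemma vtx_measurable [measurable]: "Measurable.pred unif01 vtx"
  unfolding vtx_def by measurable

lemma cls_sets: "x \<in> {0..<1} \<Longrightarrow> cls x \<in> sets unif01"
proof -
  assume [measurable]: "x \<in> {0..<1}"
  have "cls x = {y \<in> space unif01. vtx y \<and> W (x, y) \<noteq> 0 \<and> lev y = lev x \<and> pos y = pos x \<and> mrk y = mrk x}"
    by (auto simp: cls_def)
  also have "\<dots> \<in> sets unif01" by measurable
  finally show ?thesis .
qed

lemma nb_sets: "x \<in> {0..<1} \<Longrightarrow> nb d x \<in> sets unif01"
proof -
  assume [measurable]: "x \<in> {0..<1}"
  have "nb d x = {y \<in> space unif01. vtx y \<and> W (x, y) \<noteq> 0 \<and> lev y = lev x \<and> pos y = pos x + d * lev x}"
    by (auto simp: nb_def)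
  also have "\<dots> \<in> sets unif01" by measurable
  finally show ?thesis .
qed

lemma chi_eq: "lev y = lev x \<Longrightarrow> pos y = pos x \<Longrightarrow> chi W x y = lev x ^ 4"
  by (simp add: chi_def phi_def power2_eq_square power_def numeral_eq_Suc)

text \<open>At equal levels, \<open>chi W x y = 0\<close> leaves
  \<open>(lev x)^2 = (pos x - pos y)^2\<close>, that is, a step of length \<open>lev x\<close> in
  one of the two directions.\<close>

lemma edge_cases:
  assumes "edge_rule x y" "0 < lev x"
  obtains "lev y = lev x" "pos y = pos x" "mrk y = mrk x"
  | "lev y = lev x" "pos y = pos x + lev x"
  | "lev y = lev x" "pos y = pos x - lev x"
  | "lev y = lev x / 2" "mrk x = 0 \<or> mrk x = 1" "mrk y = 0 \<or> mrk y = 1"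
  | "lev y = 2 * lev x" "mrk x = 0 \<or> mrk x = 1" "mrk y = 0 \<or> mrk y = 1"
proof (cases "lev y = lev x")
  case True
  show thesis
  proof (cases "chi W x y = 0")
    case False
    then show thesis using assms True that(1) by (auto simp: edge_rule_def)
  next
    case z: True
    have "phi (lev x) (lev y) = lev x * lev x" using True by (simp add: phi_def)
    then have "(lev x)\<^sup>2 = (pos x - pos y)\<^sup>2"
      using z assms(2) by (simp add: chi_def)
    then have "pos x - pos y = lev x \<or> pos x - pos y = - lev x"
      by (auto simp: power2_eq_iff)
    then show thesis using True that(2,3) by (auto simp: algebra_simps)
  qed
next
  case False
  then show thesis using assms that(4,5) by (auto simp: edge_rule_def)
qed

text \<open>By \<open>good_atom\<close> there is a vertex \<open>y\<close> in the atom of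
  \<open>x\<close> for which both congruences hold. If \<open>W (x, w)\<close> is nonzero, then
  \<open>W (y, w) = 1\<close>; being nonzero, this in turn gives
  \<open>W (x, w) = 1\<close>.\<close>

lemma good_zero_one:
  assumes x: "good x" shows "AE z in unif01. vtx z \<longrightarrow> W (x, z) = 0 \<or> W (x, z) = 1"
proof -
  have "\<exists>y. vtx y \<and> W (x, y) \<noteq> 0 \<and> chi W x y \<noteq> 0 \<and>
    (AE w in unif01. vtx w \<longrightarrow> W (x, w) \<noteq> 0 \<longrightarrow> W (y, w) = 1) \<and>
    (AE w in unif01. vtx w \<longrightarrow> W (y, w) \<noteq> 0 \<longrightarrow> W (x, w) = 1)"
  proof (rule ccontr)
    assume no: "\<not> ?thesis"
    have "AE y in unif01. (ind W 0 y)\<^sup>2 * (W (x, y) * chi W x y) = 0"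
      using ind_AE good_congr[OF x] good_congr'[OF x]
    proof eventually_elim
      case (elim y)
      show ?case
      proof (rule ccontr)
        assume "(ind W 0 y)\<^sup>2 * (W (x, y) * chi W x y) \<noteq> 0"
        then have y: "vtx y" "W (x, y) \<noteq> 0" "chi W x y \<noteq> 0" using elim(1) by (auto split: if_splits)
        with elim(2,3) no show False by auto
      qed
    qed
    then have "(\<integral>y. (ind W 0 y)\<^sup>2 * (W (x, y) * chi W x y) \<partial>unif01) = 0"
      by (rule integral_eq_zero_AE)
    with good_atom[OF x] good_lev[OF x] show False by simp
  qed
  then obtain y where "AE w in unif01. vtx w \<longrightarrow> W (x, w) \<noteq> 0 \<longrightarrow> W (y, w) = 1"
    "AE w in unif01. vtx w \<longrightarrow> W (y, w) \<noteq> 0 \<longrightarrow> W (x, w) = 1" by blast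
  then show ?thesis by eventually_elim auto
qed

text \<open>Each congruence transfers nonzero values of one row to values 1 of the other, so where
  both rows are nonzero they are 1, and they vanish together.\<close>

lemma cls_twin:
  assumes x: "good x"
  shows "AE y in unif01. y \<in> cls x \<longrightarrow> (AE z in unif01. vtx z \<longrightarrow> W (y, z) = W (x, z))"
  using good_congr[OF x] good_congr'[OF x]
proof eventually_elim
  case (elim y)
  show ?case
  proof
    assume "y \<in> cls x"
    then have y: "vtx y" "W (x, y) \<noteq> 0" "chi W x y \<noteq> 0"
      using good_lev[OF x] chi_eq[of y x] by (auto simp: cls_def)
    with elim have "AE w in unif01. vtx w \<longrightarrow> W (x, w) \<noteq> 0 \<longrightarrow> W (y, w) = 1"
      "AE w in unif01. vtx w \<longrightarrow> W (y, w) \<noteq> 0 \<longrightarrow> W (x, w) = 1" by auto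
    then show "AE z in unif01. vtx z \<longrightarrow> W (y, z) = W (x, z)"
    proof eventually_elim
      case (elim w)
      show ?case
      proof
        assume "vtx w"
        with elim show "W (y, w) = W (x, w)"
          by (cases "W (x, w) = 0"; cases "W (y, w) = 0") auto
      qed
    qed
  qed
qed

text \<open>On class 0 the indicator and the row of \<open>x\<close> take only the values 0 and 1. A
  function that, on the neighbours of \<open>x\<close>, is constant on one set and 0 elsewhere
  therefore turns an identity into a statement about a mass.\<close>

lemma integral_eq_measure:
  assumes x: "good x" and A: "A \<in> sets unif01"
    and f: "\<And>y. y \<in> {0..<1} \<Longrightarrow> vtx y \<Longrightarrow> W (x, y) \<noteq> 0 \<Longrightarrow> edge_rule x y \<Longrightarrow> f y = c * indicator A y"
    and A': "\<And>y. y \<in> A \<Longrightarrow> vtx y \<and> W (x, y) \<noteq> 0"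
    and [measurable]: "f \<in> borel_measurable unif01"
  shows "(\<integral>y. (ind W 0 y)\<^sup>2 * (W (x, y) * f y) \<partial>unif01) = c * measure unif01 A"
proof -
  have [measurable]: "x \<in> {0..<1}" using good_space[OF x] .
  note A[measurable]
  have "(\<integral>y. (ind W 0 y)\<^sup>2 * (W (x, y) * f y) \<partial>unif01) = (\<integral>y. c * indicator A y \<partial>unif01)"
  proof (rule integral_cong_AE)
    show "AE y in unif01. (ind W 0 y)\<^sup>2 * (W (x, y) * f y) = c * indicator A y"
      using ind_AE good_edge[OF x] good_zero_one[OF x] AE_space
    proof eventually_elim
      case (elim y)
      show ?case
      proof (cases "vtx y \<and> W (x, y) \<noteq> 0")
        case True
        with elim f[of y] show ?thesis by auto
      next
        case False
        with A'[of y] elim(1) show ?thesis by (auto simp: indicator_def)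
      qed
    qed
  qed measurable
  also have "\<dots> = c * measure unif01 A"
    using A sets.sets_into_space[OF A] by (simp add: Int_absorb2)
  finally show ?thesis .
qed

lemma measure_cls:
  assumes x: "good x" shows "measure unif01 (cls x) = atom_mass (lev x)"
proof -
  have [measurable]: "x \<in> {0..<1}" using good_space[OF x] .
  have k: "0 < lev x" using good_lev[OF x] .
  have "(\<integral>y. (ind W 0 y)\<^sup>2 * (W (x, y) * chi W x y) \<partial>unif01) = lev x ^ 4 * measure unif01 (cls x)"
  proof (rule integral_eq_measure[OF x cls_sets[OF good_space[OF x]]])
    fix y assume y: "y \<in> {0..<1}" "vtx y" "W (x, y) \<noteq> 0" and e: "edge_rule x y"
    show "chi W x y = lev x ^ 4 * indicator (cls x) y"
      using e k
    proof (cases rule: edge_cases)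
      case 1
      then show ?thesis using y chi_eq by (simp add: cls_def)
    qed (use k in \<open>auto simp: chi_def phi_def cls_def power2_eq_square\<close>)
  next
    show "chi W x \<in> borel_measurable unif01"
      unfolding chi_def phi_def by measurable
  qed (auto simp: cls_def)
  with good_atom[OF x] have "(1 + lev x) * (lev x ^ 4 * measure unif01 (cls x)) = 1/16 * lev x ^ 6" by simp
  then have "lev x ^ 4 * ((1 + lev x) * measure unif01 (cls x)) = lev x ^ 4 * ((lev x)\<^sup>2 / 16)"
    by (simp add: algebra_simps power2_eq_square power_def numeral_eq_Suc)
  then have "(1 + lev x) * measure unif01 (cls x) = (lev x)\<^sup>2 / 16"
    by (rule mult_left_cancel[THEN iffD1, rotated]) (use k in simp)
  then show ?thesis using k by (simp add: atom_mass_def field_simps)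
qed

text \<open>Excludes just the ends at which the first factor of \<open>ex_step\<close> or of
  \<open>ex_back\<close> vanishes.\<close>

definition avail :: "real \<Rightarrow> real \<Rightarrow> bool" where
  "avail d x \<longleftrightarrow> d = 1 \<and> (mrk x = 1/2 \<or> pos x \<noteq> 1) \<or> d = -1 \<and> (mrk x = 1/2 \<or> pos x \<noteq> 0)"

lemma measure_nb:
  assumes x: "good x" and d: "avail d x" shows "measure unif01 (nb d x) = atom_mass (lev x)"
proof -
  have [measurable]: "x \<in> {0..<1}" using good_space[OF x] .
  have k: "0 < lev x" using good_lev[OF x] .
  have half: "mrk x * (1 - mrk x) = 1/4" if "mrk x = 1/2" by (simp add: that)
  have other: "mrk x * (1 - mrk x) = 0" if "mrk x \<noteq> 1/2" using good_mark[OF x] that by auto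
  have nz: "mrk x * (1 - mrk x) + (1 - pos x) \<noteq> 0" if "d = 1"
    using d that half other good_pos[OF x] unfolding avail_def by (cases "mrk x = 1/2") linarith+
  have nz': "mrk x * (1 - mrk x) + pos x \<noteq> 0" if "d = -1"
    using d that half other good_pos[OF x] unfolding avail_def by (cases "mrk x = 1/2") linarith+
  have "(\<integral>y. (ind W 0 y)\<^sup>2 * (W (x, y) * fstep W x y) \<partial>unif01) = 2 * lev x ^ 4 * measure unif01 (nb 1 x)"
  proof (rule integral_eq_measure[OF x nb_sets[OF good_space[OF x]]])
    fix y assume y: "y \<in> {0..<1}" "vtx y" "W (x, y) \<noteq> 0" and e: "edge_rule x y"
    show "fstep W x y = 2 * lev x ^ 4 * indicator (nb 1 x) y"
      using e k
    proof (cases rule: edge_cases)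
      case 2
      then have "fstep W x y = 2 * lev x ^ 4"
        by (simp add: fstep_def phi_def power_def numeral_eq_Suc)
      then show ?thesis using y 2 by (simp add: nb_def)
    qed (use k in \<open>auto simp: fstep_def phi_def nb_def\<close>)
  next
    show "fstep W x \<in> borel_measurable unif01"
      unfolding fstep_def phi_def by measurable
  qed (auto simp: nb_def)
  moreover have "(\<integral>y. (ind W 0 y)\<^sup>2 * (W (x, y) * bstep W x y) \<partial>unif01) = 2 * lev x ^ 4 * measure unif01 (nb (-1) x)"
  proof (rule integral_eq_measure[OF x nb_sets[OF good_space[OF x]]])
    fix y assume y: "y \<in> {0..<1}" "vtx y" "W (x, y) \<noteq> 0" and e: "edge_rule x y"
    show "bstep W x y = 2 * lev x ^ 4 * indicator (nb (-1) x) y"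
      using e k
    proof (cases rule: edge_cases)
      case 3
      then have "bstep W x y = 2 * lev x ^ 4"
        by (simp add: bstep_def phi_def power_def numeral_eq_Suc)
      then show ?thesis using y 3 by (simp add: nb_def)
    qed (use k in \<open>auto simp: bstep_def phi_def nb_def\<close>)
  next
    show "bstep W x \<in> borel_measurable unif01"
      unfolding bstep_def phi_def by measurable
  qed (auto simp: nb_def)
  ultimately have "(1 + lev x) * (2 * lev x ^ 4 * measure unif01 (nb d x)) = 1/8 * lev x ^ 6"
    using good_fstep[OF x] good_bstep[OF x] nz nz' d by (auto simp: avail_def)
  then have "lev x ^ 4 * ((1 + lev x) * measure unif01 (nb d x)) = lev x ^ 4 * ((lev x)\<^sup>2 / 16)"
    by (simp add: algebra_simps power2_eq_square power_def numeral_eq_Suc)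
  then have "(1 + lev x) * measure unif01 (nb d x) = (lev x)\<^sup>2 / 16"
    by (rule mult_left_cancel[THEN iffD1, rotated]) (use k in simp)
  then show ?thesis using k by (simp add: atom_mass_def field_simps)
qed

text \<open>Take a typical \<open>y\<close> in \<open>nb d x\<close>. By \<open>good_closed\<close>
  its atom lies in \<open>nb d x\<close> up to a null set, and as the vertices of the atom of
  \<open>x\<close> are twins, this atom lies in \<open>nb (-d) y\<close>. All four sets have the
  same mass, so both inclusions are equalities. This is what the prescribed masses are for.\<close>

lemma neighbour:
  assumes x: "good x" and d: "avail d x"
  obtains y where "good y" "lev y = lev x" "pos y = pos x + d * lev x"
    "AE z in unif01. z \<in> nb d x \<longleftrightarrow> z \<in> cls y" "AE z in unif01. z \<in> nb (-d) y \<longleftrightarrow> z \<in> cls x"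
proof -
  have xs [measurable]: "x \<in> {0..<1}" using good_space[OF x] .
  have k: "0 < lev x" using good_lev[OF x] .
  have [measurable]: "Measurable.pred unif01 (\<lambda>z. z \<in> cls x)" using cls_sets[OF xs] by measurable
  have "AE y in unif01. AE z in unif01. z \<in> cls x \<longrightarrow> vtx y \<longrightarrow> W (z, y) = W (x, y)"
  proof (subst square.AE_commute[symmetric])
    show "AE z in unif01. AE y in unif01. z \<in> cls x \<longrightarrow> vtx y \<longrightarrow> W (z, y) = W (x, y)"
      using cls_twin[OF x] by (rule AE_mpI) auto
  qed measurable
  with good_AE good_closed[OF x] have AE: "AE y in unif01. (vtx y \<longrightarrow> 0 < lev y \<longrightarrow> good y) \<and>
    (vtx y \<longrightarrow> (AE z in unif01. vtx z \<longrightarrow>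
      W (x, y) \<noteq> 0 \<longrightarrow> W (y, z) \<noteq> 0 \<longrightarrow> chi W y z \<noteq> 0 \<longrightarrow> W (x, z) = 1)) \<and>
    (AE z in unif01. z \<in> cls x \<longrightarrow> vtx y \<longrightarrow> W (z, y) = W (x, y))"
    by eventually_elim blast
  have pos: "0 < measure unif01 (nb d x)"
    using measure_nb[OF x d] atom_mass_pos[OF k] by simp
  obtain y where y: "y \<in> nb d x" and y': "(vtx y \<longrightarrow> 0 < lev y \<longrightarrow> good y) \<and>
    (vtx y \<longrightarrow> (AE z in unif01. vtx z \<longrightarrow>
      W (x, y) \<noteq> 0 \<longrightarrow> W (y, z) \<noteq> 0 \<longrightarrow> chi W y z \<noteq> 0 \<longrightarrow> W (x, z) = 1)) \<and>
    (AE z in unif01. z \<in> cls x \<longrightarrow> vtx y \<longrightarrow> W (z, y) = W (x, y))"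
    by (rule measure_pos_ex[OF pos nb_sets[OF xs] AE])
  note cl = y'[THEN conjunct2, THEN conjunct1] and tw = y'[THEN conjunct2, THEN conjunct2]
  have vy: "vtx y" "W (x, y) \<noteq> 0" "lev y = lev x" "pos y = pos x + d * lev x" "y \<in> {0..<1}"
    using y by (auto simp: nb_def)
  then have gy: "good y" using y' k by simp
  have dc: "d = 1 \<or> d = -1" using d by (auto simp: avail_def)
  \<comment> \<open>The step from \<open>x\<close> to \<open>y\<close> has positive length, so
    \<open>y\<close> is not at the end from which no step leads back.\<close>
  have av: "avail (-d) y"
    using dc vy(4) k good_pos[OF x] by (auto simp: avail_def)
  have 1: "AE z in unif01. z \<in> cls y \<longleftrightarrow> z \<in> nb d x"
  proof (rule AE_iff_of_measure_eq)
    show "AE z in unif01. z \<in> cls y \<longrightarrow> z \<in> nb d x"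
      using cl[rule_format, OF vy(1)]
    proof (rule AE_mpI, intro impI)
      fix z assume a: "vtx z \<longrightarrow> W (x, y) \<noteq> 0 \<longrightarrow> W (y, z) \<noteq> 0 \<longrightarrow> chi W y z \<noteq> 0 \<longrightarrow> W (x, z) = 1"
        and z: "z \<in> cls y"
      then have "chi W y z \<noteq> 0" using chi_eq[of z y] k vy(3) by (auto simp: cls_def)
      with a z vy show "z \<in> nb d x" by (auto simp: cls_def nb_def)
    qed
  qed (use measure_cls[OF gy] measure_nb[OF x d] vy cls_sets nb_sets xs in auto)
  have 2: "AE z in unif01. z \<in> cls x \<longleftrightarrow> z \<in> nb (-d) y"
  proof (rule AE_iff_of_measure_eq)
    show "AE z in unif01. z \<in> cls x \<longrightarrow> z \<in> nb (-d) y"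
      using tw
    proof (rule AE_mpI, intro impI)
      fix z assume "z \<in> cls x \<longrightarrow> vtx y \<longrightarrow> W (z, y) = W (x, y)" and z: "z \<in> cls x"
      then have "W (z, y) = W (x, y)" using vy(1) by blast
      moreover have "W (y, z) = W (z, y)" using z vy(5) by (intro graphon_sym[OF W]) (auto simp: cls_def)
      ultimately show "z \<in> nb (-d) y" using z vy by (auto simp: cls_def nb_def)
    qed
  qed (use measure_cls[OF x] measure_nb[OF gy av] vy cls_sets nb_sets xs in auto)
  show thesis
  proof (rule that[OF gy vy(3,4)])
    show "AE z in unif01. z \<in> nb d x \<longleftrightarrow> z \<in> cls y" using 1 by eventually_elim blast
    show "AE z in unif01. z \<in> nb (-d) y \<longleftrightarrow> z \<in> cls x" using 2 by eventually_elim blast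
  qed
qed

section \<open>Strands and their marks\<close>

definition lk :: "real \<Rightarrow> real \<Rightarrow> bool" where
  "lk x y \<longleftrightarrow> good x \<and> good y \<and> lev y = lev x \<and> pos y = pos x + lev x \<and>
    (AE z in unif01. z \<in> nb 1 x \<longleftrightarrow> z \<in> cls y) \<and> (AE z in unif01. z \<in> nb (-1) y \<longleftrightarrow> z \<in> cls x)"

lemma lk_succ: assumes "good x" "mrk x = 1/2 \<or> pos x \<noteq> 1" obtains y where "lk x y"
proof -
  have av: "avail 1 x" using assms(2) unfolding avail_def by blast
  obtain y where y: "good y" "lev y = lev x" "pos y = pos x + 1 * lev x"
    "AE z in unif01. z \<in> nb 1 x \<longleftrightarrow> z \<in> cls y" "AE z in unif01. z \<in> nb (-1) y \<longleftrightarrow> z \<in> cls x"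
    by (rule neighbour[OF assms(1) av])
  have "lk x y" unfolding lk_def using assms(1) y by simp
  with that show thesis by blast
qed

lemma lk_pred: assumes "good y" "mrk y = 1/2 \<or> pos y \<noteq> 0" obtains x where "lk x y"
proof -
  have av: "avail (-1) y" using assms(2) unfolding avail_def by blast
  obtain x where x: "good x" "lev x = lev y" "pos x = pos y + (-1) * lev y"
    "AE z in unif01. z \<in> nb (-1) y \<longleftrightarrow> z \<in> cls x" "AE z in unif01. z \<in> nb (- (-1)) x \<longleftrightarrow> z \<in> cls y"
    by (rule neighbour[OF assms(1) av])
  have "lk x y" unfolding lk_def using assms(1) x by simp
  with that show thesis by blast
qed

text \<open>A vertex of mark 1/2 has neighbours on both sides, and at an end one of them would have
  its position outside the unit interval.\<close>

lemma mark_at_ends: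
  assumes "good x" "pos x = 0 \<or> pos x = 1" shows "mrk x \<noteq> 1/2"
proof
  assume m: "mrk x = 1/2"
  obtain y where y: "lk x y" by (rule lk_succ[OF assms(1)]) (use m in blast)
  obtain z where z: "lk z x" by (rule lk_pred[OF assms(1)]) (use m in blast)
  have "good y" "good z" "pos y = pos x + lev x" "pos x = pos z + lev z" "lev x = lev z"
    using y z by (auto simp: lk_def)
  then show False
    using assms(2) good_pos(2)[of y] good_pos(1)[of z] good_lev[OF assms(1)] by linarith
qed

text \<open>Positions grow by the fixed amount \<open>lev x\<close> but never exceed 1, and a vertex
  of any other position has a successor. So the path stops, and it can stop only at position exactly
  1. In particular, levels are forced to be reciprocals of integers on full strands.\<close>

lemma forward_path:
  assumes "good x"
  shows "\<exists>K X. X 0 = x \<and> (\<forall>j<K. lk (X j) (X (Suc j))) \<and> good (X K) \<and> pos (X K) = 1"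
proof -
  have "1 - pos x \<le> real n * lev x \<Longrightarrow> good x \<Longrightarrow>
    \<exists>K X. X 0 = x \<and> (\<forall>j<K. lk (X j) (X (Suc j))) \<and> good (X K) \<and> pos (X K) = 1" for n x
  proof (induction n arbitrary: x)
    case 0
    then have "pos x = 1" using good_pos[of x] by simp
    then show ?case using 0 by (intro exI[of _ "0::nat"] exI[of _ "\<lambda>_. x"]) auto
  next
    case (Suc n)
    show ?case
    proof (cases "pos x = 1")
      case True
      then show ?thesis using Suc by (intro exI[of _ "0::nat"] exI[of _ "\<lambda>_. x"]) auto
    next
      case False
      obtain y where y: "lk x y" by (rule lk_succ[OF Suc.prems(2)]) (use False in blast)
      then have "1 - pos y \<le> real n * lev y" "good y"
        using Suc.prems by (auto simp: lk_def algebra_simps)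
      from Suc.IH[OF this] obtain K X where X: "X 0 = y" "\<forall>j<K. lk (X j) (X (Suc j))" "good (X K)" "pos (X K) = 1"
        by blast
      show ?thesis
      proof (intro exI[of _ "Suc K"] exI[of _ "case_nat x X"] conjI allI impI)
        fix j assume "j < Suc K"
        then show "lk (case_nat x X j) (case_nat x X (Suc j))"
          using X y by (cases j) auto
      qed (use X in auto)
    qed
  qed
  moreover obtain n where "1 - pos x \<le> real n * lev x"
    using reals_Archimedean3[OF good_lev[OF assms]] by (meson less_imp_le)
  ultimately show ?thesis using assms by blast
qed

lemma backward_path:
  assumes "good x"
  shows "\<exists>K X. X K = x \<and> (\<forall>j<K. lk (X j) (X (Suc j))) \<and> good (X 0) \<and> pos (X 0) = 0"
proof -
  have "pos x \<le> real n * lev x \<Longrightarrow> good x \<Longrightarrow>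
    \<exists>K X. X K = x \<and> (\<forall>j<K. lk (X j) (X (Suc j))) \<and> good (X 0) \<and> pos (X 0) = 0" for n x
  proof (induction n arbitrary: x)
    case 0
    then have "pos x = 0" using good_pos[of x] by simp
    then show ?case using 0 by (intro exI[of _ "0::nat"] exI[of _ "\<lambda>_. x"]) auto
  next
    case (Suc n)
    show ?case
    proof (cases "pos x = 0")
      case True
      then show ?thesis using Suc by (intro exI[of _ "0::nat"] exI[of _ "\<lambda>_. x"]) auto
    next
      case False
      obtain y where y: "lk y x" by (rule lk_pred[OF Suc.prems(2)]) (use False in blast)
      then have "pos y \<le> real n * lev y" "good y"
        using Suc.prems by (auto simp: lk_def algebra_simps)
      from Suc.IH[OF this] obtain K X where X: "X K = y" "\<forall>j<K. lk (X j) (X (Suc j))" "good (X 0)" "pos (X 0) = 0"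
        by blast
      show ?thesis
      proof (intro exI[of _ "Suc K"] exI[of _ "X(Suc K := x)"] conjI allI impI)
        fix j assume "j < Suc K"
        then show "lk ((X(Suc K := x)) j) ((X(Suc K := x)) (Suc j))"
          using X y by (cases "j = K") auto
      qed (use X in auto)
    qed
  qed
  moreover obtain n where "pos x \<le> real n * lev x"
    using reals_Archimedean3[OF good_lev[OF assms]] by (meson less_imp_le)
  ultimately show ?thesis using assms by blast
qed

definition strand :: "nat \<Rightarrow> (nat \<Rightarrow> real) \<Rightarrow> bool" where
  "strand K X \<longleftrightarrow> (\<forall>j<K. lk (X j) (X (Suc j))) \<and> (\<forall>j\<le>K. good (X j)) \<and> pos (X 0) = 0 \<and> pos (X K) = 1"

lemma path_labels:
  assumes "\<forall>j<K. lk (X j) (X (Suc j))" "j \<le> K"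
  shows "lev (X j) = lev (X 0) \<and> pos (X j) = pos (X 0) + real j * lev (X 0)"
  using assms(2)
proof (induction j)
  case (Suc j)
  then show ?case using assms(1) by (auto simp: lk_def algebra_simps)
qed simp

lemma path_good: "\<forall>j<K. lk (X j) (X (Suc j)) \<Longrightarrow> good (X 0) \<Longrightarrow> j \<le> K \<Longrightarrow> good (X j)"
  by (cases j) (auto simp: lk_def)

lemma strand_labels:
  assumes "strand K X"
  shows "j \<le> K \<Longrightarrow> lev (X j) = lev (X 0)" "j \<le> K \<Longrightarrow> pos (X j) = real j * lev (X 0)"
    "real K * lev (X 0) = 1"
  using assms path_labels[of K X j] path_labels[of K X K] by (auto simp: strand_def)

lemma strand_mark: assumes "strand K X" "1 \<le> j" "j < K" shows "mrk (X j) = 1/2"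
proof (rule ccontr)
  assume m: "mrk (X j) \<noteq> 1/2"
  have g: "good (X j)" "good (X 0)" using assms by (auto simp: strand_def)
  have k: "0 < lev (X 0)" using good_lev[OF g(2)] .
  have "real j * lev (X 0) < real K * lev (X 0)" "0 < real j * lev (X 0)" using assms k by auto
  moreover have "pos (X j) = real j * lev (X 0)"
    by (rule strand_labels(2)[OF assms(1)]) (use assms in simp)
  ultimately show False using good_end[OF g(1) m] strand_labels(3)[OF assms(1)] by linarith
qed

lemma good_ex: "\<exists>x. good x"
proof (rule ccontr)
  assume no: "\<nexists>x. good x"
  have "AE x in unif01. (ind W 0 x)\<^sup>2 * lev x = 0"
    using ind_AE good_AE label_range_AE[of 1, simplified]
  proof eventually_elim
    case (elim x)
    then show ?case using no by (cases "vtx x") auto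
  qed
  then have "(\<integral>x. (ind W 0 x)\<^sup>2 * lev x \<partial>unif01) = 0" by (rule integral_eq_zero_AE)
  then show False using structured by (simp add: structured_def ex_pos_def)
qed

text \<open>Otherwise the integrand of \<open>ex_next\<close> would vanish almost everywhere,
  against the positive value of its integral.\<close>

lemma next_level:
  assumes x: "good x" "mrk x \<noteq> 1/2"
  obtains y where "good y" "lev y = lev x / 2" "pos y = of_bool \<alpha>" "mrk y = of_bool \<beta>"
proof -
  let ?f = "\<lambda>y. (ind W 0 y)\<^sup>2 * (W (x, y) * ((lev x - lev y) * (2 * lev x - lev y) *
      (select \<alpha> (pos y) * select \<beta> (mrk y))))"
  have k: "0 < lev x" using good_lev[OF x(1)] .
  have "\<exists>y. good y \<and> lev y = lev x / 2 \<and> pos y = of_bool \<alpha> \<and> mrk y = of_bool \<beta>"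
  proof (rule ccontr)
    assume no: "\<not> ?thesis"
    have "AE y in unif01. ?f y = 0"
      using ind_AE good_AE good_edge[OF x(1)]
    proof eventually_elim
      case (elim y)
      show ?case
      proof (rule ccontr)
        assume nz: "?f y \<noteq> 0"
        then have y: "vtx y" "W (x, y) \<noteq> 0" "lev y \<noteq> lev x" "lev y \<noteq> 2 * lev x"
          "select \<alpha> (pos y) \<noteq> 0" "select \<beta> (mrk y) \<noteq> 0"
          using elim(1) by (auto split: if_splits)
        then have e: "edge_rule x y" using elim by blast
        then have "lev y = lev x / 2" "mrk y = 0 \<or> mrk y = 1"
          using k y by (auto elim: edge_cases)
        moreover from this have g: "good y" using elim y k by auto
        moreover have "pos y = 0 \<or> pos y = 1"
          using good_end[OF g] calculation by auto
        ultimately have "pos y = of_bool \<alpha>" "mrk y = of_bool \<beta>"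
          using y(5,6) by (auto simp: select_def split: if_splits)
        with no g \<open>lev y = lev x / 2\<close> show False by blast
      qed
    qed
    then have "(\<integral>y. ?f y \<partial>unif01) = 0" by (rule integral_eq_zero_AE)
    with good_next[OF x(1), of \<alpha> \<beta>] x(2) k show False by simp
  qed
  with that show thesis by blast
qed

text \<open>The start is the endpoint of any forward path, which has a mark other than 1/2; from
  there on \<open>next_level\<close> halves the level.\<close>

lemma small_level: "\<exists>x. good x \<and> mrk x \<noteq> 1/2 \<and> lev x \<le> 1 / 2 ^ n"
proof (induction n)
  case 0
  obtain x where "good x" using good_ex by blast
  then obtain K X where X: "X 0 = x" "\<forall>j<K. lk (X j) (X (Suc j))" "good (X K)" "pos (X K) = 1"
    using forward_path by blast
  then show ?case
    using mark_at_ends[OF X(3)] good_range[OF X(3), of 1] by auto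
next
  case (Suc n)
  then obtain x where x: "good x" "mrk x \<noteq> 1/2" "lev x \<le> 1 / 2 ^ n" by blast
  obtain y where "good y" "lev y = lev x / 2" "pos y = of_bool True" "mrk y = of_bool True"
    by (rule next_level[OF x(1,2)])
  with x show ?case by (intro exI[of _ y]) auto
qed

lemma forward_strand:
  assumes "good x" "pos x = 0" obtains K X where "strand K X" "X 0 = x"
proof -
  obtain K X where X: "X 0 = x" "\<forall>j<K. lk (X j) (X (Suc j))" "good (X K)" "pos (X K) = 1"
    using forward_path[OF assms(1)] by blast
  then have "strand K X" using assms path_good[OF X(2)] by (auto simp: strand_def)
  with X that show thesis by blast
qed

lemma backward_strand:
  assumes "good x" "pos x = 1" obtains K X where "strand K X" "X K = x"
proof -
  obtain K X where X: "X K = x" "\<forall>j<K. lk (X j) (X (Suc j))" "good (X 0)" "pos (X 0) = 0"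
    using backward_path[OF assms(1)] by blast
  then have "strand K X" using assms path_good[OF X(2)] by (auto simp: strand_def)
  with X that show thesis by blast
qed

lemma strand_length:
  assumes "strand K X" "strand L Y" "lev (X 0) = lev (Y 0)" shows "K = L"
proof -
  have "real K * lev (X 0) = real L * lev (X 0)" using strand_labels(3)[OF assms(1)] strand_labels(3)[OF assms(2)] assms(3) by simp
  moreover have "lev (X 0) \<noteq> 0" using strand_labels(3)[OF assms(1)] by auto
  ultimately show ?thesis by simp
qed

lemma strand_ends:
  assumes "strand K X" shows "mrk (X 0) = 0 \<or> mrk (X 0) = 1" "mrk (X K) = 0 \<or> mrk (X K) = 1"
  using assms good_mark[of "X 0"] good_mark[of "X K"] mark_at_ends[of "X 0"] mark_at_ends[of "X K"]
  by (auto simp: strand_def)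

text \<open>\<open>X\<close> and \<open>Y\<close> start with the marks 0 and 1. If they end with the
  same mark, a third strand \<open>Z\<close> is traced back from an end with the other mark. It ends
  unlike both and starts unlike one of them, and this one is its partner. All strands have the same
  level and hence the same length.\<close>

lemma strand_pair:
  obtains K A B where "n < K" "strand K A" "strand K B" "lev (A 0) = lev (B 0)"
    "mrk (A 0) \<noteq> mrk (B 0)" "mrk (A K) \<noteq> mrk (B K)"
proof -
  obtain x where x: "good x" "mrk x \<noteq> 1/2" "lev x \<le> 1 / 2 ^ n" using small_level by blast
  define k where "k = lev x / 2"
  have nx: "\<exists>y. good y \<and> lev y = k \<and> pos y = of_bool \<alpha> \<and> mrk y = of_bool \<beta>" for \<alpha> \<beta>
    unfolding k_def by (rule next_level[OF x(1,2), of \<alpha> \<beta>]) blast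
  obtain y0 where y0: "good y0" "lev y0 = k" "pos y0 = 0" "mrk y0 = 0"
    using nx[of False False] by auto
  obtain y1 where y1: "good y1" "lev y1 = k" "pos y1 = 0" "mrk y1 = 1"
    using nx[of False True] by auto
  obtain K X where X: "strand K X" "X 0 = y0" by (rule forward_strand[OF y0(1,3)])
  obtain L Y where Y': "strand L Y" "Y 0 = y1" by (rule forward_strand[OF y1(1,3)])
  have Y: "strand K Y" "Y 0 = y1" using strand_length[OF X(1) Y'(1)] X Y' y0 y1 by auto
  have K: "n < K"
  proof -
    have "real K * k = 1" using strand_labels(3)[OF X(1)] X y0 by simp
    moreover have "k \<le> 1 / 2 ^ n" "0 < k" using x good_lev[OF x(1)] by (auto simp: k_def)
    ultimately have "1 \<le> real K * (1 / 2 ^ n)" by (metis mult_left_mono of_nat_0_le_iff)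
    then have "2 ^ n \<le> real K" by (simp add: field_simps)
    moreover have "real n < 2 ^ n" by (rule of_nat_less_two_power)
    ultimately show ?thesis by linarith
  qed
  show thesis
  proof (cases "mrk (X K) = mrk (Y K)")
    case False
    then show thesis using that[OF K X(1) Y(1)] X Y y0 y1 by simp
  next
    case True
    \<comment> \<open>The previous level sees ends of both marks at position 1, in particular one
      whose mark is not that of \<open>X K\<close>.\<close>
    have "\<exists>z. good z \<and> lev z = k \<and> pos z = 1 \<and> mrk z \<noteq> mrk (X K)"
    proof (cases "mrk (X K) = 0")
      case True then show ?thesis using nx[of True True] by auto
    next
      case False then show ?thesis using nx[of True False] by auto
    qed
    then obtain z where z: "good z" "lev z = k" "pos z = 1" "mrk z \<noteq> mrk (X K)" by blast
    obtain M Z where Z': "strand M Z" "Z M = z" by (rule backward_strand[OF z(1,3)])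
    have "lev (Z 0) = k" using strand_labels(1)[OF Z'(1), of M] Z' z by simp
    then have Z: "strand K Z" "Z K = z" "lev (Z 0) = k"
      using strand_length[OF X(1) Z'(1)] X Z' y0 by auto
    show thesis
    proof (cases "mrk (Z 0) = mrk (X 0)")
      case True
      then show thesis using that[OF K Y(1) Z(1)] X Y Z y0 y1 z \<open>mrk (X K) = mrk (Y K)\<close> by simp
    next
      case False
      then show thesis using that[OF K X(1) Z(1)] X Z y0 z by simp
    qed
  qed
qed

end

subsection \<open>Counting strands by their marks\<close>

text \<open>The integral of \<open>Strands n\<close> adds up, over the strands with \<open>n + 1\<close> atoms, the product of
  \<open>mark - 1/2\<close> over the two ends; crossing two strands whose marks differ at both ends reverses
  the signs of their products.\<close>

primrec Path :: "nat \<Rightarrow> nat \<Rightarrow> expr" where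
  "Path 0 i = BB i \<ominus> Const (1/2)"
| "Path (Suc n) i = Integ (Suc i) (VV (Suc i) \<odot> (Edge (Suc i) i \<odot> (Fstep (Suc i) i \<odot> Path n (Suc i))))"

primrec path :: "(real \<times> real \<Rightarrow> real) \<Rightarrow> nat \<Rightarrow> real \<Rightarrow> real" where
  "path W 0 t = lab W 3 t - 1/2"
| "path W (Suc n) t = (\<integral>s. (ind W 0 s)\<^sup>2 * (W (s, t) * (fstep W s t * path W n s)) \<partial>unif01)"

text \<open>The mark minus 1/2 vanishes at interior atoms and the position vanishes at the first
  atom of a strand, so only paths to the last atom contribute.\<close>

definition Strands :: "nat \<Rightarrow> expr" where
  "Strands n = VV 0 \<odot> (Path n 0 \<odot> ((BB 0 \<ominus> Const (1/2)) \<odot> RR 0))"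

lemma Path_simps [simp]:
  "fv (Path n i) = {i}" "free_edges (Path n i) = {}" "simple (Path n i)"
proof -
  have "fv (Path n i) = {i} \<and> free_edges (Path n i) = {} \<and> simple (Path n i)"
    by (induction n arbitrary: i) auto
  then show "fv (Path n i) = {i}" "free_edges (Path n i) = {}" "simple (Path n i)" by auto
qed

lemma eval_Path [simp]: "eval W (Path n i) x = path W n (x i)"
  by (induction n arbitrary: i x) auto

lemma path_measurable:
  assumes "graphon W" shows "path W n \<in> borel_measurable unif01"
proof -
  have "(\<lambda>t. eval W (Path n 0) ((\<lambda>_. 0)(0 := t))) \<in> borel_measurable unif01"
    by (rule eval_section_measurable[OF assms]) simp
  then show ?thesis by (simp cong: measurable_cong)
qed

lemma strands_integrable:
  assumes "graphon W"
  shows "integrable unif01 (\<lambda>t. (ind W 0 t)\<^sup>2 * (path W n t * ((lab W 3 t - 1/2) * lab W 2 t)))"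
proof -
  have "integrable unif01 (\<lambda>t. eval W (Strands n) ((\<lambda>_. 0)(0 := t)))"
    by (rule eval_section_integrable[OF assms]) (auto simp: Strands_def)
  then show ?thesis by (simp add: Strands_def)
qed

locale crossing_strands = structured_graphon +
  fixes K :: nat and A B :: "nat \<Rightarrow> real"
  assumes K2: "2 \<le> K" and A: "strand K A" and B: "strand K B" and lev_AB: "lev (A 0) = lev (B 0)"
    and start: "mrk (A 0) \<noteq> mrk (B 0)" and finish: "mrk (A K) \<noteq> mrk (B K)"
begin

definition X :: "bool \<Rightarrow> nat \<Rightarrow> real" where "X s = (if s then A else B)"

definition k :: real where "k = lev (A 0)"

text \<open>The atoms of \<open>B\<close> are diminished by those of \<open>A\<close> so that the
  sets are disjoint pointwise; by \<open>AB_null\<close> only null sets are lost.\<close>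

definition U :: "nat \<Rightarrow> bool \<Rightarrow> real set" where
  "U j s = (if j \<le> K then (if s then cls (A j) else cls (B j) - cls (A j)) else {})"

lemma strand_X: "strand K (X s)"
  using A B by (simp add: X_def)

lemma good_X: "j \<le> K \<Longrightarrow> good (X s j)"
  using strand_X[of s] by (simp add: strand_def)

lemma lk_X: "j < K \<Longrightarrow> lk (X s j) (X s (Suc j))"
  using strand_X[of s] by (simp add: strand_def)

lemma lev_X0: "lev (X s 0) = k"
  using lev_AB by (cases s) (simp_all add: X_def k_def)

lemma lev_X: "j \<le> K \<Longrightarrow> lev (X s j) = k"
  by (rule trans[OF strand_labels(1)[OF strand_X] lev_X0])

lemma pos_X: "j \<le> K \<Longrightarrow> pos (X s j) = real j * k"
  using strand_labels(2)[OF strand_X[of s], of j] unfolding lev_X0 .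

lemma K_k: "real K * k = 1"
  using strand_labels(3)[OF strand_X[of True]] unfolding lev_X0 .

lemma k_pos: "0 < k"
  using good_lev[OF good_X[of 0 True]] lev_X[of 0 True] by simp

lemma in_cls:
  assumes "z \<in> cls (X s j)" "j \<le> K"
  shows "z \<in> {0..<1}" "vtx z" "lev z = k" "pos z = real j * k" "mrk z = mrk (X s j)"
  using assms lev_X[of j s] pos_X[of j s] by (auto simp: cls_def)

lemma U_cls: "z \<in> U j s \<Longrightarrow> j \<le> K \<and> z \<in> cls (X s j)"
  by (auto simp: U_def X_def split: if_splits)

lemma in_U:
  assumes "z \<in> U j s"
  shows "j \<le> K" "z \<in> {0..<1}" "vtx z" "lev z = k" "pos z = real j * k" "mrk z = mrk (X s j)"
  using U_cls[OF assms] in_cls[of z s j] by auto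

lemma U_sets [measurable]: "U j s \<in> sets unif01"
proof (cases "j \<le> K")
  case True
  then have "cls (X s j) \<in> sets unif01" for s using cls_sets[OF good_space[OF good_X]] by blast
  from this[of True] this[of False] show ?thesis by (auto simp: U_def X_def)
qed (simp add: U_def)

lemma U_disj: "z \<in> U j s \<Longrightarrow> z \<in> U j' s' \<Longrightarrow> j = j' \<and> s = s'"
proof -
  assume z: "z \<in> U j s" "z \<in> U j' s'"
  have "real j * k = real j' * k" using in_U(5)[OF z(1)] in_U(5)[OF z(2)] by linarith
  then have "j = j'" using k_pos by simp
  moreover from this z have "s = s'" by (cases s; cases s') (auto simp: U_def split: if_splits)
  ultimately show ?thesis by simp
qed

text \<open>A typical common point of the two atoms is a twin of both \<open>x\<close> and
  \<open>y\<close>.\<close>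

lemma overlap_twin:
  assumes x: "good x" and y: "good y" and "0 < measure unif01 (cls x \<inter> cls y)"
  shows "AE z in unif01. vtx z \<longrightarrow> W (x, z) = W (y, z)"
proof -
  from cls_twin[OF x] cls_twin[OF y]
  have AE: "AE w in unif01. w \<in> cls x \<inter> cls y \<longrightarrow> (AE z in unif01. vtx z \<longrightarrow> W (w, z) = W (x, z)) \<and>
      (AE z in unif01. vtx z \<longrightarrow> W (w, z) = W (y, z))"
    by eventually_elim simp
  have "cls x \<inter> cls y \<in> sets unif01"
    by (intro sets.Int cls_sets good_space x y)
  from measure_pos_ex[OF assms(3) this AE] obtain w where
    w: "w \<in> cls x \<inter> cls y" "w \<in> cls x \<inter> cls y \<longrightarrow> (AE z in unif01. vtx z \<longrightarrow> W (w, z) = W (x, z)) \<and>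
      (AE z in unif01. vtx z \<longrightarrow> W (w, z) = W (y, z))" .
  then have "AE z in unif01. vtx z \<longrightarrow> W (w, z) = W (x, z)" "AE z in unif01. vtx z \<longrightarrow> W (w, z) = W (y, z)"
    by simp_all
  then show ?thesis by eventually_elim simp
qed

text \<open>The first atoms are disjoint because their marks differ. If the atoms at
  \<open>Suc j\<close> overlapped, \<open>A (Suc j)\<close> and \<open>B (Suc j)\<close> would be
  twins and have the same predecessors. Then the atoms at \<open>j\<close> would coincide up to a
  null set, although their intersection is null and their mass is positive.\<close>

lemma AB_null: "j \<le> K \<Longrightarrow> measure unif01 (cls (A j) \<inter> cls (B j)) = 0"
proof (induction j)
  case 0
  have "cls (A 0) \<inter> cls (B 0) = {}" using start by (auto simp: cls_def)
  then show ?case by simp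
next
  case (Suc j)
  show ?case
  proof (rule ccontr)
    assume "measure unif01 (cls (A (Suc j)) \<inter> cls (B (Suc j))) \<noteq> 0"
    then have "0 < measure unif01 (cls (A (Suc j)) \<inter> cls (B (Suc j)))"
      by (simp add: zero_less_measure_iff)
    from overlap_twin[OF _ _ this]
    have "AE z in unif01. vtx z \<longrightarrow> W (A (Suc j), z) = W (B (Suc j), z)"
      using good_X[of "Suc j" True] good_X[of "Suc j" False] Suc.prems by (simp add: X_def)
    moreover have "lk (A j) (A (Suc j))" "lk (B j) (B (Suc j))"
      using lk_X[of j True] lk_X[of j False] Suc.prems by (auto simp: X_def)
    then have "AE z in unif01. z \<in> nb (-1) (A (Suc j)) \<longleftrightarrow> z \<in> cls (A j)"
      "AE z in unif01. z \<in> nb (-1) (B (Suc j)) \<longleftrightarrow> z \<in> cls (B j)" by (auto simp: lk_def)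
    ultimately have "AE z in unif01. z \<in> cls (A j) \<longleftrightarrow> z \<in> cls (A j) \<inter> cls (B j)"
    proof eventually_elim
      case (elim z)
      have "lev (A (Suc j)) = lev (B (Suc j))" "pos (A (Suc j)) = pos (B (Suc j))"
        using lev_X[of "Suc j" True] lev_X[of "Suc j" False] pos_X[of "Suc j" True] pos_X[of "Suc j" False]
          Suc.prems by (auto simp: X_def)
      then have "z \<in> nb (-1) (A (Suc j)) \<longleftrightarrow> z \<in> nb (-1) (B (Suc j))"
        using elim(1) by (auto simp: nb_def)
      with elim show ?case by auto
    qed
    moreover have cs: "cls (A j) \<in> sets unif01" "cls (B j) \<in> sets unif01"
      using cls_sets good_space[OF good_X[of j True]] good_space[OF good_X[of j False]] Suc.prems
      by (auto simp: X_def)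
    ultimately have "measure unif01 (cls (A j)) = measure unif01 (cls (A j) \<inter> cls (B j))"
      by (intro unif01.finite_measure_eq_AE) auto
    also have "\<dots> = 0" using Suc by simp
    finally show False
      using measure_cls[OF good_X[of j True]] atom_mass_pos[OF k_pos] lev_X[of j True] Suc.prems
      by (simp add: X_def)
  qed
qed

lemma U_cls_AE: "j \<le> K \<Longrightarrow> AE z in unif01. z \<in> U j s \<longleftrightarrow> z \<in> cls (X s j)"
proof (cases s)
  case True
  then show "j \<le> K \<Longrightarrow> ?thesis" by (simp add: U_def X_def)
next
  case False
  assume j: "j \<le> K"
  have "cls (A j) \<in> sets unif01" "cls (B j) \<in> sets unif01"
    using cls_sets good_space[OF good_X[of j True]] good_space[OF good_X[of j False]] j
    by (auto simp: X_def)
  then have "AE z in unif01. z \<notin> cls (A j) \<inter> cls (B j)"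
    using AB_null[OF j] by (subst unif01.prob_eq_0[symmetric]) auto
  then show ?thesis by eventually_elim (use False j in \<open>auto simp: U_def X_def\<close>)
qed

lemma all_U_cls_AE: "AE z in unif01. \<forall>j\<le>K. \<forall>s. z \<in> U j s \<longleftrightarrow> z \<in> cls (X s j)"
proof -
  have "AE z in unif01. \<forall>p\<in>{..K} \<times> UNIV. z \<in> U (fst p) (snd p) \<longleftrightarrow> z \<in> cls (X (snd p) (fst p))"
    using U_cls_AE by (intro AE_ball_countable[THEN iffD2] ballI countable_finite) auto
  then show ?thesis by eventually_elim auto
qed

lemma U_mass: "j \<le> K \<Longrightarrow> measure unif01 (U j s) = atom_mass k"
proof -
  assume j: "j \<le> K"
  have "measure unif01 (U j s) = measure unif01 (cls (X s j))"
    using U_cls_AE[OF j] cls_sets[OF good_space[OF good_X[OF j]]]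
    by (intro unif01.finite_measure_eq_AE) auto
  then show ?thesis using measure_cls[OF good_X[OF j]] lev_X[OF j] by simp
qed

lemma U_twin: "AE x in unif01. x \<in> U j s \<longrightarrow> good x \<and>
    (AE z in unif01. vtx z \<longrightarrow> W (x, z) = W (X s j, z))"
proof (cases "j \<le> K")
  case True
  from good_AE cls_twin[OF good_X[OF True]] show ?thesis
    by eventually_elim (use in_U U_cls k_pos in fastforce)
qed (simp add: U_def)

lemma next_AE': "j < K \<Longrightarrow> AE z in unif01. z \<in> nb 1 (X s j) \<longleftrightarrow> z \<in> U (Suc j) s"
proof -
  assume j: "j < K"
  from lk_X[OF j, of s] have "AE z in unif01. z \<in> nb 1 (X s j) \<longleftrightarrow> z \<in> cls (X s (Suc j))"
    by (simp add: lk_def)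
  with all_U_cls_AE show ?thesis by eventually_elim (use j in auto)
qed

lemma prev_AE: "j < K \<Longrightarrow> AE z in unif01. z \<in> nb (-1) (X s (Suc j)) \<longleftrightarrow> z \<in> U j s"
proof -
  assume j: "j < K"
  from lk_X[OF j, of s] have "AE z in unif01. z \<in> nb (-1) (X s (Suc j)) \<longleftrightarrow> z \<in> cls (X s j)"
    by (simp add: lk_def)
  with all_U_cls_AE show ?thesis by eventually_elim (use j in auto)
qed

lemma forward_AE:
  assumes "j < K"
  shows "AE x in unif01. x \<in> U j s \<longrightarrow> (AE z in unif01. z \<in> nb 1 x \<longleftrightarrow> z \<in> U (Suc j) s)"
  using U_twin[of j s]
proof (rule AE_mpI, intro impI)
  fix x assume "x \<in> U j s \<longrightarrow> good x \<and> (AE z in unif01. vtx z \<longrightarrow> W (x, z) = W (X s j, z))" and x: "x \<in> U j s"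
  then have "AE z in unif01. vtx z \<longrightarrow> W (x, z) = W (X s j, z)" by blast
  with next_AE'[OF assms, of s] show "AE z in unif01. z \<in> nb 1 x \<longleftrightarrow> z \<in> U (Suc j) s"
  proof eventually_elim
    case (elim z)
    then show ?case using in_U[OF x] lev_X[of j s] pos_X[of j s] by (auto simp: nb_def)
  qed
qed

lemma backward_AE:
  assumes "j < K"
  shows "AE x in unif01. x \<in> U (Suc j) s \<longrightarrow> (AE z in unif01. z \<in> nb (-1) x \<longleftrightarrow> z \<in> U j s)"
  using U_twin[of "Suc j" s]
proof (rule AE_mpI, intro impI)
  fix x assume "x \<in> U (Suc j) s \<longrightarrow> good x \<and> (AE z in unif01. vtx z \<longrightarrow> W (x, z) = W (X s (Suc j), z))"
    and x: "x \<in> U (Suc j) s"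
  then have "AE z in unif01. vtx z \<longrightarrow> W (x, z) = W (X s (Suc j), z)" by blast
  with prev_AE[OF assms, of s] show "AE z in unif01. z \<in> nb (-1) x \<longleftrightarrow> z \<in> U j s"
  proof eventually_elim
    case (elim z)
    then show ?case using in_U[OF x] lev_X[of "Suc j" s] pos_X[of "Suc j" s] by (auto simp: nb_def)
  qed
qed

lemma edge_forward_AE:
  assumes "j < K"
  shows "AE x in unif01. x \<in> U j s \<longrightarrow> (AE z in unif01. \<forall>s'. z \<in> U (Suc j) s' \<longrightarrow> W (x, z) = of_bool (s = s'))"
  using forward_AE[OF assms, of s] U_twin[of j s]
proof eventually_elim
  case (elim x)
  show ?case
  proof
    assume x: "x \<in> U j s"
    with elim have g: "good x" and nb: "AE z in unif01. z \<in> nb 1 x \<longleftrightarrow> z \<in> U (Suc j) s" by auto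
    from good_zero_one[OF g] nb show "AE z in unif01. \<forall>s'. z \<in> U (Suc j) s' \<longrightarrow> W (x, z) = of_bool (s = s')"
    proof eventually_elim
      case (elim z)
      show ?case
      proof (intro allI impI)
        fix s' assume z: "z \<in> U (Suc j) s'"
        have "z \<in> nb 1 x \<longleftrightarrow> W (x, z) \<noteq> 0"
          using in_U[OF z] in_U[OF x] by (auto simp: nb_def algebra_simps)
        moreover have "z \<in> U (Suc j) s \<longleftrightarrow> s = s'" using z U_disj[OF z, of "Suc j" s] by auto
        ultimately show "W (x, z) = of_bool (s = s')" using elim in_U(3)[OF z] by auto
      qed
    qed
  qed
qed

lemma edge_backward_AE:
  assumes "j < K"
  shows "AE x in unif01. x \<in> U (Suc j) s \<longrightarrow> (AE z in unif01. \<forall>s'. z \<in> U j s' \<longrightarrow> W (x, z) = of_bool (s = s'))"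
  using backward_AE[OF assms, of s] U_twin[of "Suc j" s]
proof eventually_elim
  case (elim x)
  show ?case
  proof
    assume x: "x \<in> U (Suc j) s"
    with elim have g: "good x" and nb: "AE z in unif01. z \<in> nb (-1) x \<longleftrightarrow> z \<in> U j s" by auto
    from good_zero_one[OF g] nb show "AE z in unif01. \<forall>s'. z \<in> U j s' \<longrightarrow> W (x, z) = of_bool (s = s')"
    proof eventually_elim
      case (elim z)
      show ?case
      proof (intro allI impI)
        fix s' assume z: "z \<in> U j s'"
        have "z \<in> nb (-1) x \<longleftrightarrow> W (x, z) \<noteq> 0"
          using in_U[OF z] in_U[OF x] by (auto simp: nb_def algebra_simps)
        moreover have "z \<in> U j s \<longleftrightarrow> s = s'" using z U_disj[OF z, of j s] by auto
        ultimately show "W (x, z) = of_bool (s = s')" using elim in_U(3)[OF z] by auto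
      qed
    qed
  qed
qed

text \<open>At mark 1/2 the last clause of \<open>good_mark\<close>'s companion
  \<open>good_lab4\<close> is a linear equation for the fourth label, with the nonzero coefficient
  \<open>1 + lev x\<close>.\<close>

lemma lab4_eq:
  assumes "good x" "good y" "mrk x = 1/2" "mrk y = 1/2" "lev x = lev y" "pos x = pos y"
  shows "lab W 4 x = lab W 4 y"
proof -
  have "(1 + lev y) * (lab W 4 x - 1 + 1/4 * (lev y + pos y + 1/2)) + 3/8 * (lev y)\<^sup>2 =
    (1 + lev y) * (lab W 4 y - 1 + 1/4 * (lev y + pos y + 1/2)) + 3/8 * (lev y)\<^sup>2"
    using good_lab4[OF assms(1,3)] good_lab4[OF assms(2,4)] assms(3-6) by simp
  then have "(1 + lev y) * (lab W 4 x - 1 + 1/4 * (lev y + pos y + 1/2)) =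
    (1 + lev y) * (lab W 4 y - 1 + 1/4 * (lev y + pos y + 1/2))" by (rule add_right_imp_eq)
  moreover have "1 + lev y \<noteq> 0" using good_lev[OF assms(2)] by simp
  ultimately have "lab W 4 x - 1 + 1/4 * (lev y + pos y + 1/2) = lab W 4 y - 1 + 1/4 * (lev y + pos y + 1/2)"
    by (simp only: mult_left_cancel not_False_eq_True)
  then show ?thesis by simp
qed

text \<open>Both atoms of an interior position have the same labels, so the row off the strands can
  be written with the labels of \<open>A\<close>. Towards class 0 it is 0.\<close>

definition h :: "nat \<Rightarrow> real \<Rightarrow> real" where
  "h j y = (if j \<le> K then
    (if vtx y then 0 else if deg W y = class_degree 1 then lab W 1 (A j)
     else if deg W y = class_degree 2 then lab W 2 (A j) else if deg W y = class_degree 3 then lab W 3 (A j)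
     else if deg W y = class_degree 4 then lab W 4 (A j) else 0) else 0)"

text \<open>An interior vertex has mark 1/2, which excludes neighbours of other levels. So within
  class 0 it sees exactly its own atom, the next one and the previous one; its values towards the
  markers are its labels.\<close>

lemma interior_AE:
  assumes j: "1 \<le> j" "j < K"
  shows "AE x in unif01. x \<in> U j s \<longrightarrow> (AE y in unif01. W (x, y) =
    (if \<exists>j'\<le>K. \<exists>s'. y \<in> U j' s' then of_bool (\<exists>j'\<le>K. y \<in> U j' s \<and> adjacent j j') else h j y))"
proof -
  obtain i where i: "j = Suc i" using j by (cases j) auto
  have iK: "i < K" using j i by simp
  from U_twin[of j s] forward_AE[OF j(2), of s] backward_AE[OF iK, of s, folded i]
  show ?thesis
  proof eventually_elim
    case (elim x)
    show ?case
    proof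
      assume x: "x \<in> U j s"
      with elim have g: "good x" and tw: "AE z in unif01. vtx z \<longrightarrow> W (x, z) = W (X s j, z)"
        and fw: "AE z in unif01. z \<in> nb 1 x \<longleftrightarrow> z \<in> U (Suc j) s"
        and bw: "AE z in unif01. z \<in> nb (-1) x \<longleftrightarrow> z \<in> U i s" by auto
      have m: "mrk x = 1/2" using in_U(6)[OF x] strand_mark[OF strand_X j] by simp
      have jK: "j \<le> K" using j by simp
      have gX: "good (X s j)" "mrk (X s j) = 1/2" using good_X[OF jK] strand_mark[OF strand_X j] by auto
      have gA: "good (A j)" "mrk (A j) = 1/2" "lev (A j) = k" "pos (A j) = real j * k"
        using good_X[OF jK, of True] strand_mark[OF A j] lev_X[OF jK, of True] pos_X[OF jK, of True]
        by (auto simp: X_def)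
      have labs: "lab W c x = lab W c (A j)" if "c \<in> {1, 2, 3, 4}" for c
        using that in_U[OF x] gA m lab4_eq[OF g gA(1) m gA(2)] by auto
      have twin: "AE q in unif01. \<forall>c\<in>{1, 2, 3, 4}. deg W q = class_degree c \<longrightarrow> W (x, q) = lab W c x"
        using good_twin[OF g] by (intro AE_ball_countable[THEN iffD2] ballI countable_finite) auto
      from good_edge[OF gX(1)] good_zero_one[OF g] tw fw bw all_U_cls_AE class_AE twin AE_space
      show "AE y in unif01. W (x, y) =
        (if \<exists>j'\<le>K. \<exists>s'. y \<in> U j' s' then of_bool (\<exists>j'\<le>K. y \<in> U j' s \<and> adjacent j j') else h j y)"
      proof eventually_elim
        case (elim y)
        have ys: "y \<in> {0..<1}" using elim(9) by simp
        show ?case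
        proof (cases "vtx y")
          case True
          have "W (x, y) \<noteq> 0 \<longleftrightarrow> (\<exists>j'\<le>K. y \<in> U j' s \<and> adjacent j j')"
          proof
            assume nz: "W (x, y) \<noteq> 0"
            then have nz': "W (X s j, y) \<noteq> 0" using elim(3) True by simp
            then have e: "edge_rule (X s j) y" using elim(1) True by blast
            have "0 < lev (X s j)" using k_pos lev_X[OF jK] by simp
            with e show "\<exists>j'\<le>K. y \<in> U j' s \<and> adjacent j j'"
            proof (cases rule: edge_cases)
              case 1
              then have "y \<in> cls (X s j)" using nz' ys True by (simp add: cls_def)
              then have "y \<in> U j s" using elim(6) jK by blast
              then show ?thesis using jK by (intro exI[of _ j]) (auto simp: adjacent_def)
            next
              case 2
              then have "y \<in> nb 1 x" using nz ys True in_U[OF x] lev_X[OF jK] pos_X[OF jK] by (simp add: nb_def)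
              then have "y \<in> U (Suc j) s" using elim(4) by blast
              then show ?thesis using j by (intro exI[of _ "Suc j"]) (auto simp: adjacent_def)
            next
              case 3
              then have "y \<in> nb (-1) x" using nz ys True in_U[OF x] lev_X[OF jK] pos_X[OF jK] by (simp add: nb_def)
              then have "y \<in> U i s" using elim(5) by blast
              then show ?thesis using j i by (intro exI[of _ i]) (auto simp: adjacent_def)
            qed (use gX in auto)
          next
            assume "\<exists>j'\<le>K. y \<in> U j' s \<and> adjacent j j'"
            then obtain j' where j': "j' \<le> K" "y \<in> U j' s" "adjacent j j'" by blast
            then have "j' = j \<or> j' = Suc j \<or> j' = i" using i by (auto simp: adjacent_def)
            then show "W (x, y) \<noteq> 0"
            proof (elim disjE)
              assume "j' = j"
              then have "y \<in> cls (X s j)" using j' U_cls by blast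
              then have "W (X s j, y) \<noteq> 0" by (simp add: cls_def)
              then show ?thesis using elim(3) True by simp
            next
              assume "j' = Suc j"
              then have "y \<in> nb 1 x" using j' elim(4) by blast
              then show ?thesis by (simp add: nb_def)
            next
              assume "j' = i"
              then have "y \<in> nb (-1) x" using j' elim(5) by blast
              then show ?thesis by (simp add: nb_def)
            qed
          qed
          then have "W (x, y) = of_bool (\<exists>j'\<le>K. y \<in> U j' s \<and> adjacent j j')"
            using elim(2) True by auto
          then show ?thesis using True jK by (auto simp: h_def)
        next
          case False
          then have "\<not> (\<exists>j'\<le>K. \<exists>s'. y \<in> U j' s')" using in_U(3) by blast
          moreover obtain l where l: "l < 5" "deg W y = class_degree l" using elim(7) by blast
          then have "l \<noteq> 0" using False vtx_iff_class[OF l(1)] l(2) unfolding vtx_def by metis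
          then have l': "l \<in> {1, 2, 3, 4}" using l by auto
          then have "W (x, y) = lab W l (A j)" using elim(8) l labs by auto
          moreover have "h j y = lab W l (A j)"
            using l l' False jK by (auto simp: h_def class_degree_def)
          ultimately show ?thesis by auto
        qed
      qed
    qed
  qed
qed

sublocale two_strands W U h K
proof
  show "graphon W" by (rule W)
  show "2 \<le> K" by (rule K2)
  show "U j s \<in> sets unif01" for j s by (rule U_sets)
  show "j = j' \<and> s = s'" if "x \<in> U j s" "x \<in> U j' s'" for x j s j' s'
    using U_disj[OF that] .
  show "measure unif01 (U j True) = measure unif01 (U j False)" if "j \<le> K" for j
    using U_mass[OF that] by simp
  show "U j s \<noteq> {}" if "j \<le> K" for j s
    using U_mass[OF that, of s] atom_mass_pos[OF k_pos] by auto
  show "h j \<in> borel_measurable unif01" for j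
    unfolding h_def by measurable
  show "h j x \<in> {0..1}" if "x \<in> {0..<1}" for j x
    using good_range[OF good_X[of j True]] by (auto simp: h_def X_def)
  show "AE x in unif01. x \<in> U j s \<longrightarrow> (AE y in unif01. W (x, y) =
    (if \<exists>j'\<le>K. \<exists>s'. y \<in> U j' s' then of_bool (\<exists>j'\<le>K. y \<in> U j' s \<and> adjacent j j') else h j y))"
    if "1 \<le> j" "j < K" for j s using interior_AE[OF that] .
qed

end

lemma graphon_section:
  assumes "graphon V" "x \<in> {0..<1}"
  shows "(\<lambda>y. V (x, y)) \<in> borel_measurable unif01" "(\<lambda>y. V (y, x)) \<in> borel_measurable unif01"
proof -
  show 1: "(\<lambda>y. V (x, y)) \<in> borel_measurable unif01"
    by (rule measurable_compose[OF measurable_Pair1' graphon_measurable[OF assms(1)]]) (use assms in simp)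
  show "(\<lambda>y. V (y, x)) \<in> borel_measurable unif01"
    by (rule measurable_compose[OF measurable_Pair2' graphon_measurable[OF assms(1)]]) (use assms in simp)
qed

lemma graphon_section_integrable:
  assumes "graphon V" "x \<in> {0..<1}" shows "integrable unif01 (\<lambda>y. V (x, y))"
  by (rule unif01.integrable_const_bound[of _ 1])
    (use graphon_bounds[OF assms(1)] graphon_section[OF assms] assms in \<open>auto intro!: AE_I2\<close>)

section \<open>Effect of the crossing on degrees, labels and path integrals\<close>

context crossing_strands begin

abbreviation "W' \<equiv> cross U W"

lemma W'_graphon: "graphon W'" by (rule graphon_cross[OF W U_sets])

lemmas [measurable] = ind_measurable[OF W'_graphon] lab_measurable[OF W'_graphon]
  path_measurable[OF W] path_measurable[OF W'_graphon]

text \<open>In a row of position 0 or 1 the crossing trades one atom for another of the same mass,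
  and other rows are not affected. Hence the crossed graphon has the same classes.\<close>

lemma deg_cross_AE: "AE t in unif01. deg W' t = deg W t"
proof -
  have balance: "deg W' t = deg W t" if t: "t \<in> {0..<1}"
    and AE: "AE z in unif01. W' (t, z) = W (t, z) + (indicator (U j (\<not> s)) z - indicator (U j s) z)"
    and j: "j \<le> K" for t j s
  proof -
    note [measurable] = graphon_section(1)[OF W t] graphon_section(1)[OF W'_graphon t]
    have i: "integrable unif01 (\<lambda>z. indicator (U j s) z :: real)" for s
      by (intro unif01.integrable_const_bound[of _ 1]) (auto simp: indicator_def)
    have "deg W' t = (\<integral>z. W (t, z) + (indicator (U j (\<not> s)) z - indicator (U j s) z) \<partial>unif01)"
      unfolding deg_def by (rule integral_cong_AE) (use AE in auto)
    also have "\<dots> = deg W t + (measure unif01 (U j (\<not> s)) - measure unif01 (U j s))"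
      unfolding deg_def
      using graphon_section_integrable[OF W t] i sets.sets_into_space[OF U_sets]
      by (simp add: Bochner_Integration.integral_add Bochner_Integration.integral_diff Int_absorb2)
    finally show ?thesis using U_mass[OF j] by simp
  qed
  have K0: "0 < K" using K2 by simp
  from edge_forward_AE[OF K0, of True] edge_forward_AE[OF K0, of False]
    edge_backward_AE[OF K0, of True] edge_backward_AE[OF K0, of False] AE_space
  show ?thesis
  proof eventually_elim
    case (elim t)
    have t: "t \<in> {0..<1}" using elim(5) by simp
    consider s where "t \<in> U 0 s" | s where "t \<in> U 1 s" | "\<And>s. t \<notin> U 0 s" "\<And>s. t \<notin> U 1 s" by blast
    then show ?case
    proof cases
      case (1 s)
      have "AE z in unif01. \<forall>s'. z \<in> U (Suc 0) s' \<longrightarrow> W (t, z) = of_bool (s = s')"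
        using elim(1,2) 1 by (cases s) auto
      then have "AE z in unif01. W' (t, z) = W (t, z) + (indicator (U 1 (\<not> s)) z - indicator (U 1 s) z)"
        using AE_space
      proof eventually_elim
        case (elim z)
        have "t \<notin> U 1 s'" for s' using U_disj[OF 1, of 1 s'] by auto
        then have c: "crossed U t z \<longleftrightarrow> (\<exists>s'. z \<in> U 1 s')" using 1 by (auto simp: crossed_def)
        show ?case
        proof (cases "\<exists>s'. z \<in> U 1 s'")
          case True
          then obtain s' where s': "z \<in> U 1 s'" by blast
          have "z \<in> U 1 s'' \<longleftrightarrow> s'' = s'" for s'' using U_disj[OF s', of 1 s''] s' by auto
          then show ?thesis using s' elim t c by (auto simp: cross_eq indicator_def)
        next
          case False
          then show ?thesis using c t elim by (simp add: cross_eq)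
        qed
      qed
      then show ?thesis by (rule balance[OF t]) (use K2 in simp)
    next
      case (2 s)
      have "AE z in unif01. \<forall>s'. z \<in> U 0 s' \<longrightarrow> W (t, z) = of_bool (s = s')"
        using elim(3,4) 2 by (cases s) auto
      then have "AE z in unif01. W' (t, z) = W (t, z) + (indicator (U 0 (\<not> s)) z - indicator (U 0 s) z)"
        using AE_space
      proof eventually_elim
        case (elim z)
        have "t \<notin> U 0 s'" for s' using U_disj[OF 2, of 0 s'] by auto
        then have c: "crossed U t z \<longleftrightarrow> (\<exists>s'. z \<in> U 0 s')" using 2 by (auto simp: crossed_def)
        show ?case
        proof (cases "\<exists>s'. z \<in> U 0 s'")
          case True
          then obtain s' where s': "z \<in> U 0 s'" by blast
          have "z \<in> U 0 s'' \<longleftrightarrow> s'' = s'" for s'' using U_disj[OF s', of 0 s''] s' by auto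
          then show ?thesis using s' elim t c by (auto simp: cross_eq indicator_def)
        next
          case False
          then show ?thesis using c t elim by (simp add: cross_eq)
        qed
      qed
      then show ?thesis by (rule balance[OF t]) simp
    next
      case 3
      then have "\<not> crossed U t z" for z by (auto simp: crossed_def)
      then show ?thesis unfolding deg_def
        by (intro Bochner_Integration.integral_cong refl) (use t in \<open>simp add: cross_eq\<close>)
    qed
  qed
qed

lemma ind_cross_AE: "AE t in unif01. \<forall>c. ind W' c t = ind W c t"
  using deg_cross_AE by eventually_elim (simp add: ind_def)

definition inU :: "real \<Rightarrow> bool" where "inU z \<longleftrightarrow> (\<exists>j s. z \<in> U j s)"

lemma crossed_inU: "crossed U x y \<Longrightarrow> inU x \<and> inU y"
  by (auto simp: crossed_def inU_def)

lemma inU_vtx: "inU z \<Longrightarrow> vtx z"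
  using in_U(3) by (auto simp: inU_def)

lemma inU_measurable [measurable]: "Measurable.pred unif01 inU"
proof -
  have "{z \<in> space unif01. inU z} = (\<Union>j\<in>{..K}. \<Union>s. U j s)"
    using in_U(1,2) by (auto simp: inU_def)
  also have "\<dots> \<in> sets unif01" by (intro sets.finite_UN) auto
  finally show ?thesis by (simp add: pred_def)
qed

text \<open>The crossing changes only values inside class 0, and the indicators of the marker
  classes are the same almost everywhere.\<close>

lemma lab_cross:
  assumes t: "t \<in> {0..<1}" and c: "c \<in> {1, 2, 3, 4}"
  shows "lab W' c t = lab W c t"
  unfolding lab_def
proof (rule integral_cong_AE)
  note [measurable] = graphon_section(1)[OF W t] graphon_section(1)[OF W'_graphon t]
  show "(\<lambda>s. W' (t, s) * (1 / class_mass c * ind W' c s)) \<in> borel_measurable unif01" by measurable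
  show "(\<lambda>s. W (t, s) * (1 / class_mass c * ind W c s)) \<in> borel_measurable unif01" by measurable
  show "AE s in unif01. W' (t, s) * (1 / class_mass c * ind W' c s) = W (t, s) * (1 / class_mass c * ind W c s)"
    using ind_cross_AE AE_space
  proof eventually_elim
    case (elim s)
    show ?case
    proof (cases "inU s")
      case True
      then have "deg W s = class_degree 0" using inU_vtx by (simp add: vtx_def class_degree_def)
      then have "ind W c s = 0" using ind_class[of s 0 c] c by auto
      then show ?thesis using elim by simp
    next
      case False
      then have "W' (t, s) = W (t, s)" using crossed_inU t elim(2) by (auto simp: cross_eq)
      then show ?thesis using elim by simp
    qed
  qed
qed

lemma fstep_cross: "s \<in> {0..<1} \<Longrightarrow> t \<in> {0..<1} \<Longrightarrow> fstep W' s t = fstep W s t"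
  by (simp add: fstep_def lab_cross)

lemma fstep_edge:
  assumes "edge_rule t z" "0 < lev t"
  shows "fstep W z t = (if lev z = lev t \<and> pos z = pos t - lev t then 2 * lev t ^ 4 else 0)"
  using assms
proof (cases rule: edge_cases)
  case 3
  then show ?thesis by (simp add: fstep_def phi_def power_def numeral_eq_Suc)
qed (use assms(2) in \<open>auto simp: fstep_def phi_def\<close>)

lemma fstep_edge':
  assumes "edge_rule z t" "0 < lev z"
  shows "fstep W z t = (if lev t = lev z \<and> pos t = pos z + lev z then 2 * lev z ^ 4 else 0)"
  using assms
proof (cases rule: edge_cases)
  case 2
  then show ?thesis by (simp add: fstep_def phi_def power_def numeral_eq_Suc)
qed (use assms(2) in \<open>auto simp: fstep_def phi_def\<close>)

text \<open>Integration against this kernel is one step back along the strand.\<close>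

lemma back_kernel:
  assumes j: "j < K"
  shows "AE t in unif01. t \<in> U (Suc j) s \<longrightarrow>
    (AE z in unif01. (ind W 0 z)\<^sup>2 * (W (z, t) * fstep W z t) = 2 * k ^ 4 * indicator (U j s) z)"
  using U_twin[of "Suc j" s] backward_AE[OF j, of s]
proof eventually_elim
  case (elim t)
  show ?case
  proof
    assume t: "t \<in> U (Suc j) s"
    with elim have g: "good t" and nb: "AE z in unif01. z \<in> nb (-1) t \<longleftrightarrow> z \<in> U j s" by auto
    have lt: "lev t = k" "t \<in> {0..<1}" using in_U[OF t] by auto
    from nb good_edge[OF g] good_zero_one[OF g] ind_AE AE_space
    show "AE z in unif01. (ind W 0 z)\<^sup>2 * (W (z, t) * fstep W z t) = 2 * k ^ 4 * indicator (U j s) z"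
    proof eventually_elim
      case (elim z)
      have z: "z \<in> {0..<1}" using elim(5) by simp
      have sym: "W (z, t) = W (t, z)" using graphon_sym[OF W z lt(2)] .
      show ?case
      proof (cases "vtx z \<and> W (t, z) \<noteq> 0")
        case True
        then have "edge_rule t z" using elim(2) by blast
        then have "fstep W z t = (if lev z = k \<and> pos z = pos t - k then 2 * k ^ 4 else 0)"
          using fstep_edge[of t z] lt k_pos by simp
        moreover have "z \<in> U j s \<longleftrightarrow> lev z = k \<and> pos z = pos t - k"
          using elim(1) True z lt by (auto simp: nb_def)
        ultimately show ?thesis using elim(3,4) True sym by (auto simp: indicator_def)
      next
        case False
        then have "z \<notin> U j s" using elim(1) by (auto simp: nb_def)
        then show ?thesis using elim(4) False sym by (auto simp: indicator_def)
      qed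
    qed
  qed
qed

text \<open>Among the steps back, only the one from position 1 to position 0 changes strand.\<close>

lemma back_kernel_cross:
  assumes j: "j < K"
  shows "AE t in unif01. t \<in> U (Suc j) s \<longrightarrow>
    (AE z in unif01. (ind W' 0 z)\<^sup>2 * (W' (z, t) * fstep W' z t) =
      2 * k ^ 4 * indicator (U j (if j = 0 then \<not> s else s)) z)"
  using back_kernel[OF j, of s] edge_backward_AE[OF j, of s]
proof eventually_elim
  case (elim t)
  show ?case
  proof
    assume t: "t \<in> U (Suc j) s"
    with elim have bk: "AE z in unif01. (ind W 0 z)\<^sup>2 * (W (z, t) * fstep W z t) = 2 * k ^ 4 * indicator (U j s) z"
      and eb: "AE z in unif01. \<forall>s'. z \<in> U j s' \<longrightarrow> W (t, z) = of_bool (s = s')" by auto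
    have ts: "t \<in> {0..<1}" using in_U[OF t] by auto
    from bk eb ind_cross_AE AE_space
    show "AE z in unif01. (ind W' 0 z)\<^sup>2 * (W' (z, t) * fstep W' z t) =
      2 * k ^ 4 * indicator (U j (if j = 0 then \<not> s else s)) z"
    proof eventually_elim
      case (elim z)
      have z: "z \<in> {0..<1}" using elim(4) by simp
      have fs: "fstep W' z t = fstep W z t" using fstep_cross[OF z ts] .
      have tn: "t \<in> U i s' \<longleftrightarrow> i = Suc j \<and> s' = s" for i s' using U_disj[OF t, of i s'] t by auto
      show ?case
      proof (cases "j = 0 \<and> (\<exists>s'. z \<in> U 0 s')")
        case True
        then obtain s' where s': "z \<in> U 0 s'" "j = 0" by blast
        have zn: "z \<in> U 0 s'' \<longleftrightarrow> s'' = s'" for s'' using U_disj[OF s'(1), of 0 s''] s' by auto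
        have "crossed U z t" using s' t by (auto simp: crossed_def)
        then have "W' (z, t) = 1 - of_bool (s = s')"
          using elim(2) s' z ts graphon_sym[OF W z ts] by (simp add: cross_eq)
        moreover have "fstep W z t = 2 * k ^ 4"
          using in_U[OF s'(1)] in_U[OF t] s'(2) by (simp add: fstep_def phi_def power_def numeral_eq_Suc)
        moreover have "ind W' 0 z = 1" using elim(3) ind_vtx[OF in_U(3)[OF s'(1)]] by simp
        ultimately show ?thesis using s'(2) fs zn by (auto simp: indicator_def)
      next
        case False
        then have "\<not> crossed U z t" using tn by (auto simp: crossed_def)
        then have "W' (z, t) = W (z, t)" using z ts by (simp add: cross_eq)
        then have "(ind W' 0 z)\<^sup>2 * (W' (z, t) * fstep W' z t) = 2 * k ^ 4 * indicator (U j s) z"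
          using elim(1,3) fs by simp
        then show ?thesis using False by (auto simp: indicator_def)
      qed
    qed
  qed
qed

text \<open>What one step back contributes: the value of \<open>fstep\<close> times the mass of the
  preceding atom.\<close>

definition c :: real where "c = 2 * k ^ 4 * atom_mass k"

lemma path_step:
  assumes V: "graphon V" and t: "t \<in> {0..<1}" and j: "j \<le> K"
    and AE: "AE z in unif01. (ind V 0 z)\<^sup>2 * (V (z, t) * fstep V z t) = 2 * k ^ 4 * indicator (U j s) z"
    and IH: "AE z in unif01. z \<in> U j s \<longrightarrow> path V n z = v"
  shows "path V (Suc n) t = c * v"
proof -
  note [measurable] = graphon_section(2)[OF V t] ind_measurable[OF V] lab_measurable[OF V] path_measurable[OF V]
  have "path V (Suc n) t = (\<integral>z. 2 * k ^ 4 * v * indicator (U j s) z \<partial>unif01)"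
    unfolding path.simps
  proof (rule integral_cong_AE)
    show "AE z in unif01. (ind V 0 z)\<^sup>2 * (V (z, t) * (fstep V z t * path V n z)) = 2 * k ^ 4 * v * indicator (U j s) z"
      using AE IH
    proof eventually_elim
      case (elim z)
      have "(ind V 0 z)\<^sup>2 * (V (z, t) * (fstep V z t * path V n z)) =
        (2 * k ^ 4 * indicator (U j s) z) * path V n z"
        unfolding elim(1)[symmetric] by (simp add: mult.assoc)
      also have "\<dots> = 2 * k ^ 4 * v * indicator (U j s) z" using elim(2) by (auto simp: indicator_def)
      finally show ?case .
    qed
    show "(\<lambda>z. (ind V 0 z)\<^sup>2 * (V (z, t) * (fstep V z t * path V n z))) \<in> borel_measurable unif01"
      unfolding fstep_def phi_def by measurable
  qed measurable
  also have "\<dots> = c * v"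
    using U_mass[OF j] sets.sets_into_space[OF U_sets, of j s] by (simp add: c_def Int_absorb2)
  finally show ?thesis .
qed

lemma path_strand: "j \<le> K \<Longrightarrow> AE t in unif01. t \<in> U j s \<longrightarrow> path W j t = c ^ j * (mrk (X s 0) - 1/2)"
proof (induction j)
  case 0
  show ?case by (rule AE_I2) (use in_U(6) in auto)
next
  case (Suc j)
  then have j: "j < K" "j \<le> K" by auto
  from back_kernel[OF j(1), of s] show ?case
  proof (rule AE_mpI, intro impI)
    fix t assume t: "t \<in> U (Suc j) s" and "t \<in> U (Suc j) s \<longrightarrow>
      (AE z in unif01. (ind W 0 z)\<^sup>2 * (W (z, t) * fstep W z t) = 2 * k ^ 4 * indicator (U j s) z)"
    then have "AE z in unif01. (ind W 0 z)\<^sup>2 * (W (z, t) * fstep W z t) = 2 * k ^ 4 * indicator (U j s) z" by blast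
    from path_step[OF W in_U(2)[OF t] j(2) this Suc.IH[OF j(2)]]
    show "path W (Suc j) t = c ^ Suc j * (mrk (X s 0) - 1/2)" by simp
  qed
qed

text \<open>For \<open>j > 0\<close> the path ends up, after its last step back, at the first atom
  of the other strand.\<close>

lemma path_strand_cross:
  "j \<le> K \<Longrightarrow> AE t in unif01. t \<in> U j s \<longrightarrow>
    path W' j t = c ^ j * (mrk (X (if j = 0 then s else \<not> s) 0) - 1/2)"
proof (induction j arbitrary: s)
  case 0
  show ?case by (rule AE_I2) (use in_U(2,6) lab_cross in auto)
next
  case (Suc j)
  then have j: "j < K" "j \<le> K" by auto
  from back_kernel_cross[OF j(1), of s] show ?case
  proof (rule AE_mpI, intro impI)
    let ?s = "if j = 0 then \<not> s else s"
    fix t assume t: "t \<in> U (Suc j) s" and "t \<in> U (Suc j) s \<longrightarrow>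
      (AE z in unif01. (ind W' 0 z)\<^sup>2 * (W' (z, t) * fstep W' z t) = 2 * k ^ 4 * indicator (U j ?s) z)"
    then have "AE z in unif01. (ind W' 0 z)\<^sup>2 * (W' (z, t) * fstep W' z t) = 2 * k ^ 4 * indicator (U j ?s) z"
      by blast
    from path_step[OF W'_graphon in_U(2)[OF t] j(2) this Suc.IH[OF j(2), of ?s]]
    show "path W' (Suc j) t = c ^ Suc j * (mrk (X (if Suc j = 0 then s else \<not> s) 0) - 1/2)"
      by (cases "j = 0") simp_all
  qed
qed

text \<open>The successors of atoms on the two strands lie on them as well, and beyond the last atom
  a successor would have the position \<open>1 + k\<close>, which is too large. So paths to other
  vertices never pass through the crossed strands.\<close>

lemma out_kernel: "AE t in unif01. vtx t \<longrightarrow> \<not> inU t \<longrightarrow> (AE z in unif01. inU z \<longrightarrow> W (z, t) * fstep W z t = 0)"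
proof -
  have "AE t in unif01. AE z in unif01. z \<in> U j s \<longrightarrow> vtx t \<longrightarrow> \<not> inU t \<longrightarrow> W (z, t) * fstep W z t = 0"
    if j: "j \<le> K" for j s
  proof (subst square.AE_commute[symmetric])
    have fw: "AE z in unif01. z \<in> U j s \<longrightarrow> j < K \<longrightarrow> (AE t in unif01. t \<in> nb 1 z \<longleftrightarrow> t \<in> U (Suc j) s)"
    proof (cases "j < K")
      case True
      then show ?thesis using forward_AE[of j s] by simp
    qed simp
    from U_twin[of j s] fw
    show "AE z in unif01. AE t in unif01. z \<in> U j s \<longrightarrow> vtx t \<longrightarrow> \<not> inU t \<longrightarrow> W (z, t) * fstep W z t = 0"
    proof eventually_elim
      case (elim z)
      show ?case
      proof (cases "z \<in> U j s")
        case z: True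
        with elim have g: "good z" and fw': "j < K \<longrightarrow> (AE t in unif01. t \<in> nb 1 z \<longleftrightarrow> t \<in> U (Suc j) s)" by auto
        have lz: "lev z = k" "pos z = real j * k" using in_U[OF z] by auto
        have nxt: "AE t in unif01. j < K \<longrightarrow> (t \<in> nb 1 z \<longleftrightarrow> t \<in> U (Suc j) s)"
          using fw' by (cases "j < K") auto
        from good_edge[OF g] nxt label_range_AE[of 2, simplified] AE_space
        show ?thesis
        proof eventually_elim
          case (elim t)
          show ?case
          proof (intro impI, rule ccontr)
            assume t: "vtx t" "\<not> inU t" and nz: "W (z, t) * fstep W z t \<noteq> 0"
            then have "edge_rule z t" using elim(1) by auto
            then have lt: "lev t = k" "pos t = pos z + k"
              using fstep_edge'[of z t] nz lz k_pos by (auto split: if_splits)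
            then have nb: "t \<in> nb 1 z" using t nz lz elim(4) by (auto simp: nb_def)
            show False
            proof (cases "j < K")
              case True
              then show False using nb elim(2) t by (auto simp: inU_def)
            next
              case False
              then have "pos t = 1 + k" using j lt lz K_k by simp
              then show False using elim(3) t k_pos by auto
            qed
          qed
        qed
      qed simp
    qed
    show "{p \<in> space (unif01 \<Otimes>\<^sub>M unif01). fst p \<in> U j s \<longrightarrow> vtx (snd p) \<longrightarrow> \<not> inU (snd p) \<longrightarrow>
        W (fst p, snd p) * fstep W (fst p) (snd p) = 0} \<in> sets (unif01 \<Otimes>\<^sub>M unif01)"
      unfolding fstep_def phi_def by measurable
  qed
  then have "AE t in unif01. \<forall>p\<in>{..K} \<times> UNIV. AE z in unif01. z \<in> U (fst p) (snd p) \<longrightarrow> vtx t \<longrightarrow> \<not> inU t \<longrightarrow>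
      W (z, t) * fstep W z t = 0"
    by (intro AE_ball_countable[THEN iffD2] ballI countable_finite) auto
  then show ?thesis
  proof (rule AE_mpI, intro impI)
    fix t assume "\<forall>p\<in>{..K} \<times> UNIV. AE z in unif01. z \<in> U (fst p) (snd p) \<longrightarrow> vtx t \<longrightarrow> \<not> inU t \<longrightarrow>
      W (z, t) * fstep W z t = 0" and t: "vtx t" "\<not> inU t"
    then have "AE z in unif01. \<forall>p\<in>{..K} \<times> UNIV. z \<in> U (fst p) (snd p) \<longrightarrow> vtx t \<longrightarrow> \<not> inU t \<longrightarrow>
      W (z, t) * fstep W z t = 0"
      by (intro AE_ball_countable[THEN iffD2] countable_finite) auto
    then show "AE z in unif01. inU z \<longrightarrow> W (z, t) * fstep W z t = 0"
    proof eventually_elim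
      case (elim z)
      show ?case
      proof
        assume "inU z"
        then obtain j s where z: "z \<in> U j s" by (auto simp: inU_def)
        then show "W (z, t) * fstep W z t = 0"
          using elim[rule_format, of "(j, s)"] in_U(1)[OF z] t by simp
      qed
    qed
  qed
qed

lemma path_outside: "AE t in unif01. vtx t \<longrightarrow> \<not> inU t \<longrightarrow> path W' n t = path W n t"
proof (induction n)
  case 0
  show ?case by (rule AE_I2) (simp add: lab_cross)
next
  case (Suc n)
  from out_kernel AE_space show ?case
  proof eventually_elim
    case (elim t)
    show ?case
    proof (intro impI)
      assume t: "vtx t" "\<not> inU t"
      have ts: "t \<in> {0..<1}" using elim(2) by simp
      note [measurable] = graphon_section(2)[OF W ts] graphon_section(2)[OF W'_graphon ts]
      have ok: "AE z in unif01. inU z \<longrightarrow> W (z, t) * fstep W z t = 0" using elim(1) t by blast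
      show "path W' (Suc n) t = path W (Suc n) t"
        unfolding path.simps
      proof (rule integral_cong_AE)
        show "AE z in unif01. (ind W' 0 z)\<^sup>2 * (W' (z, t) * (fstep W' z t * path W' n z)) =
          (ind W 0 z)\<^sup>2 * (W (z, t) * (fstep W z t * path W n z))"
          using ok Suc.IH ind_cross_AE ind_AE AE_space
        proof eventually_elim
          case (elim z)
          have z: "z \<in> {0..<1}" using elim(5) by simp
          have e: "W' (z, t) = W (z, t)" using crossed_inU t z ts by (auto simp: cross_eq)
          have f: "fstep W' z t = fstep W z t" using fstep_cross[OF z ts] .
          consider "\<not> vtx z" | "inU z" | "vtx z" "\<not> inU z" by blast
          then show ?case
          proof cases
            case 1
            then show ?thesis using elim by simp
          next
            case 2
            then have "W (z, t) * fstep W z t = 0" using elim by blast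
            then show ?thesis using e f by auto
          next
            case 3
            then show ?thesis using elim e f by simp
          qed
        qed
      qed (unfold fstep_def phi_def, measurable)
    qed
  qed
qed

text \<open>The integrands differ only at the last atoms of the two strands: first atoms have
  position 0, interior atoms have mark 1/2, and elsewhere the path integrals agree.\<close>

lemma strands_differ: "eval W (Integ 0 (Strands K)) x \<noteq> eval W' (Integ 0 (Strands K)) x"
proof -
  let ?f = "\<lambda>V t. (ind V 0 t)\<^sup>2 * (path V K t * ((lab V 3 t - 1/2) * lab V 2 t))"
  define \<beta> where "\<beta> s = mrk (X s 0) - 1/2" for s
  define \<epsilon> where "\<epsilon> s = mrk (X s K) - 1/2" for s
  let ?d = "\<lambda>s. c ^ K * (\<beta> (\<not> s) - \<beta> s) * \<epsilon> s"
  have AE: "AE t in unif01. ?f W' t - ?f W t =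
      ?d True * indicator (U K True) t + ?d False * indicator (U K False) t"
    using path_strand[OF order_refl, of True] path_strand[OF order_refl, of False]
      path_strand_cross[OF order_refl, of True] path_strand_cross[OF order_refl, of False]
      path_outside[of K] ind_cross_AE ind_AE AE_space
  proof eventually_elim
    case (elim t)
    have t: "t \<in> {0..<1}" using elim(8) by simp
    have ps: "path W K t = c ^ K * \<beta> s" "path W' K t = c ^ K * \<beta> (\<not> s)" if "t \<in> U K s" for s
      using elim(1-4) that K2 by (cases s; simp add: \<beta>_def)+
    have l: "lab W' 3 t = lab W 3 t" "lab W' 2 t = lab W 2 t" using lab_cross[OF t] by auto
    consider "\<not> vtx t" | "vtx t" "\<not> inU t" | j s where "t \<in> U j s" by (auto simp: inU_def)
    then show ?case
    proof cases
      case 1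
      then have "t \<notin> U j s" for j s using in_U(3) by blast
      then show ?thesis using 1 elim by simp
    next
      case 2
      then have "t \<notin> U j s" for j s by (auto simp: inU_def)
      then show ?thesis using 2 elim l by simp
    next
      case (3 j s)
      have v: "vtx t" using in_U(3)[OF 3] .
      have only: "t \<in> U i s' \<longleftrightarrow> i = j \<and> s' = s" for i s' using U_disj[OF 3, of i s'] 3 by auto
      have jK: "j \<le> K" using in_U(1)[OF 3] .
      show ?thesis
      proof (cases "j = K")
        case True
        then have "pos t = 1" "mrk t = mrk (X s K)" using in_U[OF 3] K_k by auto
        then show ?thesis
          using ps[of s] 3 True elim(6,7) v l only
          by (cases s) (simp_all add: \<epsilon>_def indicator_def algebra_simps)
      next
        case False
        have "pos t = 0 \<or> mrk t = 1/2"
        proof (cases "j = 0")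
          case True then show ?thesis using in_U(5)[OF 3] by simp
        next
          case j0: False
          then show ?thesis using in_U(6)[OF 3] strand_mark[OF strand_X, of j s] jK False by simp
        qed
        then show ?thesis using l only False by (auto simp: indicator_def)
      qed
    qed
  qed
  have i: "integrable unif01 (\<lambda>t. r * indicator (U K s) t :: real)" for s r
    by (intro integrable_mult_right unif01.integrable_const_bound[of _ 1]) (auto simp: indicator_def)
  have m: "(\<integral>t. r * indicator (U K s) t \<partial>unif01) = r * atom_mass k" for s r
    using U_mass[of K s] sets.sets_into_space[OF U_sets, of K s] by (simp add: Int_absorb2)
  have "(\<integral>t. ?f W' t \<partial>unif01) - (\<integral>t. ?f W t \<partial>unif01) = (\<integral>t. ?f W' t - ?f W t \<partial>unif01)"
    using strands_integrable[OF W] strands_integrable[OF W'_graphon]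
    by (rule Bochner_Integration.integral_diff[symmetric, rotated])
  also have "\<dots> = (\<integral>t. ?d True * indicator (U K True) t + ?d False * indicator (U K False) t \<partial>unif01)"
    by (rule integral_cong_AE) (use AE in \<open>auto intro!: borel_measurable_diff borel_measurable_integrable
      strands_integrable[OF W] strands_integrable[OF W'_graphon]\<close>)
  also have "\<dots> = ?d True * atom_mass k + ?d False * atom_mass k"
    by (subst Bochner_Integration.integral_add[OF i i]) (simp only: m)
  also have "\<dots> \<noteq> 0"
  proof -
    have \<beta>: "\<beta> False = - \<beta> True" "\<beta> True \<noteq> 0"
      using strand_ends(1)[OF A] strand_ends(1)[OF B] start by (auto simp: \<beta>_def X_def)
    have \<epsilon>: "\<epsilon> False = - \<epsilon> True" "\<epsilon> True \<noteq> 0"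
      using strand_ends(2)[OF A] strand_ends(2)[OF B] finish by (auto simp: \<epsilon>_def X_def)
    \<comment> \<open>The strands have opposite signs at both ends, so the products over the two
      ends agree. The crossing negates each of them, a change by -2 times the product, for each of
      the two strands.\<close>
    have "?d True * atom_mass k + ?d False * atom_mass k = - 4 * c ^ K * \<beta> True * \<epsilon> True * atom_mass k"
      unfolding not_True_eq_False not_False_eq_True \<beta> \<epsilon> by (simp add: algebra_simps)
    moreover have "c \<noteq> 0" "atom_mass k \<noteq> 0" using atom_mass_pos[OF k_pos] k_pos by (auto simp: c_def)
    ultimately show ?thesis using \<beta> \<epsilon> by simp
  qed
  finally have "(\<integral>t. ?f W' t \<partial>unif01) \<noteq> (\<integral>t. ?f W t \<partial>unif01)" by simp
  then show ?thesis by (simp add: Strands_def)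
qed

lemma not_weakly_isomorphic: "\<not> weakly_isomorphic W' W"
proof
  assume iso: "weakly_isomorphic W' W"
  have "simple (Integ 0 (Strands K))" "fv (Integ 0 (Strands K)) = {}" by (auto simp: Strands_def)
  from eval_determined[OF this] obtain N where N: "\<And>V V'. graphon V \<Longrightarrow> graphon V' \<Longrightarrow> density_equiv N V V' \<Longrightarrow>
    eval V (Integ 0 (Strands K)) (\<lambda>_. 0) = eval V' (Integ 0 (Strands K)) (\<lambda>_. 0)" by metis
  have "density_equiv N W W'" using iso by (simp add: density_equiv_def weakly_isomorphic_def)
  from N[OF W W'_graphon this] show False using strands_differ by blast
qed

end

lemma structured_not_forced:
  assumes "structured W"
  obtains W' where "graphon W'" "density_equiv n W W'" "\<not> weakly_isomorphic W' W"
proof -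
  interpret structured_graphon W by standard (rule assms)
  obtain K A B where K: "n + 2 < K" and AB: "strand K A" "strand K B" "lev (A 0) = lev (B 0)"
    "mrk (A 0) \<noteq> mrk (B 0)" "mrk (A K) \<noteq> mrk (B K)"
    by (rule strand_pair)
  interpret crossing_strands W K A B
    by standard (use K AB in auto)
  show thesis
    by (rule that[OF W'_graphon crossing_density_equiv not_weakly_isomorphic]) (use K in simp)
qed

subsection \<open>A graphon satisfying the identities\<close>

text \<open>\<open>Vx i j s\<close> is the atom at position \<open>j\<close> of the strand with mark \<open>s\<close> at level \<open>kap i\<close>;
  \<open>Mk m\<close> is the \<open>m\<close>-th marker class.\<close>

datatype atom = Vx nat nat bool | Mk nat

instance atom :: countable
  by countable_datatype

definition kap :: "nat \<Rightarrow> real" where "kap i = 1 / 2 ^ Suc i"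

definition len :: "nat \<Rightarrow> nat" where "len i = 2 ^ Suc i"

primrec weight :: "atom \<Rightarrow> real" where
  "weight (Vx i j s) = (if j \<le> len i then atom_mass (kap i) else 0)"
| "weight (Mk m) = (if m \<in> {1, 2, 3, 4} then class_mass m else 0)"

lemma kap_pos: "0 < kap i" and kap_le: "kap i \<le> 1/2" and kap_Suc: "kap (Suc i) = kap i / 2"
  and len_kap: "real (len i) * kap i = 1" and len_ge: "2 \<le> len i"
proof -
  have "(1::real) \<le> 2 ^ i" by simp
  then show "kap i \<le> 1/2" by (simp add: kap_def field_simps)
  have "(1::nat) \<le> 2 ^ i" by simp
  then show "2 \<le> len i" by (simp add: len_def)
qed (simp_all add: kap_def len_def)

text \<open>The unit interval is cut at the cumulative sums \<open>S n\<close>, which tend to 1 and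
  hence leave no gap. A piece that contains a point has positive length, so only values of positive
  probability are taken.\<close>

lemma partition_exists:
  fixes P :: "'a :: countable pmf"
  obtains p where "\<And>a. {t \<in> {0..<1}. p t = a} \<in> sets unif01"
    "\<And>a. measure unif01 {t \<in> {0..<1}. p t = a} = pmf P a"
    "\<And>t. t \<in> {0..<1} \<Longrightarrow> p t \<in> set_pmf P"
proof -
  define R where "R = map_pmf to_nat P"
  define S where "S n = measure (measure_pmf R) {..<n}" for n
  have S0: "S 0 = 0" by (simp add: S_def)
  have S_Suc: "S (Suc n) = S n + pmf R n" for n
    by (simp add: S_def measure_measure_pmf_finite)
  have S_mono: "S m \<le> S n" if "m \<le> n" for m n
    unfolding S_def by (rule measure_pmf.finite_measure_mono) (use that in auto)
  have S_le: "S n \<le> 1" for n by (simp add: S_def)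
  have "S \<longlonglongrightarrow> measure (measure_pmf R) (\<Union>n. {..<n})"
    unfolding S_def by (rule measure_pmf.finite_Lim_measure_incseq) (auto simp: incseq_def)
  also have "(\<Union>n. {..<n}) = (UNIV :: nat set)" by auto
  finally have lim: "S \<longlonglongrightarrow> 1" by simp
  have ex: "\<exists>n. t < S (Suc n)" if "t < 1" for t
  proof -
    from order_tendstoD(1)[OF lim that] obtain n where "t < S n"
      by (auto simp: eventually_sequentially)
    then show ?thesis using S_mono[of n "Suc n"] by (intro exI[of _ n]) simp
  qed
  define I where "I t = (LEAST n. t < S (Suc n))" for t
  have I: "I t = n \<longleftrightarrow> S n \<le> t \<and> t < S (Suc n)" if t: "t \<in> {0..<1}" for t n
  proof
    assume n: "I t = n"
    have "t < S (Suc n)" using LeastI_ex[OF ex[of t]] t n by (simp add: I_def)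
    moreover have "S n \<le> t"
    proof (cases n)
      case 0 then show ?thesis using t S0 by simp
    next
      case (Suc m)
      then have "\<not> t < S (Suc m)" using not_less_Least[of m "\<lambda>n. t < S (Suc n)"] n by (simp add: I_def)
      then show ?thesis using Suc by simp
    qed
    ultimately show "S n \<le> t \<and> t < S (Suc n)" by simp
  next
    assume n: "S n \<le> t \<and> t < S (Suc n)"
    show "I t = n"
      unfolding I_def
    proof (rule Least_equality)
      show "t < S (Suc n)" using n by simp
      fix m assume "t < S (Suc m)"
      show "n \<le> m"
      proof (rule ccontr)
        assume "\<not> n \<le> m"
        then have "S (Suc m) \<le> S n" by (intro S_mono) simp
        with n \<open>t < S (Suc m)\<close> show False by simp
      qed
    qed
  qed
  have set: "{t \<in> {0..<1}. I t = n} = {S n..<S (Suc n)}" for n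
  proof (rule set_eqI)
    fix t
    have "0 \<le> S n" "S (Suc n) \<le> 1" using S_le[of "Suc n"] S_mono[of 0 n] S0 by auto
    then show "t \<in> {t \<in> {0..<1}. I t = n} \<longleftrightarrow> t \<in> {S n..<S (Suc n)}"
      using I[of t n] by (cases "t \<in> {0..<1}") auto
  qed
  have ms: "{t \<in> {0..<1}. I t = n} \<in> sets unif01" for n
    unfolding set unif01_def
    using S_le[of "Suc n"] S_mono[of 0 n] S0 by (auto simp: sets_restrict_space_iff)
  have mm: "measure unif01 {t \<in> {0..<1}. I t = n} = pmf R n" for n
  proof -
    have "measure unif01 {S n..<S (Suc n)} = measure lborel {S n..<S (Suc n)}"
      unfolding unif01_def using S_le[of "Suc n"] S_mono[of 0 n] S0
      by (intro measure_restrict_space) auto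
    then show ?thesis unfolding set using S_mono[of n "Suc n"] S_Suc[of n] by simp
  qed
  have inR: "I t \<in> set_pmf R" if t: "t \<in> {0..<1}" for t
  proof -
    have "S (I t) < S (Suc (I t))" using I[OF t, of "I t"] by simp
    then have "pmf R (I t) \<noteq> 0" using S_Suc[of "I t"] by simp
    then show ?thesis by (simp add: set_pmf_iff)
  qed
  define p where "p t = (from_nat (I t) :: 'a)" for t
  have to_p: "to_nat (p t) = I t" if "t \<in> {0..<1}" for t
    using inR[OF that] by (auto simp: R_def p_def)
  have eq: "{t \<in> {0..<1}. p t = a} = {t \<in> {0..<1}. I t = to_nat a}" for a
  proof (rule set_eqI)
    fix t
    show "t \<in> {t \<in> {0..<1}. p t = a} \<longleftrightarrow> t \<in> {t \<in> {0..<1}. I t = to_nat a}"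
    proof (cases "t \<in> {0..<1}")
      case True
      have "p t = a \<longleftrightarrow> to_nat (p t) = to_nat a" by simp
      with to_p[OF True] show ?thesis by simp
    qed auto
  qed
  show thesis
  proof (rule that[of p])
    show "{t \<in> {0..<1}. p t = a} \<in> sets unif01" for a unfolding eq by (rule ms)
    show "measure unif01 {t \<in> {0..<1}. p t = a} = pmf P a" for a
      unfolding eq mm R_def by (rule pmf_map_inj') simp
    show "p t \<in> set_pmf P" if "t \<in> {0..<1}" for t
    proof -
      from inR[OF that] obtain a where "a \<in> set_pmf P" "I t = to_nat a" by (auto simp: R_def)
      then show ?thesis by (simp add: p_def)
    qed
  qed
qed

text \<open>That the weights add up to 1 is shown by a sampling procedure: with probability 1/8 an
  atom of class 0 is drawn, with geometric level, uniform position and a fair coin for the strand,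
  and otherwise a marker.\<close>

lemma weight_pmf: "\<exists>P. \<forall>a. pmf P a = weight a"
proof -
  define Q where "Q i = pair_pmf (pmf_of_set {..len i}) (bernoulli_pmf (1/2))" for i
  define T where "T = bind_pmf (geometric_pmf (1/2)) (\<lambda>i. map_pmf (Pair i) (Q i))"
  define VP where "VP = map_pmf (\<lambda>(i, j, s). Vx i j s) T"
  \<comment> \<open>All of the values 4 to 7 yield marker 4, which gives it the weight 4/8.\<close>
  define F where "F n = (if n = 0 then VP else return_pmf (Mk (min n 4)))" for n :: nat
  define P where "P = bind_pmf (pmf_of_set {..<8}) F"
  have T: "pmf T (i, y) = (1/2) ^ Suc i * pmf (Q i) y" for i y
  proof -
    have "pmf T (i, y) = measure_pmf.expectation (geometric_pmf (1/2)) (\<lambda>i'. pmf (map_pmf (Pair i') (Q i')) (i, y))"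
      by (simp add: T_def pmf_bind)
    also have "\<dots> = (\<Sum>i'\<in>{i}. pmf (map_pmf (Pair i') (Q i')) (i, y) * pmf (geometric_pmf (1/2)) i')"
      by (rule integral_measure_pmf_real) (auto simp: set_pmf_iff[symmetric] pmf_eq_0_set_pmf[symmetric])
    also have "\<dots> = pmf (Q i) y * ((1/2) ^ i * (1/2))"
      by (simp add: pmf_map_inj' inj_on_def)
    finally show ?thesis by simp
  qed
  have VP1: "pmf VP (Vx i j s) = (1/2) ^ Suc i * pmf (Q i) (j, s)" for i j s
  proof -
    have "inj (\<lambda>(i, j, s). Vx i j s)" by (auto simp: inj_on_def)
    from pmf_map_inj'[OF this, of T "(i, j, s)"] show ?thesis by (simp add: VP_def T)
  qed
  have VP2: "pmf VP (Mk m) = 0" for m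
    by (auto simp: VP_def pmf_eq_0_set_pmf)
  have PP: "pmf P a = (\<Sum>n<8. pmf (F n) a) / 8" for a
    unfolding P_def pmf_bind by (subst integral_pmf_of_set) (auto simp: lessThan_empty_iff)
  have sum8: "(\<Sum>n<8. g n) = g 0 + g 1 + g 2 + g 3 + g 4 + g 5 + g 6 + g (7::nat)" for g :: "nat \<Rightarrow> real"
    by (simp add: eval_nat_numeral)
  have "pmf P a = weight a" for a
  proof (cases a)
    case (Vx i j s)
    have q: "pmf (Q i) (j, s) = (if j \<le> len i then 1 / (real (len i) + 1) else 0) * (1/2)"
    proof -
      have "pmf (pmf_of_set {..len i}) j = indicator {..len i} j / real (card {..len i})"
        by (rule pmf_of_set) auto
      also have "\<dots> = (if j \<le> len i then 1 / (real (len i) + 1) else 0)"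
        by (simp add: add.commute)
      finally have 1: "pmf (pmf_of_set {..len i}) j = (if j \<le> len i then 1 / (real (len i) + 1) else 0)" .
      have 2: "pmf (bernoulli_pmf (1/2)) s = 1/2" by (cases s) simp_all
      show ?thesis unfolding Q_def pmf_pair 1 2 ..
    qed
    have "pmf P a = pmf VP a / 8"
      by (simp add: PP sum8 F_def Vx)
    also have "\<dots> = (if j \<le> len i then (1/2) ^ Suc i * (1 / (real (len i) + 1)) / 16 else 0)"
      unfolding Vx VP1 q by (cases "j \<le> len i") (simp_all only: if_True if_False, simp_all)
    also have "(1/2) ^ Suc i * (1 / (real (len i) + 1)) / 16 = atom_mass (kap i)"
    proof -
      have "real (len i) = 1 / kap i" using len_kap[of i] kap_pos[of i] by (simp add: field_simps)
      moreover have "(1/2) ^ Suc i = kap i" by (simp add: kap_def power_one_over)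
      moreover have "k * (1 / (1 / k + 1)) / 16 = atom_mass k" if "0 < k" for k
        using that by (simp add: atom_mass_def field_simps power2_eq_square)
      ultimately show ?thesis using kap_pos[of i] by simp
    qed
    finally show ?thesis by (simp add: Vx)
  next
    case (Mk m)
    have "pmf P a = (of_bool (m = 1) + of_bool (m = 2) + of_bool (m = 3) + 4 * of_bool (m = 4)) / 8"
      by (simp add: PP sum8 F_def Mk VP2 pmf_return min_def)
    then show ?thesis by (auto simp: Mk class_mass_def)
  qed
  then show ?thesis by blast
qed

section \<open>A graphon that depends only on the atoms of its arguments\<close>

locale model =
  fixes p :: "real \<Rightarrow> atom"
  assumes p_sets: "\<And>a. {t \<in> {0..<1}. p t = a} \<in> sets unif01"
    and p_measure: "\<And>a. measure unif01 {t \<in> {0..<1}. p t = a} = weight a"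
    and p_weight: "\<And>t. t \<in> {0..<1} \<Longrightarrow> weight (p t) \<noteq> 0"
begin

lemma p_measurable [measurable]: "p \<in> measurable unif01 (count_space UNIV)"
proof (subst measurable_count_space_eq_countable)
  have "p -` {a} \<inter> space unif01 = {t \<in> {0..<1}. p t = a}" for a by auto
  then show "p \<in> space unif01 \<rightarrow> UNIV \<and> (\<forall>a\<in>UNIV. p -` {a} \<inter> space unif01 \<in> sets unif01)"
    using p_sets by auto
qed auto

lemma p_fun_measurable [measurable]: "(\<lambda>t. f (p t) :: real) \<in> borel_measurable unif01"
  by (rule measurable_compose[OF p_measurable]) simp

lemma p_cases:
  assumes "t \<in> {0..<1}"
  obtains i j s where "p t = Vx i j s" "j \<le> len i" | m where "p t = Mk m" "m \<in> {1, 2, 3, 4}"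
  using p_weight[OF assms] by (cases "p t") (auto split: if_splits)

lemma integral_finite_support:
  assumes S: "finite S" and f: "\<And>t. t \<in> {0..<1} \<Longrightarrow> p t \<notin> S \<Longrightarrow> f (p t) = 0"
  shows "(\<integral>t. f (p t) \<partial>unif01) = (\<Sum>a\<in>S. f a * weight a)"
proof -
  let ?A = "\<lambda>a. {t \<in> {0..<1}. p t = a}"
  have "(\<integral>t. f (p t) \<partial>unif01) = (\<integral>t. (\<Sum>a\<in>S. f a * indicator (?A a) t) \<partial>unif01)"
  proof (intro Bochner_Integration.integral_cong refl)
    fix t assume "t \<in> space unif01"
    then have t: "t \<in> {0..<1}" by simp
    have "(\<Sum>a\<in>S. f a * indicator (?A a) t) = (\<Sum>a\<in>S. if a = p t then f (p t) else 0)"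
      using t by (intro sum.cong refl) (auto simp: indicator_def)
    then show "f (p t) = (\<Sum>a\<in>S. f a * indicator (?A a) t)"
      using S f[OF t] by (auto simp: sum.delta)
  qed
  also have "\<dots> = (\<Sum>a\<in>S. \<integral>t. f a * indicator (?A a) t \<partial>unif01)"
  proof (rule Bochner_Integration.integral_sum)
    fix a
    have "integrable unif01 (indicator (?A a) :: real \<Rightarrow> real)"
      by (rule integrable_real_indicator[OF p_sets]) (simp add: unif01.emeasure_eq_measure)
    then show "integrable unif01 (\<lambda>t. f a * indicator (?A a) t)" by (rule integrable_mult_right)
  qed
  also have "\<dots> = (\<Sum>a\<in>S. f a * weight a)"
  proof (rule sum.cong[OF refl])
    fix a
    have "?A a \<inter> space unif01 = ?A a" by auto
    then have "(\<integral>t. indicator (?A a) t \<partial>unif01) = weight a"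
      unfolding Bochner_Integration.integral_indicator by (simp only: p_measure)
    then show "(\<integral>t. f a * indicator (?A a) t \<partial>unif01) = f a * weight a"
      unfolding integral_mult_right_zero by (rule arg_cong[where f = "\<lambda>r. f a * r"])
  qed
  finally show ?thesis .
qed

primrec isV :: "atom \<Rightarrow> bool" where
  "isV (Vx i j s) = True" | "isV (Mk m) = False"

lemma integral_bounded:
  assumes "\<And>a. \<bar>f a\<bar> \<le> B" shows "integrable unif01 (\<lambda>t. f (p t) :: real)"
  by (rule unif01.integrable_const_bound[of _ B]) (use assms in auto)

text \<open>Class 0 has infinitely many atoms, so its mass is computed from that of its complement,
  the four markers.\<close>

lemma integral_isV: "(\<integral>t. of_bool (isV (p t)) \<partial>unif01) = (1/8 :: real)"
proof -
  have i: "integrable unif01 (\<lambda>t. of_bool (isV (p t)) :: real)"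
    "integrable unif01 (\<lambda>t. of_bool (\<not> isV (p t)) :: real)"
    by (rule integral_bounded[of _ 1], simp)+
  have "(\<integral>t. of_bool (\<not> isV (p t)) \<partial>unif01) = (\<Sum>a\<in>Mk ` {1, 2, 3, 4}. of_bool (\<not> isV a) * weight a)"
  proof (rule integral_finite_support)
    fix t :: real assume "t \<in> {0..<1}" and n: "p t \<notin> Mk ` {1, 2, 3, 4}"
    from this(1) show "of_bool (\<not> isV (p t)) = (0::real)" by (cases rule: p_cases) (use n in auto)
  qed simp
  also have "\<dots> = (7/8 :: real)"
    by (subst sum.reindex) (auto simp: inj_on_def class_mass_def)
  finally have "(\<integral>t. of_bool (\<not> isV (p t)) \<partial>unif01) = (7/8 :: real)" .
  moreover have "(\<integral>t. of_bool (isV (p t)) + of_bool (\<not> isV (p t)) \<partial>unif01) = (1::real)"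
  proof -
    have "(\<integral>t. of_bool (isV (p t)) + of_bool (\<not> isV (p t)) \<partial>unif01) = (\<integral>t. (1::real) \<partial>unif01)"
      by (intro Bochner_Integration.integral_cong refl) auto
    then show ?thesis by simp
  qed
  ultimately show ?thesis using i by simp
qed

definition is_end :: "nat \<Rightarrow> nat \<Rightarrow> bool" where
  "is_end i j \<longleftrightarrow> j = 0 \<or> j = len i"

text \<open>Ends of consecutive levels are all joined, whichever ends and marks they have;
  \<open>ex_next\<close> demands each combination.\<close>

definition vadj :: "nat \<Rightarrow> nat \<Rightarrow> bool \<Rightarrow> nat \<Rightarrow> nat \<Rightarrow> bool \<Rightarrow> bool" where
  "vadj i j s i' j' s' \<longleftrightarrow> i = i' \<and> s = s' \<and> adjacent j j' \<or>
    (i' = Suc i \<or> i = Suc i') \<and> is_end i j \<and> is_end i' j'"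

definition vw :: "atom \<Rightarrow> atom \<Rightarrow> real" where
  "vw a a' = (case a of Mk m \<Rightarrow> 0 | Vx i j s \<Rightarrow>
    (case a' of Mk m \<Rightarrow> 0 | Vx i' j' s' \<Rightarrow> of_bool (vadj i j s i' j' s')))"

definition vdeg :: "atom \<Rightarrow> real" where
  "vdeg a = (\<integral>t. vw a (p t) \<partial>unif01)"

definition mark :: "nat \<Rightarrow> nat \<Rightarrow> bool \<Rightarrow> real" where
  "mark i j s = (if is_end i j then of_bool s else 1/2)"

text \<open>The labels are cut off to keep them in the unit interval on the atoms of weight 0.\<close>

definition lb :: "nat \<Rightarrow> atom \<Rightarrow> real" where
  "lb m a = (case a of Mk m \<Rightarrow> 0 | Vx i j s \<Rightarrow>
    if j \<le> len i then
      (if m = 1 then kap i else if m = 2 then real j * kap i else if m = 3 then mark i j s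
       else 1 - (kap i + real j * kap i + mark i j s) / 4 - 2 * vdeg a)
    else 0)"

definition L :: "nat \<Rightarrow> real" where
  "L m = (\<integral>t. lb m (p t) \<partial>unif01)"

text \<open>A marker of class \<open>m\<close> receives the degree \<open>L m\<close> from class 0.
  The rest has to come from class 4, of mass 1/2, which explains the factor 2.\<close>

definition g :: "nat \<Rightarrow> real" where
  "g m = 2 * (class_degree m - L m)"

text \<open>The classes 1 to 3 meet no markers but those of class 4, so each degree equation has one
  unknown; class 4 balances its own degree by its inner density.\<close>

definition G :: "nat \<Rightarrow> nat \<Rightarrow> real" where
  "G m m' = (if m = 4 \<and> m' = 4 then 2 * (class_degree 4 - L 4 - (g 1 + g 2 + g 3) / 8)
    else if m = 4 \<and> m' \<in> {1, 2, 3} then g m' else if m' = 4 \<and> m \<in> {1, 2, 3} then g m else 0)"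

definition \<omega> :: "atom \<Rightarrow> atom \<Rightarrow> real" where
  "\<omega> a a' = (case a of
    Vx i j s \<Rightarrow> (case a' of Vx i' j' s' \<Rightarrow> vw a a' | Mk m \<Rightarrow> if m \<in> {1, 2, 3, 4} then lb m a else 0)
  | Mk m \<Rightarrow> (case a' of Vx i' j' s' \<Rightarrow> if m \<in> {1, 2, 3, 4} then lb m a' else 0 | Mk m' \<Rightarrow> G m m'))"

definition W0 :: "real \<times> real \<Rightarrow> real" where
  "W0 = (\<lambda>x\<in>{0..<1} \<times> {0..<1}. \<omega> (p (fst x)) (p (snd x)))"

lemma adjacent_sym: "adjacent j j' = adjacent j' j"
  by (auto simp: adjacent_def)

lemma vw_sym: "vw a a' = vw a' a"
  by (cases a; cases a') (auto simp: vw_def vadj_def adjacent_sym)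

lemma G_sym: "G m m' = G m' m"
  by (auto simp: G_def)

lemma \<omega>_sym: "\<omega> a a' = \<omega> a' a"
  using vw_sym[of a a'] by (cases a; cases a') (simp_all add: \<omega>_def G_sym)

lemma vw_bounds: "0 \<le> vw a a'" "vw a a' \<le> of_bool (isV a')"
  by (cases a; cases a'; simp add: vw_def)+

lemma vdeg_bounds: "0 \<le> vdeg a" "vdeg a \<le> 1/8"
proof -
  show "0 \<le> vdeg a" unfolding vdeg_def by (intro Bochner_Integration.integral_nonneg vw_bounds)
  have "vdeg a \<le> (\<integral>t. of_bool (isV (p t)) \<partial>unif01)"
    unfolding vdeg_def
  proof (rule integral_mono)
    have "\<bar>vw a a'\<bar> \<le> 1" for a' using vw_bounds[of a a'] by (cases "isV a'") auto
    then show "integrable unif01 (\<lambda>t. vw a (p t))" by (rule integral_bounded)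
    show "integrable unif01 (\<lambda>t. of_bool (isV (p t)) :: real)" by (rule integral_bounded[of _ 1]) simp
  qed (rule vw_bounds)
  then show "vdeg a \<le> 1/8" by (simp add: integral_isV)
qed

lemma lb_bounds: "0 \<le> lb m a" "lb m a \<le> of_bool (isV a)"
proof -
  have "0 \<le> lb m a \<and> lb m a \<le> of_bool (isV a)"
  proof (cases a)
    case (Vx i j s)
    show ?thesis
    proof (cases "j \<le> len i")
      case True
      have "real j * kap i \<le> real (len i) * kap i"
        using True kap_pos[of i] by (intro mult_right_mono) auto
      then have j: "0 \<le> real j * kap i" "real j * kap i \<le> 1"
        using len_kap[of i] kap_pos[of i] by auto
      have "0 \<le> mark i j s" "mark i j s \<le> 1" by (auto simp: mark_def)
      moreover from this have "0 \<le> 1 - (kap i + real j * kap i + mark i j s) / 4 - 2 * vdeg a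
        \<and> 1 - (kap i + real j * kap i + mark i j s) / 4 - 2 * vdeg a \<le> 1"
        using j kap_pos[of i] kap_le[of i] vdeg_bounds[of a] by argo
      ultimately show ?thesis
        using True j kap_pos[of i] kap_le[of i] by (simp add: lb_def Vx)
    qed (simp add: lb_def Vx)
  qed (simp add: lb_def)
  then show "0 \<le> lb m a" "lb m a \<le> of_bool (isV a)" by auto
qed

lemma lb_integrable: "integrable unif01 (\<lambda>t. lb m (p t))"
proof (rule integral_bounded)
  show "\<bar>lb m a\<bar> \<le> 1" for a using lb_bounds[of m a] by (cases "isV a") auto
qed

lemma L_bounds: "0 \<le> L m" "L m \<le> 1/8"
proof -
  show "0 \<le> L m" unfolding L_def by (intro Bochner_Integration.integral_nonneg lb_bounds)
  have "L m \<le> (\<integral>t. of_bool (isV (p t)) \<partial>unif01)"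
    unfolding L_def
  proof (rule integral_mono)
    show "integrable unif01 (\<lambda>t. of_bool (isV (p t)) :: real)" by (rule integral_bounded[of _ 1]) simp
  qed (rule lb_integrable, rule lb_bounds)
  then show "L m \<le> 1/8" by (simp add: integral_isV)
qed

lemma g_bounds: "m \<in> {1, 2, 3} \<Longrightarrow> 0 \<le> g m \<and> g m \<le> 2 * class_degree m"
  using L_bounds[of m] by (auto simp: g_def class_degree_def)

text \<open>Class 4 receives at most 1/8 from class 0 and at most
  \<open>(1/4 + 1/2 + 3/4) / 8 = 3/16\<close> from the other markers, which is below its degree
  7/16.\<close>

lemma G_bounds: "0 \<le> G m m'" "G m m' \<le> 1"
proof -
  have *: "0 \<le> g 1" "g 1 \<le> 1/4" "0 \<le> g 2" "g 2 \<le> 1/2" "0 \<le> g 3" "g 3 \<le> 3/4"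
    using g_bounds[of 1] g_bounds[of 2] g_bounds[of 3] by (auto simp: class_degree_def)
  have "class_degree 4 = 7/16" by (simp add: class_degree_def)
  then have "0 \<le> 2 * (class_degree 4 - L 4 - (g 1 + g 2 + g 3) / 8) \<and>
    2 * (class_degree 4 - L 4 - (g 1 + g 2 + g 3) / 8) \<le> 1"
    using * L_bounds[of 4] by argo
  then show "0 \<le> G m m'" "G m m' \<le> 1"
    using * unfolding G_def by auto
qed

lemma \<omega>_bounds: "0 \<le> \<omega> a a'" "\<omega> a a' \<le> 1"
proof -
  have v: "0 \<le> vw a a' \<and> vw a a' \<le> 1" using vw_bounds[of a a'] by (cases "isV a'") auto
  have l: "0 \<le> lb m a \<and> lb m a \<le> 1" for m a using lb_bounds[of m a] by (cases "isV a") auto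
  have "0 \<le> \<omega> a a' \<and> \<omega> a a' \<le> 1"
  proof (cases a)
    case a: (Vx i j s)
    show ?thesis using v l[of _ a] by (cases a') (simp_all add: \<omega>_def a)
  next
    case a: (Mk m)
    show ?thesis using l[of m a'] G_bounds by (cases a') (simp_all add: \<omega>_def a)
  qed
  then show "0 \<le> \<omega> a a'" "\<omega> a a' \<le> 1" by auto
qed

lemma W0_eq: "t \<in> {0..<1} \<Longrightarrow> t' \<in> {0..<1} \<Longrightarrow> W0 (t, t') = \<omega> (p t) (p t')"
  by (simp add: W0_def)

lemma graphon_W0: "graphon W0"
  unfolding graphon_def
proof (intro conjI ballI)
  show "W0 \<in> {0..<1} \<times> {0..<1} \<rightarrow>\<^sub>E {0..1}"
    using \<omega>_bounds by (auto simp: W0_def)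
  show "W0 (x, y) = W0 (y, x)" if "x \<in> {0..<1}" "y \<in> {0..<1}" for x y
    using that by (simp add: W0_eq \<omega>_sym)
  have "(\<lambda>x. \<omega> (p (fst x)) (p (snd x))) \<in> borel_measurable (unif01 \<Otimes>\<^sub>M unif01)"
  proof (rule measurable_compose_countable[where f = "\<lambda>a x. \<omega> a (p (snd x))" and g = "\<lambda>x. p (fst x)"])
    show "(\<lambda>x. \<omega> a (p (snd x))) \<in> borel_measurable (unif01 \<Otimes>\<^sub>M unif01)" for a
      by (rule measurable_compose[OF measurable_snd p_fun_measurable])
    show "(\<lambda>x. p (fst x)) \<in> measurable (unif01 \<Otimes>\<^sub>M unif01) (count_space UNIV)"
      by (rule measurable_compose[OF measurable_fst p_measurable])
  qed
  then show "W0 \<in> borel_measurable (unif01 \<Otimes>\<^sub>M unif01)"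
    by (rule measurable_cong[THEN iffD1, rotated]) (auto simp: W0_def space_pair_measure)
qed

primrec cl :: "atom \<Rightarrow> nat" where
  "cl (Vx i j s) = 0" | "cl (Mk m) = m"

lemma integral_marker: "m \<in> {1, 2, 3, 4} \<Longrightarrow> (\<integral>t. of_bool (p t = Mk m) \<partial>unif01) = class_mass m"
  using integral_finite_support[of "{Mk m}" "\<lambda>a. of_bool (a = Mk m)"] by auto

lemma integral_markers:
  "(\<integral>t. of_bool (p t = Mk (Suc 0)) \<partial>unif01) = (1/8 :: real)" "(\<integral>t. of_bool (p t = Mk 2) \<partial>unif01) = (1/8 :: real)"
  "(\<integral>t. of_bool (p t = Mk 3) \<partial>unif01) = (1/8 :: real)" "(\<integral>t. of_bool (p t = Mk 4) \<partial>unif01) = (1/2 :: real)"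
  using integral_marker[of 1] integral_marker[of 2] integral_marker[of 3] integral_marker[of 4]
  by (simp_all add: class_mass_def)

text \<open>For vertices the fourth label was defined to make this true, for markers the numbers
  \<open>g\<close> and \<open>G\<close> were.\<close>

lemma deg_W0:
  assumes t: "t \<in> {0..<1}" shows "deg W0 t = class_degree (cl (p t))"
proof -
  have d: "deg W0 t = (\<integral>s. \<omega> (p t) (p s) \<partial>unif01)"
    unfolding deg_def by (intro Bochner_Integration.integral_cong refl) (use t in \<open>simp add: W0_eq\<close>)
  have im: "integrable unif01 (\<lambda>s. of_bool (p s = a) :: real)" for a
    by (rule integral_bounded[of _ 1]) simp
  show ?thesis
    using t
  proof (cases rule: p_cases)
    case (1 i j s)
    have iv: "integrable unif01 (\<lambda>s. vw (p t) (p s))"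
    proof (rule integral_bounded)
      show "\<bar>vw (p t) a'\<bar> \<le> 1" for a' using vw_bounds[of "p t" a'] by (cases "isV a'") auto
    qed
    have "deg W0 t = (\<integral>s. vw (p t) (p s) + (lb 1 (p t) * of_bool (p s = Mk 1) + (lb 2 (p t) * of_bool (p s = Mk 2)
        + (lb 3 (p t) * of_bool (p s = Mk 3) + lb 4 (p t) * of_bool (p s = Mk 4)))) \<partial>unif01)"
      unfolding d
    proof (intro Bochner_Integration.integral_cong refl)
      fix s' show "\<omega> (p t) (p s') = vw (p t) (p s') + (lb 1 (p t) * of_bool (p s' = Mk 1) +
        (lb 2 (p t) * of_bool (p s' = Mk 2) + (lb 3 (p t) * of_bool (p s' = Mk 3) + lb 4 (p t) * of_bool (p s' = Mk 4))))"
        by (cases "p s'") (auto simp: \<omega>_def vw_def 1)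
    qed
    also have "\<dots> = vdeg (p t) + (lb 1 (p t) / 8 + (lb 2 (p t) / 8 + (lb 3 (p t) / 8 + lb 4 (p t) / 2)))"
      using iv im by (simp add: vdeg_def integral_markers)
    also have "\<dots> = 1/2" unfolding 1(1) using 1(2) by (simp add: lb_def) (simp add: field_simps)
    finally show ?thesis by (simp add: 1 class_degree_def)
  next
    case (2 m)
    have "deg W0 t = (\<integral>s. lb m (p s) + (G m 1 * of_bool (p s = Mk 1) + (G m 2 * of_bool (p s = Mk 2)
        + (G m 3 * of_bool (p s = Mk 3) + G m 4 * of_bool (p s = Mk 4)))) \<partial>unif01)"
      unfolding d
    proof (intro Bochner_Integration.integral_cong refl)
      fix s' assume "s' \<in> space unif01"
      then have s': "s' \<in> {0..<1}" by simp
      show "\<omega> (p t) (p s') = lb m (p s') + (G m 1 * of_bool (p s' = Mk 1) +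
        (G m 2 * of_bool (p s' = Mk 2) + (G m 3 * of_bool (p s' = Mk 3) + G m 4 * of_bool (p s' = Mk 4))))"
        using s' by (cases rule: p_cases) (use 2 in \<open>auto simp: \<omega>_def lb_def\<close>)
    qed
    also have "\<dots> = L m + (G m 1 / 8 + (G m 2 / 8 + (G m 3 / 8 + G m 4 / 2)))"
      using lb_integrable im by (simp add: L_def integral_markers)
    also have "\<dots> = class_degree m" using 2(2) by (auto simp: G_def g_def[of m] field_simps)
    finally show ?thesis by (simp add: 2)
  qed
qed

lemma cl_less: "t \<in> {0..<1} \<Longrightarrow> cl (p t) < 5"
  by (erule p_cases) auto

lemma ind_W0: "t \<in> {0..<1} \<Longrightarrow> m < 5 \<Longrightarrow> ind W0 m t = of_bool (m = cl (p t))"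
  by (simp add: ind_def deg_W0 lagrange_class_degree cl_less)

lemma cl_0: "t \<in> {0..<1} \<Longrightarrow> cl (p t) = 0 \<longleftrightarrow> isV (p t)"
  by (erule p_cases) auto

lemma cl_marker: "t \<in> {0..<1} \<Longrightarrow> m \<in> {1, 2, 3, 4} \<Longrightarrow> cl (p t) = m \<longleftrightarrow> p t = Mk m"
  by (erule p_cases) auto

lemma lab_W0:
  assumes t: "t \<in> {0..<1}" "isV (p t)" and m: "m \<in> {1, 2, 3, 4}"
  shows "lab W0 m t = lb m (p t)"
proof -
  have "lab W0 m t = (\<integral>s. lb m (p t) / class_mass m * of_bool (p s = Mk m) \<partial>unif01)"
    unfolding lab_def
  proof (intro Bochner_Integration.integral_cong refl)
    fix s assume "s \<in> space unif01"
    then have s: "s \<in> {0..<1}" by simp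
    have "ind W0 m s = of_bool (p s = Mk m)"
      using ind_W0[OF s, of m] cl_marker[OF s m] m by auto
    then show "W0 (t, s) * (1 / class_mass m * ind W0 m s) = lb m (p t) / class_mass m * of_bool (p s = Mk m)"
      using t s m by (cases "p t") (auto simp: W0_eq \<omega>_def)
  qed
  also have "\<dots> = lb m (p t)" using integral_marker[OF m] by (auto simp: class_mass_def)
  finally show ?thesis .
qed

end

lemma eval_Integ_eq_0:
  assumes "\<And>t. t \<in> {0..<1} \<Longrightarrow> eval W a (x(k := t)) = 0"
  shows "eval W (Integ k a) x = 0"
proof -
  have "eval W (Integ k a) x = (\<integral>t. 0 \<partial>unif01)"
    unfolding eval.simps by (intro Bochner_Integration.integral_cong refl) (use assms in simp)
  then show ?thesis by simp
qed

lemma atom_mass_mult: "0 < k \<Longrightarrow> (1 + k) * atom_mass k = k\<^sup>2 / 16"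
  by (simp add: atom_mass_def field_simps)

section \<open>Verification of the identities\<close>

context model
begin

lemma integral_one_atom:
  assumes "\<And>t. t \<in> {0..<1} \<Longrightarrow> h t = (if p t = a then c else 0)"
  shows "(\<integral>t. h t \<partial>unif01) = c * weight a"
proof -
  have "(\<integral>t. h t \<partial>unif01) = (\<integral>t. (if p t = a then c else 0) \<partial>unif01)"
    by (intro Bochner_Integration.integral_cong refl) (use assms in simp)
  also have "\<dots> = (\<Sum>b\<in>{a}. (if b = a then c else 0) * weight b)"
    by (rule integral_finite_support[of "{a}" "\<lambda>b. if b = a then c else 0"]) auto
  finally show ?thesis by simp
qed

lemma vertex_cases:
  assumes "t \<in> {0..<1}"
  obtains i j s where "p t = Vx i j s" "j \<le> len i" "ind W0 0 t = 1"
  | "\<not> isV (p t)" "ind W0 0 t = 0"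
proof -
  have i: "ind W0 0 t = of_bool (isV (p t))"
    using ind_W0[OF assms, of 0] cl_0[OF assms] by auto
  show thesis
    using assms
  proof (cases rule: p_cases)
    case (1 i j s) then show ?thesis using that(1)[of i j s] i by simp
  next
    case (2 m) then show ?thesis using that(2) i by simp
  qed
qed

lemma marker_ind: "t \<in> {0..<1} \<Longrightarrow> m \<in> {1, 2, 3, 4} \<Longrightarrow> ind W0 m t = of_bool (p t = Mk m)"
  using ind_W0[of t m] cl_marker[of t m] by auto

lemma labels:
  assumes "t \<in> {0..<1}" "p t = Vx i j s" "j \<le> len i"
  shows "lab W0 1 t = kap i" "lab W0 (Suc 0) t = kap i" "lab W0 2 t = real j * kap i" "lab W0 3 t = mark i j s"
    "lab W0 4 t = 1 - (kap i + real j * kap i + mark i j s) / 4 - 2 * vdeg (Vx i j s)"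
  using lab_W0[of t 1] lab_W0[of t 2] lab_W0[of t 3] lab_W0[of t 4] assms by (simp_all add: lb_def)

lemma W0_vertices:
  assumes "t \<in> {0..<1}" "p t = Vx i j s" "t' \<in> {0..<1}" "p t' = Vx i' j' s'"
  shows "W0 (t, t') = of_bool (vadj i j s i' j' s')"
  using assms by (simp add: W0_eq \<omega>_def vw_def)

lemma phi_kap: "phi (kap i) (kap i) = (kap i)\<^sup>2" "phi (kap i) (kap (Suc i)) = 0" "phi (kap (Suc i)) (kap i) = 0"
  by (simp_all add: phi_def kap_Suc power2_eq_square)

lemma vadj_cases:
  assumes "vadj i j s i' j' s'"
  obtains "i' = i" "s' = s" "j' = j" | "i' = i" "s' = s" "j' = Suc j" | "i' = i" "s' = s" "j = Suc j'"
  | "i' = Suc i" "is_end i j" "is_end i' j'" | "i = Suc i'" "is_end i j" "is_end i' j'"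
proof -
  consider "i = i'" "s = s'" "j \<le> Suc j'" "j' \<le> Suc j" | "i' = Suc i" "is_end i j" "is_end i' j'"
    | "i = Suc i'" "is_end i j" "is_end i' j'"
    using assms unfolding vadj_def adjacent_def by blast
  then show thesis
  proof cases
    case 1
    then consider "j' = j" | "j' = Suc j" | "j = Suc j'" by linarith
    then show thesis using that(1-3) 1 by cases auto
  qed (use that(4,5) in auto)
qed

text \<open>\<open>phi\<close> removes the neighbours of other levels, and the remaining three cases
  differ in the position. For \<open>bstep\<close> the case is described by
  \<open>Suc j' = j\<close>, as there is no preceding atom to name when
  \<open>j = 0\<close>.\<close>

lemma steps:
  assumes t: "t \<in> {0..<1}" "p t = Vx i j s" "j \<le> len i"
    and t': "t' \<in> {0..<1}" "p t' = Vx i' j' s'" "j' \<le> len i'"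
    and a: "vadj i j s i' j' s'"
  shows "chi W0 t t' = (if p t' = Vx i j s then kap i ^ 4 else 0)"
    "fstep W0 t t' = (if p t' = Vx i (Suc j) s then 2 * kap i ^ 4 else 0)"
    "bstep W0 t t' = (if Suc j' = j \<and> i' = i then 2 * kap i ^ 4 else 0)"
proof -
  note l = labels[OF t] labels[OF t']
  have "chi W0 t t' = (if p t' = Vx i j s then kap i ^ 4 else 0) \<and>
    fstep W0 t t' = (if p t' = Vx i (Suc j) s then 2 * kap i ^ 4 else 0) \<and>
    bstep W0 t t' = (if Suc j' = j \<and> i' = i then 2 * kap i ^ 4 else 0)"
    using a
  proof (cases rule: vadj_cases)
    case 1
    then show ?thesis
      by (simp add: chi_def fstep_def bstep_def l phi_kap t'(2) power2_eq_square power4_eq_xxxx)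
  next
    case 2
    then show ?thesis
      by (simp add: chi_def fstep_def bstep_def l phi_kap t'(2) power2_eq_square power4_eq_xxxx algebra_simps)
  next
    case 3
    then show ?thesis
      by (simp add: chi_def fstep_def bstep_def l phi_kap t'(2) power2_eq_square power4_eq_xxxx algebra_simps)
  next
    case 4
    then show ?thesis by (simp add: chi_def fstep_def bstep_def l phi_kap t'(2))
  next
    case 5
    then show ?thesis by (simp add: chi_def fstep_def bstep_def l phi_kap t'(2))
  qed
  then show "chi W0 t t' = (if p t' = Vx i j s then kap i ^ 4 else 0)"
    "fstep W0 t t' = (if p t' = Vx i (Suc j) s then 2 * kap i ^ 4 else 0)"
    "bstep W0 t t' = (if Suc j' = j \<and> i' = i then 2 * kap i ^ 4 else 0)" by blast+
qed

lemma is_end_label: "is_end i j \<Longrightarrow> real j * kap i = 0 \<and> j = 0 \<or> real j * kap i = 1 \<and> j = len i"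
  using len_kap[of i] by (auto simp: is_end_def)

lemma vadj_refl: "vadj i j s i j s" and vadj_Suc: "vadj i j s i (Suc j) s" "vadj i (Suc j) s i j s"
  by (auto simp: vadj_def adjacent_def)

lemma vdeg_interior:
  assumes "j \<le> len i" "\<not> is_end i j" shows "vdeg (Vx i j s) = 3 * atom_mass (kap i)"
proof -
  from assms obtain k where k: "j = Suc k" "Suc j \<le> len i" by (cases j) (auto simp: is_end_def)
  have "vdeg (Vx i j s) = (\<Sum>a\<in>{Vx i k s, Vx i j s, Vx i (Suc j) s}. vw (Vx i j s) a * weight a)"
    unfolding vdeg_def
  proof (rule integral_finite_support)
    fix t assume n: "p t \<notin> {Vx i k s, Vx i j s, Vx i (Suc j) s}"
    show "vw (Vx i j s) (p t) = 0"
    proof (cases "p t")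
      case (Vx i' j' s')
      have "\<not> vadj i j s i' j' s'"
      proof
        assume "vadj i j s i' j' s'"
        then show False by (cases rule: vadj_cases) (use n Vx k assms in auto)
      qed
      then show ?thesis by (simp add: vw_def Vx)
    qed (simp add: vw_def)
  qed simp
  also have "\<dots> = 3 * atom_mass (kap i)"
    using k by (simp add: vw_def vadj_refl vadj_Suc)
  finally show ?thesis .
qed

lemma eval_degree: "eval W0 ex_degree x = 0"
  unfolding ex_degree_def
proof (rule eval_Integ_eq_0)
  fix t :: real assume t: "t \<in> {0..<1}"
  have "cl (p t) \<in> {0, 1, 2, 3, 4}" using cl_less[OF t] by auto
  then show "eval W0 (Sq (Prods (map (\<lambda>l. Deg 0 \<ominus> Const (class_degree l)) [0, 1, 2, 3, 4]))) (x(0 := t)) = 0"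
    using t by (auto simp: deg_W0)
qed

lemma eval_mass:
  assumes "m \<in> {1, 2, 3, 4}" shows "eval W0 (ex_mass m) x = 0"
proof -
  have "(\<integral>t. ind W0 m t \<partial>unif01) = 1 * weight (Mk m)"
    by (rule integral_one_atom) (use marker_ind assms in auto)
  then show ?thesis using assms by (auto simp: ex_mass_def)
qed

lemma eval_twin:
  assumes m: "m \<in> {1, 2, 3, 4}" shows "eval W0 (ex_twin m) x = 0"
proof -
  have tw: "eval W0 (Twin m i j) y = 0" if y: "y i \<in> {0..<1}" "y j \<in> {0..<1}" for i j y
    using y(1)
  proof (cases rule: vertex_cases)
    case (1 i' j' s')
    have "ind W0 m (y j) * (W0 (y i, y j) - lab W0 m (y i)) = 0"
    proof (cases "p (y j) = Mk m")
      case True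
      have "W0 (y i, y j) = lab W0 m (y i)"
        using lab_W0[OF y(1) _ m] 1 m True y by (simp add: W0_eq \<omega>_def)
      then show ?thesis by simp
    next
      case False then show ?thesis using marker_ind[OF y(2) m] by simp
    qed
    then show ?thesis by (simp add: Twin_def)
  qed (simp add: Twin_def)
  show ?thesis
    unfolding ex_twin_def
  proof (intro eval_Integ_eq_0)
    fix t0 t1 t2 t3 :: real assume "t0 \<in> {0..<1}" "t1 \<in> {0..<1}" "t2 \<in> {0..<1}" "t3 \<in> {0..<1}"
    then have "eval W0 (Twin m 0 2) (x(0 := t0, 1 := t1, 2 := t2, 3 := t3)) = 0"
      by (intro tw) auto
    then show "eval W0 (Twin m 0 2 \<odot> Twin m 0 3 \<odot> Twin m 1 2 \<odot> Twin m 1 3)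
      (x(0 := t0, 1 := t1, 2 := t2, 3 := t3)) = 0" by (simp only: eval.simps mult_zero_left)
  qed
qed

lemma eval_label: "eval W0 ex_label x = 0"
  unfolding ex_label_def
proof (rule eval_Integ_eq_0, goal_cases)
  case (1 t)
  then show ?case
  proof (cases rule: vertex_cases)
    case v: (1 i j s)
    note l = labels[OF 1 v(1,2)]
    show ?thesis
    proof (cases "is_end i j")
      case True
      then have "mark i j s = 0 \<or> mark i j s = 1" "real j * kap i = 0 \<or> real j * kap i = 1"
        using is_end_label[OF True] by (auto simp: mark_def)
      then show ?thesis by (auto simp: l)
    next
      case False
      then have m: "mark i j s = 1/2" by (simp add: mark_def)
      \<comment> \<open>The three atoms seen by an interior vertex appear twice in the fourth label
        because class 4 has mass 1/2.\<close>
      have "lab W0 4 t - 1 + 1/4 * (kap i + real j * kap i + 1/2) = - 6 * atom_mass (kap i)"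
        unfolding l m vdeg_interior[OF v(2) False] by argo
      then have "(1 + kap i) * (lab W0 4 t - 1 + 1/4 * (kap i + real j * kap i + 1/2)) + 3/8 * (kap i)\<^sup>2
        = 3/8 * (kap i)\<^sup>2 - 6 * ((1 + kap i) * atom_mass (kap i))" by simp
      also have "\<dots> = 0" unfolding atom_mass_mult[OF kap_pos] by simp
      finally show ?thesis by (simp add: l(1-4) m)
    qed
  qed simp
qed

lemma eval_edge: "eval W0 ex_edge x = 0"
  unfolding ex_edge_def
proof (intro eval_Integ_eq_0, goal_cases)
  case (1 t t')
  show ?case
    using 1(1)
  proof (cases rule: vertex_cases)
    case v: (1 i j s)
    show ?thesis
      using 1(2)
    proof (cases rule: vertex_cases)
      case v': (1 i' j' s')
      note l = labels[OF 1(1) v(1,2)] labels[OF 1(2) v'(1,2)]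
      show ?thesis
      proof (cases "vadj i j s i' j' s'")
        case True
        note st = steps(1)[OF 1(1) v(1,2) 1(2) v'(1,2) True]
        from True show ?thesis
          by (cases rule: vadj_cases) (auto simp: l st v' kap_Suc mark_def)
      next
        case False
        then show ?thesis using W0_vertices[OF 1(1) v(1) 1(2) v'(1)] by simp
      qed
    qed simp
  qed simp
qed

text \<open>Where \<open>W0 (t, t') * chi W0 t t'\<close> is nonzero, \<open>t\<close> and
  \<open>t'\<close> lie in the same atom and have the same row. The product then contains
  \<open>w * (1 - w)\<close> for a value \<open>w\<close> of 0 or 1.\<close>

lemma triangle_zero:
  assumes "t \<in> {0..<1}" "t' \<in> {0..<1}" "t'' \<in> {0..<1}"
  shows "(ind W0 0 t)\<^sup>2 * ((ind W0 0 t')\<^sup>2 * ((ind W0 0 t'')\<^sup>2 * (W0 (t, t') * ((chi W0 t t')\<^sup>2 *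
    (W0 (t, t'') * (1 - W0 (t', t'')))))) ) = 0" (is ?A)
    "(ind W0 0 t)\<^sup>2 * ((ind W0 0 t')\<^sup>2 * ((ind W0 0 t'')\<^sup>2 * (W0 (t, t') * ((chi W0 t t')\<^sup>2 *
    (W0 (t', t'') * (1 - W0 (t, t'')))))) ) = 0" (is ?B)
proof -
  have "?A \<and> ?B"
    using assms(1)
  proof (cases rule: vertex_cases)
    case v: (1 i j s)
    show ?thesis
      using assms(2)
    proof (cases rule: vertex_cases)
      case v': (1 i' j' s')
      show ?thesis
      proof (cases "vadj i j s i' j' s' \<and> p t' = p t")
        case True
        then have "W0 (t', t'') = W0 (t, t'')" using assms by (simp add: W0_eq)
        moreover have "W0 (t, t'') * (1 - W0 (t, t'')) = 0" if "ind W0 0 t'' \<noteq> 0"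
          using assms(3)
        proof (cases rule: vertex_cases)
          case (1 i'' j'' s'')
          then show ?thesis using W0_vertices[OF assms(1) v(1) assms(3)] by simp
        qed (use that in simp)
        ultimately show ?thesis by (cases "ind W0 0 t'' = 0") auto
      next
        case False
        have "W0 (t, t') * (chi W0 t t')\<^sup>2 = 0"
        proof (cases "vadj i j s i' j' s'")
          case True
          then show ?thesis
            using steps(1)[OF assms(1) v(1,2) assms(2) v'(1,2)] False v by simp
        qed (use W0_vertices[OF assms(1) v(1) assms(2) v'(1)] in simp)
        then show ?thesis by auto
      qed
    qed simp
  qed simp
  then show ?A ?B by auto
qed

lemma eval_congr: "eval W0 ex_congr x = 0" "eval W0 ex_congr' x = 0"
  unfolding ex_congr_def ex_congr'_def
  by (intro eval_Integ_eq_0; use triangle_zero in simp)+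

lemma eval_closed: "eval W0 ex_closed x = 0"
  unfolding ex_closed_def
proof (intro eval_Integ_eq_0, goal_cases)
  case (1 t0 t1 t2)
  note g = graphon_W0
  have s: "W0 (t0, t1) = W0 (t1, t0)" "W0 (t0, t2) = W0 (t2, t0)"
    using graphon_sym[OF g] 1 by auto
  show ?case using triangle_zero(1)[OF 1(2,3,1)] by (auto simp: s)
qed

text \<open>In each of the neighbourhood identities a single atom carries the whole
  integral.\<close>

lemma step_integral:
  assumes t: "t \<in> {0..<1}" "p t = Vx i j s" "j \<le> len i"
    and h: "\<And>t' i' j' s'. t' \<in> {0..<1} \<Longrightarrow> p t' = Vx i' j' s' \<Longrightarrow> j' \<le> len i' \<Longrightarrow> vadj i j s i' j' s' \<Longrightarrow>
      h t' = (if p t' = Vx ia ja sa then c else 0)"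
    and a: "vadj i j s ia ja sa" "ja \<le> len ia"
  shows "(\<integral>t'. (ind W0 0 t')\<^sup>2 * (W0 (t, t') * h t') \<partial>unif01) = c * atom_mass (kap ia)"
proof -
  have "(\<integral>t'. (ind W0 0 t')\<^sup>2 * (W0 (t, t') * h t') \<partial>unif01) = c * weight (Vx ia ja sa)"
  proof (rule integral_one_atom)
    fix t' :: real assume t': "t' \<in> {0..<1}"
    then show "(ind W0 0 t')\<^sup>2 * (W0 (t, t') * h t') = (if p t' = Vx ia ja sa then c else 0)"
    proof (cases rule: vertex_cases)
      case v: (1 i' j' s')
      show ?thesis
        using W0_vertices[OF t(1,2) t' v(1)] h[OF t' v(1,2)] v a by (cases "vadj i j s i' j' s'") auto
    qed auto
  qed
  then show ?thesis using a by simp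
qed

lemma eval_step: "eval W0 ex_step x = 0"
  unfolding ex_step_def
proof (rule eval_Integ_eq_0, goal_cases)
  case (1 t)
  then show ?case
  proof (cases rule: vertex_cases)
    case v: (1 i j s)
    note l = labels[OF 1 v(1,2)]
    show ?thesis
    proof (cases "j = len i")
      case True
      then show ?thesis using len_kap[of i] by (auto simp: l mark_def is_end_def)
    next
      case False
      have "(\<integral>t'. (ind W0 0 t')\<^sup>2 * (W0 (t, t') * fstep W0 t t') \<partial>unif01) = 2 * kap i ^ 4 * atom_mass (kap i)"
        by (rule step_integral[OF 1 v(1,2), where ia = i and ja = "Suc j" and sa = s])
          (use steps(2)[OF 1 v(1,2)] vadj_Suc False v(2) in auto)
      moreover have "(1 + kap i) * (2 * kap i ^ 4 * atom_mass (kap i)) = 2 * kap i ^ 4 * ((1 + kap i) * atom_mass (kap i))"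
        by (simp add: algebra_simps)
      ultimately show ?thesis
        by (simp add: l atom_mass_mult[OF kap_pos] power2_eq_square power4_eq_xxxx)
    qed
  qed simp
qed

lemma eval_back: "eval W0 ex_back x = 0"
  unfolding ex_back_def
proof (rule eval_Integ_eq_0, goal_cases)
  case (1 t)
  then show ?case
  proof (cases rule: vertex_cases)
    case v: (1 i j s)
    note l = labels[OF 1 v(1,2)]
    show ?thesis
    proof (cases j)
      case 0
      then show ?thesis by (auto simp: l mark_def is_end_def)
    next
      case (Suc k)
      have "(\<integral>t'. (ind W0 0 t')\<^sup>2 * (W0 (t, t') * bstep W0 t t') \<partial>unif01) = 2 * kap i ^ 4 * atom_mass (kap i)"
      proof (rule step_integral[OF 1 v(1,2), where ia = i and ja = k and sa = s])
        fix t' i' j' s' assume t': "t' \<in> {0..<1}" "p t' = Vx i' j' s'" "j' \<le> len i'" and a: "vadj i j s i' j' s'"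
        have "i' = i \<Longrightarrow> s' = s" using a by (auto simp: vadj_def)
        then show "bstep W0 t t' = (if p t' = Vx i k s then 2 * kap i ^ 4 else 0)"
          using steps(3)[OF 1 v(1,2) t' a] t' Suc by auto
      qed (use vadj_Suc Suc v(2) in auto)
      moreover have "(1 + kap i) * (2 * kap i ^ 4 * atom_mass (kap i)) = 2 * kap i ^ 4 * ((1 + kap i) * atom_mass (kap i))"
        by (simp add: algebra_simps)
      ultimately show ?thesis
        by (simp add: l(1,2) atom_mass_mult[OF kap_pos] power2_eq_square power4_eq_xxxx)
    qed
  qed simp
qed

lemma eval_atom: "eval W0 ex_atom x = 0"
  unfolding ex_atom_def
proof (rule eval_Integ_eq_0, goal_cases)
  case (1 t)
  then show ?case
  proof (cases rule: vertex_cases)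
    case v: (1 i j s)
    note l = labels[OF 1 v(1,2)]
    have "(\<integral>t'. (ind W0 0 t')\<^sup>2 * (W0 (t, t') * chi W0 t t') \<partial>unif01) = kap i ^ 4 * atom_mass (kap i)"
      by (rule step_integral[OF 1 v(1,2), where ia = i and ja = j and sa = s])
        (use steps(1)[OF 1 v(1,2)] vadj_refl v(2) in auto)
    moreover have "(1 + kap i) * (kap i ^ 4 * atom_mass (kap i)) = kap i ^ 4 * ((1 + kap i) * atom_mass (kap i))"
      by (simp add: algebra_simps)
    ultimately show ?thesis
      by (simp add: l(1,2) atom_mass_mult[OF kap_pos] power2_eq_square power4_eq_xxxx)
  qed simp
qed

lemma eval_next: "eval W0 (ex_next \<alpha> \<beta>) x = 0"
  unfolding ex_next_def
proof (rule eval_Integ_eq_0, goal_cases)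
  case (1 t)
  then show ?case
  proof (cases rule: vertex_cases)
    case v: (1 i j s)
    note l = labels[OF 1 v(1,2)]
    show ?thesis
    proof (cases "is_end i j")
      case False
      then show ?thesis by (simp add: l mark_def)
    next
      case True
      \<comment> \<open>\<alpha> picks the end and \<beta> the strand, which leaves one of the four
        end atoms of the next level.\<close>
      let ?j = "if \<alpha> then len (Suc i) else 0"
      have e: "is_end (Suc i) ?j" by (simp add: is_end_def)
      have "(\<integral>t'. (ind W0 0 t')\<^sup>2 * (W0 (t, t') * (((kap i - lab W0 1 t') * (2 * kap i - lab W0 1 t')) *
          (select \<alpha> (lab W0 2 t') * select \<beta> (lab W0 3 t')))) \<partial>unif01)
        = 3/4 * (kap i)\<^sup>2 * atom_mass (kap (Suc i))"
      proof (rule step_integral[OF 1 v(1,2), where ia = "Suc i" and ja = ?j and sa = \<beta>])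
        fix t' i' j' s' assume t': "t' \<in> {0..<1}" "p t' = Vx i' j' s'" "j' \<le> len i'" and a: "vadj i j s i' j' s'"
        note l' = labels[OF t']
        from a show "((kap i - lab W0 1 t') * (2 * kap i - lab W0 1 t')) *
          (select \<alpha> (lab W0 2 t') * select \<beta> (lab W0 3 t')) = (if p t' = Vx (Suc i) ?j \<beta> then 3/4 * (kap i)\<^sup>2 else 0)"
        proof (cases rule: vadj_cases)
          case 4
          have "len (Suc i) \<noteq> 0" using len_ge[of "Suc i"] by simp
          moreover have m: "mark i' j' s' = of_bool s'" using 4 by (simp add: mark_def)
          ultimately have "select \<alpha> (lab W0 2 t') * select \<beta> (lab W0 3 t') = of_bool (p t' = Vx (Suc i) ?j \<beta>)"
            unfolding l' m using is_end_label[OF 4(3)] 4(1) t'(2) by (auto simp: select_def)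
          moreover have "(kap i - lab W0 1 t') * (2 * kap i - lab W0 1 t') = 3/4 * (kap i)\<^sup>2"
            unfolding l' 4(1) kap_Suc by (simp add: field_simps power2_eq_square)
          ultimately show ?thesis by simp
        qed (auto simp: l' t' kap_Suc)
      next
        show "vadj i j s (Suc i) ?j \<beta>" using e True by (simp add: vadj_def)
      qed simp
      moreover have "(1 + 1/2 * kap i) * (3/4 * (kap i)\<^sup>2 * atom_mass (kap (Suc i))) = 3/256 * ((kap i)\<^sup>2)\<^sup>2"
      proof -
        have "(1 + 1/2 * kap i) * (3/4 * (kap i)\<^sup>2 * atom_mass (kap (Suc i))) =
          3/4 * (kap i)\<^sup>2 * ((1 + kap (Suc i)) * atom_mass (kap (Suc i)))"
          by (simp add: kap_Suc algebra_simps)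
        also have "\<dots> = 3/256 * ((kap i)\<^sup>2)\<^sup>2"
          unfolding atom_mass_mult[OF kap_pos] by (simp add: kap_Suc power2_eq_square)
        finally show ?thesis .
      qed
      ultimately have "(1 + 1/2 * kap i) * (\<integral>t'. (ind W0 0 t')\<^sup>2 * (W0 (t, t') * (((kap i - lab W0 1 t') * (2 * kap i - lab W0 1 t')) *
          (select \<alpha> (lab W0 2 t') * select \<beta> (lab W0 3 t')))) \<partial>unif01) - 3/256 * ((kap i)\<^sup>2)\<^sup>2 = 0"
        by (simp only: diff_self)
      then show ?thesis by (simp add: l(1,2))
    qed
  qed simp
qed

lemma eval_pos: "0 < eval W0 ex_pos x"
proof -
  let ?a = "Vx 0 0 False"
  have "0 < kap 0 * weight ?a"
    using atom_mass_pos kap_pos by simp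
  also have "\<dots> = (\<integral>t. (if p t = ?a then kap 0 else 0) \<partial>unif01)"
    by (rule integral_one_atom[symmetric]) simp
  also have "\<dots> \<le> (\<integral>t. lb 1 (p t) \<partial>unif01)"
  proof (rule integral_mono)
    show "integrable unif01 (\<lambda>t. if p t = ?a then kap 0 else 0)"
      by (rule integral_bounded[of "\<lambda>a. if a = ?a then kap 0 else 0" "kap 0"]) (use kap_pos[of 0] in auto)
    show "(if p t = ?a then kap 0 else 0) \<le> lb 1 (p t)" for t
      using lb_bounds(1)[of 1 "p t"] by (auto simp: lb_def)
  qed (rule lb_integrable)
  also have "\<dots> = (\<integral>t. (ind W0 0 t)\<^sup>2 * lab W0 1 t \<partial>unif01)"
  proof (intro Bochner_Integration.integral_cong refl)
    fix t assume "t \<in> space unif01"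
    then have t: "t \<in> {0..<1}" by simp
    then show "lb 1 (p t) = (ind W0 0 t)\<^sup>2 * lab W0 1 t"
    proof (cases rule: vertex_cases)
      case (1 i j s) then show ?thesis using lab_W0[OF t, of 1] by simp
    next
      case 2 then show ?thesis by (cases "p t") (simp_all add: lb_def)
    qed
  qed
  also have "\<dots> = eval W0 ex_pos x" by (simp add: ex_pos_def)
  finally show ?thesis .
qed

lemma structured_W0: "structured W0"
  unfolding structured_def zero_exprs_def
  using graphon_W0 eval_pos
  by (simp add: eval_degree eval_mass[simplified] eval_twin[simplified] eval_label eval_edge eval_closed
    eval_congr eval_step eval_back eval_atom eval_next)

end

lemma structured_exists: "\<exists>W. structured W"
proof -
  obtain P where P: "\<And>a. pmf P a = weight a" using weight_pmf by blast
  show ?thesis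
  proof (rule partition_exists[of P])
    fix p
    assume "\<And>a. {t \<in> {0..<1}. p t = a} \<in> sets unif01"
      "\<And>a. measure unif01 {t \<in> {0..<1}. p t = a} = pmf P a"
      "\<And>t. t \<in> {0..<1} \<Longrightarrow> p t \<in> set_pmf P"
    then have "model p" by (simp add: model_def P set_pmf_iff)
    then show ?thesis using model.structured_W0 by blast
  qed
qed

subsection \<open>The family\<close>

lemma density_equiv_trans:
  "density_equiv N W1 W2 \<Longrightarrow> density_equiv N W2 W3 \<Longrightarrow> density_equiv N W1 W3"
  by (simp add: density_equiv_def)

lemma density_equiv_mono: "density_equiv N W W' \<Longrightarrow> M \<le> N \<Longrightarrow> density_equiv M W W'"
  by (auto simp: density_equiv_def)

lemma card_vertices_bounded:
  fixes m :: nat and F :: "nat \<Rightarrow> graph"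
  obtains M where "\<forall>i\<in>{1..m}. card (fst (F i)) \<le> M"
proof (rule that)
  show "\<forall>i\<in>{1..m}. card (fst (F i)) \<le> (\<Sum>i\<in>{1..m}. card (fst (F i)))"
    by (intro ballI member_le_sum) auto
qed

lemma weak_class_eqD:
  assumes "graphon W'" "weak_isomorphism_class W' = weak_isomorphism_class W"
  shows "weakly_isomorphic W' W"
proof -
  have "W' \<in> weak_isomorphism_class W'"
    using assms(1) by (simp add: weak_isomorphism_class_def weakly_isomorphic_def)
  then show ?thesis unfolding assms(2) by (simp add: weak_isomorphism_class_def)
qed

text \<open>Members are counted up to weak isomorphism: as functions, a nonempty selection would be
  infinite anyway, since changes on null sets preserve all densities. Nonemptiness rules out the
  empty family, which unattainable densities would describe.\<close>

theorem theorem19: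
  shows "\<exists>(\<W> :: (real \<times> real \<Rightarrow> real) set) (l :: nat) (H :: nat \<Rightarrow> graph) (d :: nat \<Rightarrow> real).
    \<W> \<noteq> {} \<and> (\<forall>W\<in>\<W>. graphon W) \<and> (\<forall>i\<in>{1..l}. finite_graph (H i)) \<and>
    (\<forall>W. graphon W \<longrightarrow>
       ((\<exists>W'\<in>\<W>. weakly_isomorphic W W') \<longleftrightarrow> (\<forall>i\<in>{1..l}. graph_density (H i) W = d i))) \<and>
    (\<forall>W\<in>\<W>. \<not> finitely_forcible W) \<and>
    (\<forall>(r :: nat) (H' :: nat \<Rightarrow> graph) (d' :: nat \<Rightarrow> real).
       (\<forall>i\<in>{1..r}. finite_graph (H' i)) \<longrightarrow>
       {W \<in> \<W>. \<forall>i\<in>{1..r}. graph_density (H' i) W = d' i} = {} \<or>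
       infinite (weak_isomorphism_class ` {W \<in> \<W>. \<forall>i\<in>{1..r}. graph_density (H' i) W = d' i}))"
proof -
  obtain V where V: "structured V" using structured_exists by blast
  then have gV: "graphon V" by (simp add: structured_def)
  obtain N where N: "\<And>W W'. structured W \<Longrightarrow> graphon W' \<Longrightarrow> density_equiv N W W' \<Longrightarrow> structured W'"
    by (rule structured_determined) blast
  \<comment> \<open>Weakly isomorphic graphons are in the family together, so being weakly
    isomorphic to a member means having the densities of \<open>V\<close> on the finitely many
    graphs in \<open>Gs\<close>.\<close>
  define \<W> where "\<W> = {W. graphon W \<and> density_equiv N V W}"
  define Gs :: "graph set" where "Gs = (\<Union>n\<le>N. Pair {..<n} ` Pow (edges n))"
  have "finite Gs" by (simp add: Gs_def)
  then obtain H where "bij_betw H {1..card Gs} Gs" using ex_bij_betw_nat_finite_1 by blast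
  then have H: "H ` {1..card Gs} = Gs" by (rule bij_betw_imp_surj_on)
  have fin: "finite_graph G" if "G \<in> Gs" for G
  proof -
    from that obtain n E where "G = ({..<n}, E)" "E \<subseteq> edges n" by (auto simp: Gs_def)
    then show ?thesis by (simp add: finite_graph_def edges_def)
  qed
  \<comment> \<open>Agreement up to order \<open>N\<close> keeps the new graphon in the family, and
    agreement up to order \<open>M\<close> hides it from the given graphs.\<close>
  have neighbour: "\<exists>W'\<in>\<W>. density_equiv M W W' \<and> \<not> weakly_isomorphic W' W" if W: "W \<in> \<W>" for W M
  proof -
    have "structured W" using N[OF V] W by (simp add: \<W>_def)
    then obtain W' where W': "graphon W'" "density_equiv (max M N) W W'" "\<not> weakly_isomorphic W' W"
      by (rule structured_not_forced)
    have "density_equiv N V W'"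
      by (rule density_equiv_trans[OF _ density_equiv_mono[OF W'(2)]]) (use W in \<open>auto simp: \<W>_def\<close>)
    moreover have "density_equiv M W W'" by (rule density_equiv_mono[OF W'(2)]) simp
    ultimately show ?thesis using W' by (auto simp: \<W>_def)
  qed
  have forced: "(\<exists>W'\<in>\<W>. weakly_isomorphic W W') \<longleftrightarrow>
      (\<forall>i\<in>{1..card Gs}. graph_density (H i) W = graph_density (H i) V)" if W: "graphon W" for W
  proof
    assume "\<exists>W'\<in>\<W>. weakly_isomorphic W W'"
    then obtain W' where W': "density_equiv N V W'" "weakly_isomorphic W W'" by (auto simp: \<W>_def)
    have "graph_density G W = graph_density G V" if "G \<in> Gs" for G
    proof -
      have "card (fst G) \<le> N" using that by (auto simp: Gs_def)
      then show ?thesis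
        using W' fin[OF that] unfolding density_equiv_def weakly_isomorphic_def by metis
    qed
    then show "\<forall>i\<in>{1..card Gs}. graph_density (H i) W = graph_density (H i) V" using H by blast
  next
    assume eq: "\<forall>i\<in>{1..card Gs}. graph_density (H i) W = graph_density (H i) V"
    have "density_equiv N V W"
    proof (rule density_equivI[OF gV W])
      fix n E assume "n \<le> N" "E \<subseteq> edges n"
      then have "({..<n}, E) \<in> Gs" unfolding Gs_def by blast
      then have "({..<n}, E) \<in> H ` {1..card Gs}" using H by simp
      then show "graph_density ({..<n}, E) V = graph_density ({..<n}, E) W" using eq by auto
    qed
    then have "W \<in> \<W>" using W by (simp add: \<W>_def)
    then show "\<exists>W'\<in>\<W>. weakly_isomorphic W W'" by (auto simp: weakly_isomorphic_def)
  qed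
  have not_forcible: "\<not> finitely_forcible W" if W: "W \<in> \<W>" for W
  proof
    assume "finitely_forcible W"
    then obtain m F where F: "\<forall>i\<in>{1..m::nat}. finite_graph (F i)"
      and f: "\<And>W'. graphon W' \<Longrightarrow> (\<forall>i\<in>{1..m}. graph_density (F i) W' = graph_density (F i) W)
          \<Longrightarrow> weakly_isomorphic W' W"
      unfolding finitely_forcible_def by blast
    obtain M where M: "\<forall>i\<in>{1..m}. card (fst (F i)) \<le> M"
      by (rule card_vertices_bounded)
    obtain W' where W': "W' \<in> \<W>" "density_equiv M W W'" "\<not> weakly_isomorphic W' W"
      using neighbour[OF W] by blast
    have "graph_density (F i) W' = graph_density (F i) W" if "i \<in> {1..m}" for i
      using W'(2) F M that by (metis density_equiv_def)
    then show False using f[of W'] W' by (simp add: \<W>_def)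
  qed
  \<comment> \<open>For each \<open>k\<close> there is a member \<open>w k\<close> that agrees with
    \<open>W\<close> up to order \<open>k\<close> but is not weakly isomorphic to it. With finitely
    many classes, one class would contain \<open>w k\<close> for infinitely many \<open>k\<close>,
    so its members would agree with \<open>W\<close> on every graph.\<close>
  have many: "infinite (weak_isomorphism_class ` S)"
    if H': "\<forall>i\<in>{1..r::nat}. finite_graph (H' i)"
      and S: "S = {W \<in> \<W>. \<forall>i\<in>{1..r}. graph_density (H' i) W = d' i}" and ne: "S \<noteq> {}" for r H' d' S
  proof
    assume fin': "finite (weak_isomorphism_class ` S)"
    from ne obtain W where W: "W \<in> S" by blast
    obtain M where M: "\<forall>i\<in>{1..r}. card (fst (H' i)) \<le> M"
      by (rule card_vertices_bounded)
    have "\<exists>W'\<in>S. density_equiv k W W' \<and> \<not> weakly_isomorphic W' W" for k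
    proof -
      obtain W' where W': "W' \<in> \<W>" "density_equiv (max k M) W W'" "\<not> weakly_isomorphic W' W"
        using neighbour[of W "max k M"] W S by blast
      have "density_equiv M W W'" "density_equiv k W W'"
        by (rule density_equiv_mono[OF W'(2)], simp)+
      moreover have "W' \<in> S"
      proof -
        have "graph_density (H' i) W = graph_density (H' i) W'" if "i \<in> {1..r}" for i
          using \<open>density_equiv M W W'\<close> H' M that by (metis density_equiv_def)
        then show ?thesis using W W' by (simp add: S)
      qed
      ultimately show ?thesis using W' by blast
    qed
    then obtain w where w: "\<And>k. w k \<in> S" "\<And>k. density_equiv k W (w k)" "\<And>k. \<not> weakly_isomorphic (w k) W"
      by metis
    have "finite ((\<lambda>k. weak_isomorphism_class (w k)) ` UNIV)"
      by (rule finite_subset[OF _ fin']) (use w in auto)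
    from pigeonhole_infinite[OF infinite_UNIV_nat this] obtain k
      where k: "infinite {m. weak_isomorphism_class (w m) = weak_isomorphism_class (w k)}" by auto
    from w(3)[of k] obtain G where G: "finite_graph G" "graph_density G (w k) \<noteq> graph_density G W"
      by (auto simp: weakly_isomorphic_def)
    from k obtain m where m: "card (fst G) \<le> m" "weak_isomorphism_class (w m) = weak_isomorphism_class (w k)"
      unfolding infinite_nat_iff_unbounded_le by blast
    have "graphon (w m)" using w(1)[of m] by (simp add: S \<W>_def)
    from weak_class_eqD[OF this m(2)] have "graph_density G (w m) = graph_density G (w k)"
      using G unfolding weakly_isomorphic_def by blast
    moreover have "graph_density G W = graph_density G (w m)"
      using w(2)[of m] G m unfolding density_equiv_def by blast
    ultimately show False using G by simp
  qed
  have "V \<in> \<W>" using gV by (simp add: \<W>_def density_equiv_def)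
  then have "\<W> \<noteq> {}" by blast
  moreover have "\<forall>i\<in>{1..card Gs}. finite_graph (H i)" using fin H by blast
  ultimately show ?thesis
  proof (intro exI conjI)
    show "\<forall>W\<in>\<W>. graphon W" by (simp add: \<W>_def)
    show "\<forall>W. graphon W \<longrightarrow> ((\<exists>W'\<in>\<W>. weakly_isomorphic W W') \<longleftrightarrow>
      (\<forall>i\<in>{1..card Gs}. graph_density (H i) W = graph_density (H i) V))"
      using forced by blast
    show "\<forall>W\<in>\<W>. \<not> finitely_forcible W" using not_forcible by blast
    show "\<forall>(r :: nat) (H' :: nat \<Rightarrow> graph) (d' :: nat \<Rightarrow> real). (\<forall>i\<in>{1..r}. finite_graph (H' i)) \<longrightarrow>
      {W \<in> \<W>. \<forall>i\<in>{1..r}. graph_density (H' i) W = d' i} = {} \<or>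
      infinite (weak_isomorphism_class ` {W \<in> \<W>. \<forall>i\<in>{1..r}. graph_density (H' i) W = d' i})"
    proof (intro allI impI)
      fix r :: nat and H' :: "nat \<Rightarrow> graph" and d' :: "nat \<Rightarrow> real"
      assume "\<forall>i\<in>{1..r}. finite_graph (H' i)"
      from many[OF this refl, of d']
      show "{W \<in> \<W>. \<forall>i\<in>{1..r}. graph_density (H' i) W = d' i} = {} \<or>
        infinite (weak_isomorphism_class ` {W \<in> \<W>. \<forall>i\<in>{1..r}. graph_density (H' i) W = d' i})"
        by blast
    qed
  qed
qed

end
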